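(* Consider the second order partial differential equation for $u=u(x,t)$ $$P(u,u_x,u_t,u_{xx},u_{xt},u_{tt},\varepsilon)=0, \qquad ( * )$$ where $\mathcal W\subset\mathbb R^{6}$ is open, $\mathcal I\subset\mathbb R$ is an open interval containing $0$, $P:\mathcal W\times\mathcal I\to\mathbb R$ is a sufficiently smooth function and $\varepsilon\in\mathcal I$ is a small parameter. Assume that $( * )$ satisfies Property $\mathcal A$ (defined in the context) for some $c\in\mathbb R$, where $\ell\ge 1$ denotes the number of simple zeroes of the function $M_c$ appearing in that property. Then: (a) For $\varepsilon=0$ the equation $( * )$ has a continuum of periodic traveling wave solutions $u=U_h(x-ct)$, for $h$ in an open real interval. (b) For all $\varepsilon$ small enough, the equation $( * )$ has at least $\ell$ periodic traveling wave solutions $u=U_{h_j}(x-ct,\varepsilon)$, $j=1,2,\ldots,\ell$.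
   Context: Traveling waves. A traveling wave solution (TWS) of speed $c$ of $( * )$ is a solution $u(x,t)=U(x-ct)$ with $U(s)$ defined for all $s\in\mathbb R$; equivalently $U$ is a solution, defined for all $s$, of the ODE $P_c(U,U',U'',\varepsilon)=0$, where $P_c(x,y,z,\varepsilon):=P(x,y,-cy,z,-cz,c^2z,\varepsilon)$ is defined for $(x,y,z)$ in the open set $\mathcal W_c=\{(x,y,z)\in\mathbb R^3:(x,y,-cy,z,-cz,c^2z)\in\mathcal W\}$ and $\varepsilon\in\mathcal I$. It is periodic if $U$ is a nonconstant periodic function. Two TWS are regarded as the same if they differ by a translation of $s$. Property $\mathcal A$. The equation $( * )$ satisfies Property $\mathcal A$ for $c\in\mathbb R$ if the following three conditions hold. (i) There are open sets $\mathcal V_c(\varepsilon)\subset\mathbb R^2$ ($\varepsilon\in\mathcal I$), such that $\{(x,y,\varepsilon):\varepsilon\in\mathcal I,\ (x,y)\in\mathcal V_c(\varepsilon)\}$ is open in $\mathbb R^3$, and $\mathcal C^1$ functions $f_c(x,y)$ (defined on the sets $\mathcal V_c(\varepsilon)$ and not depending on $\varepsilon$) and $g_c(x,y,\varepsilon)$ (defined for $\varepsilon\in\mathcal I$, $(x,y)\in\mathcal V_c(\varepsilon)$) such that, for $\varepsilon$ small enough, $$\{(x,y,z):(x,y)\in\mathcal V_c(\varepsilon),\ z=f_c(x,y)+\varepsilon g_c(x,y,\varepsilon)\}\subset\{(x,y,z)\in\mathcal W_c: P_c(x,y,z,\varepsilon)=0\}.$$ Moreover, let $\mathcal V_c:=\mathcal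 V_c(0)$ be the limit of the sets $\mathcal V_c(\varepsilon)$ as $\varepsilon\to0$. The only solution of $f_c(x,0)=0$ with $(x,0)\in\mathcal V_c$ is $x=x_c$. (ii) There exist a $\mathcal C^2$ function $H_c:\mathcal V_c\to[0,\infty)$ with $H_c(x_c,0)=0$ and a $\mathcal C^1$ function $s_c:\mathcal V_c\to(0,\infty)$ such that $$\frac{\partial H_c}{\partial y}(x,y)=\frac{y}{s_c(x,y)},\qquad \frac{\partial H_c}{\partial x}(x,y)=-\frac{f_c(x,y)}{s_c(x,y)}.$$ (iii) There is $\overline h_c\in(0,\infty]$ such that for each $h\in(0,\overline h_c)$ the set $\gamma_c(h):=\{(x,y)\in\mathcal V_c: H_c(x,y)=h\}$ is a closed oval (a simple closed curve) surrounding $(x_c,0)$, and the function $M_c:(0,\overline h_c)\to\mathbb R$ given by the line integral $$M_c(h)=\int_{\gamma_c(h)}\frac{g_c(x,y,0)}{s_c(x,y)}\,dx$$ (ovals oriented by the flow $\dot x=\partial H_c/\partial y$, $\dot y=-\partial H_c/\partial x$) has $\ell\ge1$ simple zeroes $h_1,\dots,h_\ell$ in $(0,\overline h_c)$. A zero $h^*$ is simple if $M_c(h^* )=0$ and $M_c'(h^* )\neq0$. *)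

theory Defs
  imports "HOL-Analysis.Analysis"
begin

definition C1_on :: "'a::real_normed_vector set \<Rightarrow> ('a \<Rightarrow> 'b::real_normed_vector) \<Rightarrow> bool" where
  "C1_on S f \<longleftrightarrow>
     (\<exists>f' :: 'a \<Rightarrow> 'a \<Rightarrow>\<^sub>L 'b.
        (\<forall>x\<in>S. (f has_derivative blinfun_apply (f' x)) (at x)) \<and> continuous_on S f')"

definition C2_on :: "'a::real_normed_vector set \<Rightarrow> ('a \<Rightarrow> 'b::real_normed_vector) \<Rightarrow> bool" where
  "C2_on S f \<longleftrightarrow>
     (\<exists>f' :: 'a \<Rightarrow> 'a \<Rightarrow>\<^sub>L 'b.
        (\<forall>x\<in>S. (f has_derivative blinfun_apply (f' x)) (at x)) \<and> C1_on S f')"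

type_synonym jet = "real \<times> real \<times> real \<times> real \<times> real \<times> real"

definition Dx :: "(real \<Rightarrow> real \<Rightarrow> real) \<Rightarrow> real \<Rightarrow> real \<Rightarrow> real" where
  "Dx u x t = deriv (\<lambda>\<xi>. u \<xi> t) x"

definition Dt :: "(real \<Rightarrow> real \<Rightarrow> real) \<Rightarrow> real \<Rightarrow> real \<Rightarrow> real" where
  "Dt u x t = deriv (\<lambda>\<tau>. u x \<tau>) t"

definition jet_of :: "(real \<Rightarrow> real \<Rightarrow> real) \<Rightarrow> real \<Rightarrow> real \<Rightarrow> jet" where
  "jet_of u x t =
     (u x t, Dx u x t, Dt u x t, Dx (Dx u) x t, Dt (Dx u) x t, Dt (Dt u) x t)"

text \<open>Classical solutions on the whole \<open>(x,t)\<close>-plane. Since \<open>u\<close> is of class C2, all the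
  \<^const>\<open>deriv\<close>s in \<^const>\<open>jet_of\<close> exist.\<close>

definition pde_solution :: "(jet \<Rightarrow> real \<Rightarrow> real) \<Rightarrow> jet set \<Rightarrow> real \<Rightarrow> (real \<Rightarrow> real \<Rightarrow> real) \<Rightarrow> bool" where
  "pde_solution P W \<epsilon> u \<longleftrightarrow>
     C2_on UNIV (\<lambda>(x, t). u x t) \<and>
     (\<forall>x t. jet_of u x t \<in> W \<and> P (jet_of u x t) \<epsilon> = 0)"

definition traveling_wave :: "(jet \<Rightarrow> real \<Rightarrow> real) \<Rightarrow> jet set \<Rightarrow> real \<Rightarrow> real \<Rightarrow> (real \<Rightarrow> real) \<Rightarrow> bool" where
  "traveling_wave P W \<epsilon> c U \<longleftrightarrow> pde_solution P W \<epsilon> (\<lambda>x t. U (x - c * t))"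

definition periodic_wave :: "(jet \<Rightarrow> real \<Rightarrow> real) \<Rightarrow> jet set \<Rightarrow> real \<Rightarrow> real \<Rightarrow> (real \<Rightarrow> real) \<Rightarrow> bool" where
  "periodic_wave P W \<epsilon> c U \<longleftrightarrow>
     traveling_wave P W \<epsilon> c U \<and> (\<exists>T>0. \<forall>s. U (s + T) = U s) \<and> \<not> U constant_on UNIV"

definition same_wave :: "(real \<Rightarrow> real) \<Rightarrow> (real \<Rightarrow> real) \<Rightarrow> bool" where
  "same_wave U U' \<longleftrightarrow> (\<exists>a. \<forall>s. U' s = U (s + a))"

definition wave_jet :: "real \<Rightarrow> real \<times> real \<times> real \<Rightarrow> jet" where
  "wave_jet c = (\<lambda>(x, y, z). (x, y, - c * y, z, - c * z, c\<^sup>2 * z))"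

definition W_c :: "jet set \<Rightarrow> real \<Rightarrow> (real \<times> real \<times> real) set" where
  "W_c W c = {w. wave_jet c w \<in> W}"

definition P_c :: "(jet \<Rightarrow> real \<Rightarrow> real) \<Rightarrow> real \<Rightarrow> real \<times> real \<times> real \<Rightarrow> real \<Rightarrow> real" where
  "P_c P c w \<epsilon> = P (wave_jet c w) \<epsilon>"

definition simple_closed_param :: "(real \<times> real) set \<Rightarrow> (real \<Rightarrow> real \<times> real) \<Rightarrow> bool" where
  "simple_closed_param \<Gamma> p \<longleftrightarrow> simple_path p \<and> pathfinish p = pathstart p \<and> path_image p = \<Gamma>"

definition oval_around :: "(real \<times> real) set \<Rightarrow> real \<times> real \<Rightarrow> bool" where
  "oval_around \<Gamma> z \<longleftrightarrow> (\<exists>p. simple_closed_param \<Gamma> p) \<and> z \<in> inside \<Gamma>"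

definition oriented_param ::
  "(real \<times> real \<Rightarrow> real \<times> real) \<Rightarrow> (real \<times> real) set \<Rightarrow> (real \<Rightarrow> real \<times> real) \<Rightarrow> bool" where
  "oriented_param X \<Gamma> p \<longleftrightarrow>
     simple_closed_param \<Gamma> p \<and> p C1_differentiable_on {0..1} \<and>
     (\<forall>t\<in>{0..1}. \<exists>r>0. vector_derivative p (at t) = r *\<^sub>R X (p t))"

text \<open>The integral of \<open>k dx\<close> over \<open>\<Gamma>\<close>. Its value does not depend on the parametrization; when
  \<open>\<Gamma>\<close> is a closed orbit of a C1 field \<open>X\<close> without zeros on \<open>\<Gamma>\<close>, the orbit itself, rescaled to
  the unit interval, is such a parametrization.\<close>

definition line_integral_dx ::
  "(real \<times> real \<Rightarrow> real \<times> real) \<Rightarrow> (real \<times> real) set \<Rightarrow> (real \<times> real \<Rightarrow> real) \<Rightarrow> real" where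
  "line_integral_dx X \<Gamma> k =
     (THE J. \<exists>p. oriented_param X \<Gamma> p \<and>
        ((\<lambda>t. k (p t) * fst (vector_derivative p (at t))) has_integral J) {0..1})"

definition hamiltonian_field :: "(real \<times> real \<Rightarrow> real) \<Rightarrow> real \<times> real \<Rightarrow> real \<times> real" where
  "hamiltonian_field H = (\<lambda>(x, y). (deriv (\<lambda>\<eta>. H (x, \<eta>)) y, - deriv (\<lambda>\<xi>. H (\<xi>, y)) x))"

text \<open>Openness of the total set in \<open>(x,y,\<epsilon>)\<close> already forces every compact subset of \<open>V 0\<close> to
  lie in \<open>V \<epsilon>\<close> for small \<open>\<epsilon>\<close>; no further convergence of \<open>V \<epsilon>\<close> to \<open>V 0\<close> is required.\<close>

definition property_A_i ::
  "(jet \<Rightarrow> real \<Rightarrow> real) \<Rightarrow> jet set \<Rightarrow> real set \<Rightarrow> real \<Rightarrow> (real \<Rightarrow> (real \<times> real) set) \<Rightarrow>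
   (real \<times> real \<Rightarrow> real) \<Rightarrow> (real \<times> real \<times> real \<Rightarrow> real) \<Rightarrow> real \<Rightarrow> bool" where
  "property_A_i P W I c V f g xc \<longleftrightarrow>
     (\<forall>\<epsilon>\<in>I. open (V \<epsilon>)) \<and>
     open {(x, y, \<epsilon>). \<epsilon> \<in> I \<and> (x, y) \<in> V \<epsilon>} \<and>
     C1_on (\<Union>\<epsilon>\<in>I. V \<epsilon>) f \<and>
     C1_on {(x, y, \<epsilon>). \<epsilon> \<in> I \<and> (x, y) \<in> V \<epsilon>} g \<and>
     (\<exists>\<epsilon>\<^sub>1>0. \<forall>\<epsilon>\<in>I. \<bar>\<epsilon>\<bar> < \<epsilon>\<^sub>1 \<longrightarrow>
        {(x, y, z). (x, y) \<in> V \<epsilon> \<and> z = f (x, y) + \<epsilon> * g (x, y, \<epsilon>)}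
          \<subseteq> {w \<in> W_c W c. P_c P c w \<epsilon> = 0}) \<and>
     {x. (x, 0) \<in> V 0 \<and> f (x, 0) = 0} = {xc}"

definition property_A_ii ::
  "(real \<times> real) set \<Rightarrow> (real \<times> real \<Rightarrow> real) \<Rightarrow> real \<Rightarrow>
   (real \<times> real \<Rightarrow> real) \<Rightarrow> (real \<times> real \<Rightarrow> real) \<Rightarrow> bool" where
  "property_A_ii V\<^sub>0 f xc H s \<longleftrightarrow>
     C2_on V\<^sub>0 H \<and> (\<forall>z\<in>V\<^sub>0. H z \<ge> 0) \<and> H (xc, 0) = 0 \<and>
     C1_on V\<^sub>0 s \<and> (\<forall>z\<in>V\<^sub>0. s z > 0) \<and>
     (\<forall>(x, y)\<in>V\<^sub>0.
        ((\<lambda>\<eta>. H (x, \<eta>)) has_real_derivative y / s (x, y)) (at y) \<and>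
        ((\<lambda>\<xi>. H (\<xi>, y)) has_real_derivative - (f (x, y) / s (x, y))) (at x))"

definition level_oval :: "(real \<times> real) set \<Rightarrow> (real \<times> real \<Rightarrow> real) \<Rightarrow> real \<Rightarrow> (real \<times> real) set" where
  "level_oval V\<^sub>0 H h = {z \<in> V\<^sub>0. H z = h}"

definition melnikov ::
  "(real \<times> real) set \<Rightarrow> (real \<times> real \<times> real \<Rightarrow> real) \<Rightarrow>
   (real \<times> real \<Rightarrow> real) \<Rightarrow> (real \<times> real \<Rightarrow> real) \<Rightarrow> real \<Rightarrow> real" where
  "melnikov V\<^sub>0 g H s h =
     line_integral_dx (hamiltonian_field H) (level_oval V\<^sub>0 H h) (\<lambda>(x, y). g (x, y, 0) / s (x, y))"

definition simple_zero :: "(real \<Rightarrow> real) \<Rightarrow> real \<Rightarrow> bool" where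
  "simple_zero M h \<longleftrightarrow> M h = 0 \<and> (\<exists>D. D \<noteq> 0 \<and> (M has_real_derivative D) (at h))"

text \<open>The \<open>L\<close> distinct simple zeros listed need not be all of them.\<close>

definition property_A_iii ::
  "(real \<times> real) set \<Rightarrow> (real \<times> real \<times> real \<Rightarrow> real) \<Rightarrow> real \<Rightarrow>
   (real \<times> real \<Rightarrow> real) \<Rightarrow> (real \<times> real \<Rightarrow> real) \<Rightarrow> nat \<Rightarrow> bool" where
  "property_A_iii V\<^sub>0 g xc H s L \<longleftrightarrow>
     L \<ge> 1 \<and>
     (\<exists>hbar :: ereal. hbar > 0 \<and>
        (\<forall>h>0. ereal h < hbar \<longrightarrow> oval_around (level_oval V\<^sub>0 H h) (xc, 0)) \<and>
        (\<exists>hz :: nat \<Rightarrow> real. inj_on hz {1..L} \<and>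
           (\<forall>j\<in>{1..L}. 0 < hz j \<and> ereal (hz j) < hbar \<and> simple_zero (melnikov V\<^sub>0 g H s) (hz j))))"

definition property_A ::
  "(jet \<Rightarrow> real \<Rightarrow> real) \<Rightarrow> jet set \<Rightarrow> real set \<Rightarrow> real \<Rightarrow> nat \<Rightarrow> bool" where
  "property_A P W I c L \<longleftrightarrow>
     (\<exists>V f g xc H s.
        property_A_i P W I c V f g xc \<and>
        property_A_ii (V 0) f xc H s \<and>
        property_A_iii (V 0) g xc H s L)"

end

theory Submission
  imports Defs
begin

text \<open>
  On a level curve of \<open>H\<close> the system \<open>x' = y, y' = f(x,y)\<close> has no equilibrium, so every level oval is
  a single periodic orbit; this gives the continuum of waves for \<open>\<epsilon> = 0\<close>. For small \<open>\<epsilon>\<close> take a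
  segment of the axis \<open>y = 0\<close> through a level oval with \<open>M(h\<^sub>j) = 0\<close>. The orbit of \<open>(x,0)\<close> returns
  to the axis at a time \<open>\<tau>(x,\<epsilon>)\<close>, and along it \<open>H\<close> changes by \<open>\<epsilon> \<Delta>(x,\<epsilon>)\<close>, where \<open>\<Delta>\<close> is the integral
  of \<open>g y / s\<close> up to time \<open>\<tau>\<close>. Since \<open>H\<close> is strictly monotone on the segment, the orbit closes as soon as
  \<open>\<Delta>(x,\<epsilon>) = 0\<close>. At \<open>\<epsilon> = 0\<close> the value \<open>\<Delta>(x,0)\<close> is a positive multiple of \<open>M(H(x,0))\<close>, which changes
  sign at a simple zero; by continuity \<open>\<Delta>(\<cdot>,\<epsilon>)\<close> still changes sign for small \<open>\<epsilon>\<close>, and the intermediate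
  value theorem applies. Waves from different zeros are distinct because \<open>H\<close> stays close to
  \<open>h\<^sub>j\<close> along them.
\<close>

section \<open>Globally Lipschitz vector fields\<close>

text \<open>The change of \<open>H\<close> over one return is not expanded in
  \<open>\<epsilon>\<close>. It equals \<open>\<epsilon>\<close> times the accumulated integrand
  exactly, so the factor cancels, and what remains is continuous up to
  \<open>\<epsilon> = 0\<close>, where it is compared with \<open>M\<close>. A multiple of
  \<open>M\<close> appears because the crossing used may close the orbit after several minimal
  periods; the factor is a positive integer and leaves the sign alone. Three obstacles shape the
  rest. The data live on open sets that vary with \<open>\<epsilon>\<close>, so on a compact
  neighbourhood of one oval they are replaced by globally Lipschitz extensions, and each orbit must
  be shown to stay where extension and data agree. The ovals are given only as topological circles,
  so that an orbit runs around a whole oval is derived from order on the line: a circle without a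
  point is an arc. Finally, \<open>M\<close> is a definite description over all oriented
  parametrizations, and each of these has to be matched with the orbit by a change of time.\<close>

definition prim :: "(real \<Rightarrow> 'a::euclidean_space) \<Rightarrow> real \<Rightarrow> 'a" where
  "prim G t = (if 0 \<le> t then integral {0..t} G else - integral {t..0} G)"

lemma prim_0 [simp]: "prim G 0 = 0"
  by (simp add: prim_def)

lemma prim_has_vector_derivative:
  assumes "continuous_on UNIV G"
  shows "(prim G has_vector_derivative G t) (at t)"
proof -
  define n where "n = \<bar>t\<bar> + 1"
  have n: "n > 0" "- n < t" "t < n" by (auto simp: n_def)
  have int: "G integrable_on {a..b}" for a b
    using assms continuous_on_subset integrable_continuous_real by blast
  \<comment> \<open>Up to a constant, both signs in the definition of \<open>prim\<close> give one
    integral from a common left end \<open>- n\<close>, to which the fundamental theorem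
    applies.\<close>
  have eq: "integral {-n..u} G - integral {-n..0} G = prim G u" if "u \<in> {-n<..<n}" for u
  proof (cases "0 \<le> u")
    case True
    then show ?thesis
      using Henstock_Kurzweil_Integration.integral_combine[OF _ _ int, of "-n" 0 u] n
      by (auto simp: prim_def algebra_simps)
  next
    case False
    then show ?thesis
      using Henstock_Kurzweil_Integration.integral_combine[OF _ _ int, of "-n" u 0] that
      by (auto simp: prim_def algebra_simps)
  qed
  have "((\<lambda>u. integral {-n..u} G) has_vector_derivative G t) (at t within {-n..n})"
    using n by (intro integral_has_vector_derivative continuous_on_subset[OF assms]) auto
  then have "((\<lambda>u. integral {-n..u} G) has_vector_derivative G t) (at t)"
    using n by (simp add: at_within_Icc_at)
  then have "((\<lambda>u. integral {-n..u} G - integral {-n..0} G) has_vector_derivative G t) (at t)"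
    by (auto intro!: derivative_eq_intros)
  then show ?thesis
    by (rule has_vector_derivative_transform_within_open[of _ _ _ "{-n<..<n}"]) (use n eq in auto)
qed

lemma has_vector_derivative_shift:
  assumes "(z has_vector_derivative d) (at (t + s))"
  shows "((\<lambda>t. z (t + s)) has_vector_derivative d) (at t)"
proof -
  have "((\<lambda>t. t + s) has_vector_derivative 1) (at t)" by (auto intro!: derivative_eq_intros)
  from vector_diff_chain_at[OF this assms] show ?thesis by (simp add: o_def)
qed

lemma has_vector_derivative_reflect:
  assumes "(z has_vector_derivative d) (at (- t))"
  shows "((\<lambda>t. z (- t)) has_vector_derivative - d) (at t)"
proof -
  have "((\<lambda>t. - t) has_vector_derivative - 1) (at t)" by (auto intro!: derivative_eq_intros)
  from vector_diff_chain_at[OF this assms] show ?thesis by (simp add: o_def)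
qed

text \<open>Integrating the weight \<open>exp (k * \<bar>t\<bar>)\<close> gains a factor
  \<open>1 / k\<close>. This gain is what beats the Lipschitz constant in the Picard iteration;
  negative times follow by reflection.\<close>

lemma exponential_growth_bound:
  fixes h G :: "real \<Rightarrow> 'a::euclidean_space"
  assumes "k > 0" and "h 0 = 0"
    and d: "\<And>t. (h has_vector_derivative G t) (at t)"
    and b: "\<And>t. norm (G t) \<le> B * exp (k * \<bar>t\<bar>)"
  shows "norm (h t) \<le> B / k * exp (k * \<bar>t\<bar>)"
proof -
  have B: "B \<ge> 0" using b[of 0] norm_ge_zero[of "G 0"] by (simp del: norm_ge_zero)
  have pos: "norm (f t) \<le> B / k * exp (k * t)"
    if t: "0 \<le> t" and f0: "f 0 = 0" and df: "\<And>s. (f has_vector_derivative F s) (at s)"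
      and bF: "\<And>s. norm (F s) \<le> B * exp (k * \<bar>s\<bar>)" for t and f F :: "real \<Rightarrow> 'a"
  proof (cases "t = 0")
    case True then show ?thesis using B \<open>k > 0\<close> f0 by simp
  next
    case False
    have "norm (f t - f 0) \<le> B / k * exp (k * t) - B / k * exp (k * 0)"
    proof (rule differentiable_bound_general)
      show "0 < t" using False t by simp
      show "continuous_on {0..t} f"
        by (meson df continuous_at_imp_continuous_on has_vector_derivative_continuous)
      show "continuous_on {0..t} (\<lambda>t. B / k * exp (k * t))" by (intro continuous_intros)
      show "(f has_vector_derivative F x) (at x)" for x by (rule df)
      show "((\<lambda>t. B / k * exp (k * t)) has_vector_derivative B * exp (k * x)) (at x)" for x
        using \<open>k > 0\<close> unfolding has_real_derivative_iff_has_vector_derivative[symmetric]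
        by (auto intro!: derivative_eq_intros)
      show "norm (F x) \<le> B * exp (k * x)" if "0 < x" for x using bF[of x] that by simp
    qed
    moreover have "B / k \<ge> 0" using B \<open>k > 0\<close> by simp
    ultimately show ?thesis using f0 by simp
  qed
  show ?thesis
  proof (cases "0 \<le> t")
    case True
    then show ?thesis using pos[OF True \<open>h 0 = 0\<close> d b] by simp
  next
    case False
    have "((\<lambda>s. h (- s)) has_vector_derivative - G (- s)) (at s)" for s
      by (intro has_vector_derivative_reflect d)
    moreover have "norm (- G (- s)) \<le> B * exp (k * \<bar>s\<bar>)" for s using b[of "- s"] by simp
    ultimately have "norm (h (- (- t))) \<le> B / k * exp (k * (- t))"
      using False \<open>h 0 = 0\<close> by (intro pos[of "- t" "\<lambda>s. h (- s)" "\<lambda>s. - G (- s)"]) auto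
    then show ?thesis using False by simp
  qed
qed

text \<open>Picard iteration contracts in the weighted norm \<open>sup |u(t)| exp (- (L + 1) |t|)\<close>, which gives
  the solution on the whole line at once; the fixed point below is the weighted displacement.\<close>

lemma lipschitz_ode_exists:
  fixes X :: "'a::euclidean_space \<Rightarrow> 'a"
  assumes lip: "L-lipschitz_on UNIV X"
  shows "\<exists>z. z 0 = p \<and> (\<forall>t. (z has_vector_derivative X (z t)) (at t))"
proof -
  \<comment> \<open>Any exponent above \<open>L\<close> makes the contraction factor
    \<open>L / k\<close> less than 1; \<open>L + 1\<close> is positive even for
    \<open>L = 0\<close>.\<close>
  define k where "k = L + 1"
  have L: "L \<ge> 0" using lip by (rule lipschitz_on_nonneg)
  have k: "k > 0" using L by (simp add: k_def)
  have contX: "continuous_on UNIV X" using lip by (rule lipschitz_on_continuous_on)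
  define G where "G u s = X (p + exp (k * \<bar>s\<bar>) *\<^sub>R apply_bcontfun u s)" for u s
  have contG: "continuous_on UNIV (G u)" for u
    unfolding G_def by (rule continuous_on_compose2[OF contX]) (auto intro!: continuous_intros)
  define \<Psi> where "\<Psi> u t = exp (- k * \<bar>t\<bar>) *\<^sub>R prim (G u) t" for u t
  have normG: "norm (G u s) \<le> (norm (X p) + L * norm u) * exp (k * \<bar>s\<bar>)" for u s
  proof -
    have "norm (G u s - X p) \<le> L * norm ((p + exp (k * \<bar>s\<bar>) *\<^sub>R apply_bcontfun u s) - p)"
      unfolding G_def by (rule lipschitz_on_normD[OF lip]) auto
    also have "\<dots> = L * exp (k * \<bar>s\<bar>) * norm (apply_bcontfun u s)" by simp
    also have "\<dots> \<le> L * exp (k * \<bar>s\<bar>) * norm u"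
      using L by (intro mult_left_mono norm_bounded) auto
    finally have "norm (G u s) \<le> norm (X p) + L * exp (k * \<bar>s\<bar>) * norm u"
      using norm_triangle_ineq2[of "G u s" "X p"] by linarith
    also have "\<dots> \<le> norm (X p) * exp (k * \<bar>s\<bar>) + L * exp (k * \<bar>s\<bar>) * norm u"
      using k mult_left_mono[of 1 "exp (k * \<bar>s\<bar>)" "norm (X p)"] by simp
    finally show ?thesis by (simp add: algebra_simps)
  qed
  have \<Psi>: "\<Psi> u \<in> bcontfun" for u
  proof (rule bcontfun_normI)
    have "continuous_on UNIV (prim (G u))"
      using prim_has_vector_derivative[OF contG]
      by (meson continuous_at_imp_continuous_on has_vector_derivative_continuous)
    then show "continuous_on UNIV (\<Psi> u)"
      unfolding \<Psi>_def by (intro continuous_intros)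
    fix t
    have "norm (prim (G u) t) \<le> (norm (X p) + L * norm u) / k * exp (k * \<bar>t\<bar>)"
      by (rule exponential_growth_bound[OF k prim_0 prim_has_vector_derivative[OF contG] normG])
    then show "norm (\<Psi> u t) \<le> (norm (X p) + L * norm u) / k"
      by (simp add: \<Psi>_def exp_minus field_simps)
  qed
  have contr: "dist (Bcontfun (\<Psi> u)) (Bcontfun (\<Psi> v)) \<le> L / k * dist u v" for u v
  proof (rule dist_bound)
    fix t
    have "norm (prim (G u) t - prim (G v) t) \<le> (L * dist u v) / k * exp (k * \<bar>t\<bar>)"
    proof (rule exponential_growth_bound[OF k])
      show "((\<lambda>t. prim (G u) t - prim (G v) t) has_vector_derivative G u t - G v t) (at t)" for t
        by (intro derivative_intros prim_has_vector_derivative contG)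
      show "norm (G u s - G v s) \<le> L * dist u v * exp (k * \<bar>s\<bar>)" for s
      proof -
        have "norm (G u s - G v s) \<le> L * norm ((p + exp (k * \<bar>s\<bar>) *\<^sub>R apply_bcontfun u s)
            - (p + exp (k * \<bar>s\<bar>) *\<^sub>R apply_bcontfun v s))"
          unfolding G_def by (rule lipschitz_on_normD[OF lip]) auto
        also have "\<dots> = L * exp (k * \<bar>s\<bar>) * dist (apply_bcontfun u s) (apply_bcontfun v s)"
          by (simp add: dist_norm flip: scaleR_diff_right)
        also have "\<dots> \<le> L * exp (k * \<bar>s\<bar>) * dist u v"
          using L by (intro mult_left_mono dist_bounded) auto
        finally show ?thesis by (simp add: algebra_simps)
      qed
    qed simp
    then have "exp (- k * \<bar>t\<bar>) * norm (prim (G u) t - prim (G v) t) \<le> L / k * dist u v"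
      by (simp add: exp_minus field_simps)
    then show "dist (apply_bcontfun (Bcontfun (\<Psi> u)) t) (apply_bcontfun (Bcontfun (\<Psi> v)) t)
        \<le> L / k * dist u v"
      by (simp add: Bcontfun_inverse \<Psi> dist_norm \<Psi>_def flip: scaleR_diff_right)
  qed
  have "\<exists>!u. Bcontfun (\<Psi> u) = u"
    by (rule banach_fix_type[of "L / k"]) (use L k contr in \<open>auto simp: k_def\<close>)
  then obtain u where u: "Bcontfun (\<Psi> u) = u" by blast
  define z where "z t = p + prim (G u) t" for t
  have "apply_bcontfun u t = \<Psi> u t" for t using u \<Psi> by (metis Bcontfun_inverse)
  then have "exp (k * \<bar>t\<bar>) *\<^sub>R apply_bcontfun u t = prim (G u) t" for t
    by (simp add: \<Psi>_def exp_minus)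
  then have Gz: "G u t = X (z t)" for t by (simp add: G_def z_def)
  have "(z has_vector_derivative X (z t)) (at t)" for t
    unfolding z_def using prim_has_vector_derivative[OF contG, of u t] Gz[of t]
    by (auto intro!: derivative_eq_intros simp: z_def)
  moreover have "z 0 = p" by (simp add: z_def)
  ultimately show ?thesis by blast
qed

section \<open>Gronwall estimate, uniqueness and continuous dependence\<close>

text \<open>The squared distance, damped by \<open>exp (- 2 * L * (t - a))\<close>, cannot increase,
  by Cauchy-Schwarz. The velocities are arbitrary functions instead of values of a fixed field, so
  that orbits run through at variable speed are covered as well.\<close>

lemma gronwall_difference:
  fixes z w :: "real \<Rightarrow> 'a::euclidean_space"
  assumes "a \<le> b"
    and z: "\<And>t. t \<in> {a..b} \<Longrightarrow> (z has_vector_derivative zd t) (at t within {a..b})"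
    and w: "\<And>t. t \<in> {a..b} \<Longrightarrow> (w has_vector_derivative wd t) (at t within {a..b})"
    and le: "\<And>t. t \<in> {a..b} \<Longrightarrow> norm (zd t - wd t) \<le> L * norm (z t - w t)"
  shows "norm (z b - w b) \<le> exp (L * (b - a)) * norm (z a - w a)"
proof -
  define D where "D t = (z t - w t) \<bullet> (z t - w t) * exp (- 2 * L * (t - a))" for t
  have "D b \<le> D a"
  proof (rule DERIV_nonpos_imp_decreasing_open[OF \<open>a \<le> b\<close>])
    have "continuous_on {a..b} z" "continuous_on {a..b} w"
      using z w by (meson continuous_on_eq_continuous_within has_vector_derivative_continuous)+
    then show "continuous_on {a..b} D" unfolding D_def by (intro continuous_intros)
    fix t assume t: "a < t" "t < b"
    have zt: "(z has_vector_derivative zd t) (at t)" and wt: "(w has_vector_derivative wd t) (at t)"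
      using z[of t] w[of t] t by (auto simp: at_within_Icc_at)
    let ?d = "(2 * ((z t - w t) \<bullet> (zd t - wd t)) - 2 * L * ((z t - w t) \<bullet> (z t - w t)))
        * exp (- 2 * L * (t - a))"
    have "(D has_real_derivative ?d) (at t)"
      unfolding D_def has_real_derivative_iff_has_vector_derivative has_vector_derivative_def
      using zt[unfolded has_vector_derivative_def] wt[unfolded has_vector_derivative_def]
      by (auto intro!: derivative_eq_intros simp: fun_eq_iff algebra_simps inner_commute)
    moreover have "?d \<le> 0"
    proof -
      have "(z t - w t) \<bullet> (zd t - wd t) \<le> norm (z t - w t) * norm (zd t - wd t)"
        by (rule norm_cauchy_schwarz)
      also have "\<dots> \<le> norm (z t - w t) * (L * norm (z t - w t))"
        using le[of t] t by (intro mult_left_mono) auto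
      also have "\<dots> = L * ((z t - w t) \<bullet> (z t - w t))"
        by (simp add: dot_square_norm power2_eq_square)
      finally show ?thesis by (simp add: mult_le_0_iff)
    qed
    ultimately show "\<exists>y. (D has_real_derivative y) (at t) \<and> y \<le> 0" by blast
  qed
  then have "(norm (z b - w b))\<^sup>2 * exp (- 2 * L * (b - a)) \<le> (norm (z a - w a))\<^sup>2"
    by (simp add: D_def dot_square_norm)
  then have "(norm (z b - w b))\<^sup>2 \<le> (norm (z a - w a))\<^sup>2 * exp (2 * L * (b - a))"
    by (simp add: exp_minus field_simps exp_diff)
  also have "\<dots> = (exp (L * (b - a)) * norm (z a - w a))\<^sup>2"
    by (simp add: power_mult_distrib power2_eq_square mult_exp_exp algebra_simps)
  finally show ?thesis by (rule power2_le_imp_le) simp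
qed

lemma lipschitz_solutions_diverge:
  fixes z w :: "real \<Rightarrow> 'a::euclidean_space"
  assumes lip: "L-lipschitz_on S X"
    and z: "\<And>t. (z has_vector_derivative X (z t)) (at t)" "\<And>t. z t \<in> S"
    and w: "\<And>t. (w has_vector_derivative X (w t)) (at t)" "\<And>t. w t \<in> S"
  shows "norm (z t - w t) \<le> exp (L * \<bar>t - s\<bar>) * norm (z s - w s)"
proof (cases "s \<le> t")
  case True
  then show ?thesis
    using gronwall_difference[of s t z "\<lambda>t. X (z t)" w "\<lambda>t. X (w t)" L]
      z w lipschitz_on_normD[OF lip] has_vector_derivative_at_within by fastforce
next
  case False
  \<comment> \<open>Backward in time the estimate is applied to the reflected solutions, which
    follow the field \<open>- X\<close>.\<close>
  have "norm (z (- (- t)) - w (- (- t))) \<le> exp (L * (- t - - s)) * norm (z (- (- s)) - w (- (- s)))"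
  proof (rule gronwall_difference[of "- s" "- t" "\<lambda>t. z (- t)" "\<lambda>t. - X (z (- t))" "\<lambda>t. w (- t)" "\<lambda>t. - X (w (- t))" L])
    show "- s \<le> - t" using False by simp
    fix u
    show "((\<lambda>t. z (- t)) has_vector_derivative - X (z (- u))) (at u within {- s..- t})"
      "((\<lambda>t. w (- t)) has_vector_derivative - X (w (- u))) (at u within {- s..- t})"
      by (auto intro!: has_vector_derivative_at_within has_vector_derivative_reflect z w)
    show "norm (- X (z (- u)) - - X (w (- u))) \<le> L * norm (z (- u) - w (- u))"
      using lipschitz_on_normD[OF lip z(2)[of "- u"] w(2)[of "- u"]] by (simp add: norm_minus_commute)
  qed
  then show ?thesis using False by (simp add: algebra_simps)
qed

lemma lipschitz_solutions_unique:
  fixes z w :: "real \<Rightarrow> 'a::euclidean_space"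
  assumes "L-lipschitz_on S X"
    and "\<And>t. (z has_vector_derivative X (z t)) (at t)" "\<And>t. z t \<in> S"
    and "\<And>t. (w has_vector_derivative X (w t)) (at t)" "\<And>t. w t \<in> S"
    and "z s = w s"
  shows "z t = w t"
  using lipschitz_solutions_diverge[OF assms(1-5), of t s] assms(6) by simp

text \<open>Joint continuity combines two separate facts: dependence on the initial point is
  Lipschitz with a constant bounded on bounded times, and the single orbit through \<open>p0\<close>
  is continuous in time.\<close>

lemma lipschitz_flow_exists:
  fixes X :: "'a::euclidean_space \<Rightarrow> 'a"
  assumes lip: "L-lipschitz_on UNIV X"
  obtains \<Phi> :: "real \<Rightarrow> 'a \<Rightarrow> 'a" where "\<forall>p. \<Phi> 0 p = p"
    and "\<forall>p t. ((\<lambda>t. \<Phi> t p) has_vector_derivative X (\<Phi> t p)) (at t)"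
    and "continuous_on UNIV (\<lambda>(t, p). \<Phi> t p)"
proof -
  obtain \<phi> where \<phi>: "\<And>p. \<phi> p 0 = p"
    "\<And>p t. ((\<lambda>t. \<phi> p t) has_vector_derivative X (\<phi> p t)) (at t)"
    using lipschitz_ode_exists[OF lip] by metis
  have le: "norm (\<phi> p t - \<phi> q t) \<le> exp (L * \<bar>t\<bar>) * norm (p - q)" for p q t
    using lipschitz_solutions_diverge[OF lip \<phi>(2) UNIV_I \<phi>(2) UNIV_I, of p t q 0] by (simp add: \<phi>(1))
  have "isCont (\<lambda>(t, p). \<phi> p t) (t0, p0)" for t0 p0
  proof -
    have "((\<lambda>x. exp (L * \<bar>fst x\<bar>) * norm (snd x - p0) + norm (\<phi> p0 (fst x) - \<phi> p0 t0))
        \<longlongrightarrow> exp (L * \<bar>t0\<bar>) * norm (p0 - p0) + norm (\<phi> p0 t0 - \<phi> p0 t0)) (at (t0, p0))"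
    proof (intro tendsto_intros)
      have "isCont (\<phi> p0) t0" using \<phi>(2) has_vector_derivative_continuous by blast
      then show "((\<lambda>x. \<phi> p0 (fst x)) \<longlongrightarrow> \<phi> p0 t0) (at (t0, p0))"
        by (rule isCont_tendsto_compose) (auto intro!: tendsto_eq_intros)
    qed (auto intro!: tendsto_eq_intros)
    then have "((\<lambda>x. exp (L * \<bar>fst x\<bar>) * norm (snd x - p0) + norm (\<phi> p0 (fst x) - \<phi> p0 t0))
        \<longlongrightarrow> 0) (at (t0, p0))" by simp
    then have "((\<lambda>x. (case x of (t, p) \<Rightarrow> \<phi> p t) - \<phi> p0 t0) \<longlongrightarrow> 0) (at (t0, p0))"
    proof (rule Lim_null_comparison[rotated], intro always_eventually allI)
      fix x :: "real \<times> 'a"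
      obtain t p where x: "x = (t, p)" by force
      have "norm (\<phi> p t - \<phi> p0 t0) \<le> norm (\<phi> p t - \<phi> p0 t) + norm (\<phi> p0 t - \<phi> p0 t0)"
        using norm_triangle_ineq[of "\<phi> p t - \<phi> p0 t" "\<phi> p0 t - \<phi> p0 t0"] by simp
      then show "norm ((case x of (t, p) \<Rightarrow> \<phi> p t) - \<phi> p0 t0)
          \<le> exp (L * \<bar>fst x\<bar>) * norm (snd x - p0) + norm (\<phi> p0 (fst x) - \<phi> p0 t0)"
        using le[of p t p0] x by simp
    qed
    then show ?thesis unfolding isCont_def using LIM_zero_cancel by fastforce
  qed
  then have "continuous_on UNIV (\<lambda>(t, p). \<phi> p t)"
    by (simp add: continuous_at_imp_continuous_on)
  with \<phi> show ?thesis by (intro that[of "\<lambda>t p. \<phi> p t"]) auto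
qed

section \<open>Lipschitz extension and C1 functions on compact sets\<close>

text \<open>McShane's formula.\<close>

lemma lipschitz_extension:
  fixes f :: "'a::metric_space \<Rightarrow> real"
  assumes lip: "L-lipschitz_on K f" and "K \<noteq> {}"
  obtains F where "L-lipschitz_on UNIV F" and "\<And>x. x \<in> K \<Longrightarrow> F x = f x"
proof
  define F where "F x = (INF w\<in>K. f w + L * dist x w)" for x
  have L: "L \<ge> 0" using lip by (rule lipschitz_on_nonneg)
  obtain k where k: "k \<in> K" using \<open>K \<noteq> {}\<close> by blast
  \<comment> \<open>Comparison with one fixed \<open>k\<close> bounds the family from below, so that
    the infimum is a genuine one.\<close>
  have lb: "f k - L * dist x k \<le> f w + L * dist x w" if "w \<in> K" for w x
  proof -
    have "f k - f w \<le> L * dist k w" using lipschitz_onD[OF lip k that] by (simp add: dist_real_def)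
    also have "\<dots> \<le> L * (dist x k + dist x w)"
      using L by (intro mult_left_mono dist_triangle3) auto
    finally show ?thesis by (simp add: algebra_simps)
  qed
  then have bdd: "bdd_below ((\<lambda>w. f w + L * dist x w) ` K)" for x by (auto intro!: bdd_belowI2)
  have le: "F x \<le> F y + L * dist x y" for x y
  proof -
    have "F x - L * dist x y \<le> f w + L * dist y w" if "w \<in> K" for w
    proof -
      have "F x \<le> f w + L * dist x w" unfolding F_def by (rule cINF_lower[OF bdd that])
      also have "L * dist x w \<le> L * (dist x y + dist y w)"
        using L by (intro mult_left_mono dist_triangle) auto
      finally show ?thesis by (simp add: algebra_simps)
    qed
    then have "F x - L * dist x y \<le> F y"
      using \<open>K \<noteq> {}\<close> unfolding F_def[of y] by (intro cINF_greatest) auto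
    then show ?thesis by simp
  qed
  show "L-lipschitz_on UNIV F"
  proof (rule lipschitz_onI[OF _ L])
    fix x y
    show "dist (F x) (F y) \<le> L * dist x y"
      using le[of x y] le[of y x] by (simp add: dist_real_def dist_commute abs_le_iff)
  qed
  show "F x = f x" if x: "x \<in> K" for x
  proof (rule antisym)
    show "F x \<le> f x" using cINF_lower[OF bdd x, of x] by (simp add: F_def)
    show "f x \<le> F x" unfolding F_def
    proof (rule cINF_greatest[OF \<open>K \<noteq> {}\<close>])
      fix w assume "w \<in> K"
      from lipschitz_onD[OF lip x this] show "f x \<le> f w + L * dist x w" by (simp add: dist_real_def)
    qed
  qed
qed

text \<open>On a small ball the derivative is bounded and the mean value inequality applies by
  convexity. The compact set itself need not be convex, so the local bounds are glued by the theory
  of \<open>local_lipschitz\<close>, with a dummy time set \<open>{0}\<close>.\<close>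

lemma C1_on_compact_imp_lipschitz:
  fixes f :: "'a::euclidean_space \<Rightarrow> 'b::euclidean_space"
  assumes "C1_on S f" "open S" "compact K" "K \<subseteq> S"
  obtains L where "L-lipschitz_on K f"
proof -
  obtain f' :: "'a \<Rightarrow> 'a \<Rightarrow>\<^sub>L 'b" where f': "\<And>x. x \<in> S \<Longrightarrow> (f has_derivative f' x) (at x)"
    and cont: "continuous_on S f'" using assms(1) by (auto simp: C1_on_def)
  have "local_lipschitz {0::real} K (\<lambda>_. f)"
  proof (rule local_lipschitzI)
    fix t x assume "x \<in> K"
    then have x: "x \<in> S" using assms by auto
    have "isCont f' x" using cont assms(2) x by (simp add: continuous_on_eq_continuous_at)
    then obtain d where d: "d > 0" "\<And>y. dist y x < d \<Longrightarrow> dist (f' y) (f' x) < 1"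
      unfolding continuous_at_eps_delta by (metis zero_less_one)
    obtain e where e: "e > 0" "ball x e \<subseteq> S" using assms(2) x openE by blast
    define u where "u = min d e / 2"
    have u: "u > 0" "cball x u \<subseteq> S" "\<And>y. y \<in> cball x u \<Longrightarrow> dist (f' y) (f' x) < 1"
      using d e by (auto simp: u_def subset_iff dist_commute)
    have "(norm (f' x) + 1)-lipschitz_on (cball x u) f"
    proof (rule lipschitz_onI)
      fix y w assume yw: "y \<in> cball x u" "w \<in> cball x u"
      show "dist (f y) (f w) \<le> (norm (f' x) + 1) * dist y w"
        unfolding dist_norm
      proof (rule differentiable_bound[OF convex_cball _ _ yw(1) yw(2)])
        fix v assume v: "v \<in> cball x u"
        show "(f has_derivative f' v) (at v within cball x u)"
          using f' u(2) v has_derivative_at_withinI by blast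
        show "onorm (f' v) \<le> norm (f' x) + 1"
          using u(3)[OF v] norm_triangle_ineq2[of "f' v" "f' x"]
          by (simp add: dist_norm norm_blinfun.rep_eq)
      qed
    qed simp
    then have "\<forall>t\<in>cball t u \<inter> {0}. (norm (f' x) + 1)-lipschitz_on (cball x u \<inter> K) f"
      by (meson inf_le1 lipschitz_on_subset)
    then show "\<exists>u>0. \<exists>L. \<forall>t\<in>cball t u \<inter> {0}. L-lipschitz_on (cball x u \<inter> K) f"
      using u(1) by blast
  qed
  then obtain L where "\<And>t. t \<in> {0} \<Longrightarrow> L-lipschitz_on K f"
    by (rule local_lipschitz_compact_implies_lipschitz[OF _ assms(3)]) auto
  then show ?thesis using that by auto
qed

section \<open>Orbits on a simple closed curve\<close>

text \<open>Cutting the closed curve at \<open>z0\<close> leaves an arc. With \<open>z0\<close>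
  placed at both ends, the parametrization is injective on the rest, so a path that avoids
  \<open>z0\<close> becomes a real function, open to order arguments.\<close>

lemma simple_closed_lift:
  fixes z :: "real \<Rightarrow> real \<times> real"
  assumes "simple_closed_param \<Gamma> p" and "z0 \<in> \<Gamma>" and "closed S" and "continuous_on S z"
    and "\<And>t. t \<in> S \<Longrightarrow> z t \<in> \<Gamma> - {z0}"
  obtains c :: "real \<Rightarrow> real \<times> real" and \<psi> where "continuous_on {0..1} c" "c ` {0..1} = \<Gamma>"
    "continuous_on S \<psi>" "\<forall>t\<in>S. \<psi> t \<in> {0..1} \<and> c (\<psi> t) = z t"
    "\<forall>s\<in>S. \<forall>t\<in>S. \<psi> s = \<psi> t \<longleftrightarrow> z s = z t"
proof -
  have p: "simple_path p" "pathfinish p = pathstart p" "path_image p = \<Gamma>"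
    using assms(1) by (auto simp: simple_closed_param_def)
  obtain a where a: "a \<in> {0..1}" "p a = z0" using assms(2) p(3) by (auto simp: path_image_def)
  define c where "c = shiftpath a p"
  have c: "simple_path c" "path_image c = \<Gamma>"
    using a p by (auto simp: c_def simple_path_shiftpath path_image_shiftpath)
  have c01: "c 0 = z0" "c 1 = z0"
    using a p(2) by (auto simp: c_def shiftpath_def pathfinish_def pathstart_def)
  have cont: "continuous_on {0..1} c" and free: "loop_free c"
    using c(1) by (auto simp: simple_path_def path_def)
  have "\<forall>t\<in>S. \<exists>u. u \<in> {0..1} \<and> c u = z t"
    using assms(5) c(2) by (fastforce simp: path_image_def)
  then obtain \<psi> where \<psi>: "\<And>t. t \<in> S \<Longrightarrow> \<psi> t \<in> {0..1} \<and> c (\<psi> t) = z t" by metis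
  have uniq: "u = \<psi> t" if "t \<in> S" "u \<in> {0..1}" "c u = z t" for t u
    using free[unfolded loop_free_def, rule_format, OF that(2), of "\<psi> t"] \<psi>[OF that(1)]
      that assms(5)[OF that(1)] c01 by auto
  \<comment> \<open>The preimage of a closed set under \<open>\<psi>\<close> is the preimage under
    \<open>z\<close> of a compact image under \<open>c\<close>; compactness thus replaces a
    continuous inverse of \<open>c\<close>.\<close>
  have "continuous_on S \<psi>"
    unfolding continuous_on_closed_vimage[OF \<open>closed S\<close>]
  proof (intro allI impI)
    fix B :: "real set" assume "closed B"
    then have "compact (B \<inter> {0..1})" by (simp add: closed_Int_compact)
    then have "closed (c ` (B \<inter> {0..1}))"
      by (intro compact_imp_closed compact_continuous_image continuous_on_subset[OF cont]) auto
    then have "closed (z -` (c ` (B \<inter> {0..1})) \<inter> S)"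
      using assms(4) continuous_on_closed_vimage[OF \<open>closed S\<close>] by blast
    also have "z -` (c ` (B \<inter> {0..1})) \<inter> S = \<psi> -` B \<inter> S"
    proof (intro set_eqI iffI)
      fix t assume "t \<in> z -` (c ` (B \<inter> {0..1})) \<inter> S"
      then obtain u where "t \<in> S" "u \<in> B" "u \<in> {0..1}" "c u = z t" by force
      then show "t \<in> \<psi> -` B \<inter> S" using uniq[of t u] by auto
    next
      fix t assume "t \<in> \<psi> -` B \<inter> S"
      then show "t \<in> z -` (c ` (B \<inter> {0..1})) \<inter> S" using \<psi>[of t] by (auto intro!: image_eqI[of _ c "\<psi> t"])
    qed
    finally show "closed (\<psi> -` B \<inter> S)" .
  qed
  moreover have "\<psi> s = \<psi> t \<longleftrightarrow> z s = z t" if "s \<in> S" "t \<in> S" for s t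
    using \<psi>[OF that(1)] \<psi>[OF that(2)] uniq[OF that(2), of "\<psi> s"] by auto
  ultimately show ?thesis
    using \<psi> cont c(2) by (intro that[of c \<psi>]) (auto simp: path_image_def)
qed

lemma mono_bounded_converges:
  fixes \<psi> :: "real \<Rightarrow> real"
  assumes mono: "mono_on {b..} \<psi>" and bd: "\<And>t. t \<ge> b \<Longrightarrow> \<psi> t \<in> {0..1}"
  obtains l where "l \<in> {0..1}" "(\<psi> \<longlongrightarrow> l) at_top"
proof
  define l where "l = (SUP t\<in>{b..}. \<psi> t)"
  have bdd: "bdd_above (\<psi> ` {b..})" using bd by (auto intro!: bdd_aboveI2)
  have le: "\<psi> t \<le> l" if "t \<ge> b" for t unfolding l_def using that by (intro cSUP_upper bdd) auto
  have "l \<le> 1" unfolding l_def using bd by (intro cSUP_least) auto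
  then show "l \<in> {0..1}" using le[of b] bd[of b] by auto
  show "(\<psi> \<longlongrightarrow> l) at_top"
  proof (rule tendstoI)
    fix e :: real assume "e > 0"
    then obtain t0 where t0: "t0 \<ge> b" "\<psi> t0 > l - e"
      using less_cSUP_iff[OF _ bdd, of "l - e"] by (auto simp: l_def)
    show "\<forall>\<^sub>F t in at_top. dist (\<psi> t) l < e"
      using eventually_ge_at_top[of t0]
    proof eventually_elim
      case (elim t)
      then have "\<psi> t0 \<le> \<psi> t" using mono t0 by (auto simp: mono_on_def)
      then show ?case using le[of t] elim t0 by (auto simp: dist_real_def)
    qed
  qed
qed

text \<open>If the limit had velocity \<open>v\<close> different from 0, the component along
  \<open>v\<close> would eventually grow by at least \<open>(v \<bullet> v) / 2\<close> per unit of
  time, while unit increments of a convergent function tend to 0.\<close>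

lemma solution_limit_is_equilibrium:
  fixes z :: "real \<Rightarrow> 'a::euclidean_space"
  assumes "\<And>t. (z has_vector_derivative X (z t)) (at t)" and "\<And>t. z t \<in> S"
    and "continuous_on S X" and "(z \<longlongrightarrow> l) at_top" and "l \<in> S"
  shows "X l = 0"
proof (rule ccontr)
  assume nz: "X l \<noteq> 0"
  define v where "v = X l"
  have v: "v \<bullet> v > 0" using nz by (simp add: v_def)
  have "((\<lambda>t. X (z t)) \<longlongrightarrow> X l) at_top"
    using assms by (intro continuous_on_tendsto_compose[OF assms(3,4)]) auto
  then have "((\<lambda>t. X (z t) \<bullet> v) \<longlongrightarrow> v \<bullet> v) at_top"
    unfolding v_def by (intro tendsto_intros)
  then have "\<forall>\<^sub>F t in at_top. X (z t) \<bullet> v > (v \<bullet> v) / 2"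
    using v by (intro order_tendstoD) auto
  then obtain N where N: "\<And>t. t \<ge> N \<Longrightarrow> X (z t) \<bullet> v > (v \<bullet> v) / 2"
    by (auto simp: eventually_at_top_linorder)
  have ge: "z (t + 1) \<bullet> v - z t \<bullet> v \<ge> (v \<bullet> v) / 2" if "t \<ge> N" for t
  proof -
    have d: "((\<lambda>t. z t \<bullet> v) has_real_derivative X (z t) \<bullet> v) (at t)" for t
      using bounded_linear.has_vector_derivative[OF bounded_linear_inner_left assms(1)[of t]]
      by (simp add: has_real_derivative_iff_has_vector_derivative)
    have "\<exists>u. t < u \<and> u < t + 1 \<and> z (t + 1) \<bullet> v - z t \<bullet> v = (t + 1 - t) * (X (z u) \<bullet> v)"
      by (rule MVT2[OF _ d]) simp
    then obtain u where "u > t" "z (t + 1) \<bullet> v - z t \<bullet> v = X (z u) \<bullet> v" by auto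
    then show ?thesis using N[of u] that by simp
  qed
  have "((\<lambda>t. z (t + 1)) \<longlongrightarrow> l) at_top"
    by (rule filterlim_compose[OF assms(4)])
      (auto intro!: filterlim_tendsto_add_at_top[of "\<lambda>_. 1::real" 1 _ "\<lambda>t. t", simplified add.commute] filterlim_ident)
  then have "((\<lambda>t. z (t + 1) \<bullet> v - z t \<bullet> v) \<longlongrightarrow> l \<bullet> v - l \<bullet> v) at_top"
    by (intro tendsto_intros assms(4))
  then have "(v \<bullet> v) / 2 \<le> l \<bullet> v - l \<bullet> v"
    by (rule tendsto_lowerbound) (use ge in \<open>auto simp: eventually_at_top_linorder\<close>)
  then show False using v by simp
qed

text \<open>If the half orbit never meets its starting point, it lifts to an injective, hence monotone,
  bounded function on an interval; its limit would be an equilibrium on the curve.\<close>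

lemma solution_on_closed_curve_recurs:
  fixes z :: "real \<Rightarrow> real \<times> real"
  assumes curve: "simple_closed_param \<Gamma> p"
    and lip: "L-lipschitz_on \<Gamma> X" and nz: "\<And>w. w \<in> \<Gamma> \<Longrightarrow> X w \<noteq> 0"
    and z: "\<And>t. (z has_vector_derivative X (z t)) (at t)" "\<And>t. z t \<in> \<Gamma>"
  obtains T where "T > 0" "z T = z 0"
proof (rule ccontr)
  note recur = that
  assume "\<not> thesis"
  have no: "z t \<noteq> z 0" if "t > 0" for t
    using that recur[of t] \<open>\<not> thesis\<close> by blast
  \<comment> \<open>A repetition at any two times can be shifted back, by uniqueness, to a return to
    the starting point.\<close>
  have ne: "z s \<noteq> z t" if "s < t" for s t
  proof
    assume eq: "z s = z t"
    have "z (0 + s) = z (0 + t)" using eq by simp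
    then have "z (- s + s) = z (- s + t)"
      by (rule lipschitz_solutions_unique[OF lip has_vector_derivative_shift[OF z(1)] z(2)
          has_vector_derivative_shift[OF z(1)] z(2)])
    then show False using no[of "t - s"] that by simp
  qed
  have contz: "continuous_on A z" for A
    using z(1) by (meson continuous_at_imp_continuous_on has_vector_derivative_continuous)
  have contX: "continuous_on \<Gamma> X" using lip by (rule lipschitz_on_continuous_on)
  \<comment> \<open>After time 0 the starting point is never met again, so the curve may be cut
    there.\<close>
  have avoid: "z t \<in> \<Gamma> - {z 0}" if "t \<in> {1..}" for t using z(2) no[of t] that by auto
  obtain c :: "real \<Rightarrow> real \<times> real" and \<psi> :: "real \<Rightarrow> real" where c: "continuous_on {0..1} c" "c ` {0..1} = \<Gamma>"
    and lift: "continuous_on {1..} \<psi>" "\<forall>t\<in>{1..}. \<psi> t \<in> {0..1} \<and> c (\<psi> t) = z t"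
      "\<forall>s\<in>{1..}. \<forall>t\<in>{1..}. \<psi> s = \<psi> t \<longleftrightarrow> z s = z t"
    by (rule simple_closed_lift[OF curve z(2)[of 0] closed_atLeast contz avoid])
  note \<psi> = lift[rule_format]
  have "inj_on \<psi> {1..}"
  proof (rule inj_onI)
    fix s t assume "s \<in> {1..}" "t \<in> {1..}" "\<psi> s = \<psi> t"
    then have "z s = z t" using \<psi>(3) by blast
    then show "s = t" using ne[of s t] ne[of t s] by force
  qed
  then have "strict_mono_on {1..} \<psi> \<or> strict_antimono_on {1..} \<psi>"
    using injective_eq_monotone_map[OF _ \<psi>(1)] by (simp add: is_interval_ci)
  then obtain l where l: "l \<in> {0..1}" "(\<psi> \<longlongrightarrow> l) at_top"
  proof
    assume "strict_mono_on {1..} \<psi>"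
    then have "mono_on {1..} \<psi>" by (rule strict_mono_on_imp_mono_on)
    from mono_bounded_converges[OF this] \<psi>(2) that show ?thesis by (metis atLeast_iff)
  next
    assume "strict_antimono_on {1..} \<psi>"
    then have "\<psi> t \<le> \<psi> s" if "1 \<le> s" "s \<le> t" for s t
      using that by (cases "s = t") (auto simp: monotone_on_def intro!: less_imp_le)
    then have "mono_on {1..} (\<lambda>t. 1 - \<psi> t)"
      by (intro mono_onI) auto
    moreover have "1 - \<psi> t \<in> {0..1}" if "t \<ge> 1" for t using \<psi>(2)[of t] that by auto
    ultimately obtain l where "l \<in> {0..1}" "((\<lambda>t. 1 - \<psi> t) \<longlongrightarrow> l) at_top"
      using mono_bounded_converges by metis
    then show ?thesis
      using that[of "1 - l"] tendsto_diff[OF tendsto_const[of 1 at_top], of "\<lambda>t. 1 - \<psi> t" l] by auto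
  qed
  have "((\<lambda>t. c (\<psi> t)) \<longlongrightarrow> c l) at_top"
    by (rule continuous_on_tendsto_compose[OF c(1) l(2,1)])
      (use \<psi>(2) in \<open>auto simp: eventually_at_top_linorder intro!: exI[of _ 1]\<close>)
  then have "(z \<longlongrightarrow> c l) at_top"
    by (rule Lim_transform_eventually)
      (use \<psi>(2) in \<open>auto simp: eventually_at_top_linorder intro!: exI[of _ 1]\<close>)
  moreover have "c l \<in> \<Gamma>" using c(2) l(1) by blast
  ultimately show False
    using solution_limit_is_equilibrium[OF z contX] nz by blast
qed

section \<open>Periods of an orbit\<close>

lemma periodic_int_shift:
  fixes z :: "real \<Rightarrow> 'a"
  assumes per: "\<And>t. z (t + T) = z t"
  shows "z (t + of_int k * T) = z t"
proof -
  have n: "z (t + real n * T) = z t" for t n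
  proof (induction n)
    case (Suc n)
    then show ?case using per[of "t + real n * T"] by (simp add: algebra_simps)
  qed simp
  show ?thesis
  proof (cases "k \<ge> 0")
    case True
    then show ?thesis using n[of t "nat k"] by simp
  next
    case False
    then show ?thesis using n[of "t + of_int k * T" "nat (- k)"] by simp
  qed
qed

lemma periodic_in_period_image:
  fixes z :: "real \<Rightarrow> 'a"
  assumes per: "\<And>t. z (t + T) = z t" and "T > 0"
  shows "\<exists>u\<in>{0..T}. z t = z u"
proof -
  define k where "k = \<lfloor>t / T\<rfloor>"
  define u where "u = t - of_int k * T"
  have "of_int k \<le> t / T" "t / T < of_int k + 1" by (auto simp: k_def)
  then have "u \<in> {0..T}" using \<open>T > 0\<close> by (auto simp: u_def field_simps)
  moreover have "z t = z u"
    using periodic_int_shift[of z T u k, OF per] by (simp add: u_def)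
  ultimately show ?thesis by blast
qed

text \<open>The nonzero velocity at time 0 keeps positive return times above some \<open>e\<close>,
  so they form a closed set with a least element \<open>T\<close>. Division with remainder makes
  every repetition a multiple of \<open>T\<close>; \<open>det\<close> says that a state determines
  the whole orbit.\<close>

lemma minimal_period_exists:
  fixes z :: "real \<Rightarrow> 'a::euclidean_space"
  assumes det: "\<And>s t r. z s = z t \<Longrightarrow> z (s + r) = z (t + r)"
    and d: "(z has_vector_derivative d) (at 0)" "d \<noteq> 0"
    and cont: "continuous_on UNIV z" and \<tau>: "\<tau> > 0" "z \<tau> = z 0"
  obtains T where "T > 0" "\<And>s t. z s = z t \<longleftrightarrow> (\<exists>k::int. t - s = of_int k * T)"
proof -
  have "norm d / 2 > 0" using d(2) by simp
  then obtain e where e: "e > 0"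
    "\<And>y. norm (y - 0) < e \<Longrightarrow> norm (z y - z 0 - (y - 0) *\<^sub>R d) \<le> norm d / 2 * norm (y - 0)"
    using d(1) unfolding has_vector_derivative_def has_derivative_at_alt by blast
  have near: "z y \<noteq> z 0" if "0 < y" "y < e" for y
  proof
    assume "z y = z 0"
    then have "y * norm d \<le> norm d / 2 * y" using e(2)[of y] that by simp
    then show False using that d(2) by simp
  qed
  define A where "A = {e..} \<inter> z -` {z 0}"
  define T where "T = Inf A"
  have "closed A"
    unfolding A_def by (intro closed_Int closed_vimage cont) (auto simp: closed_atLeast)
  moreover have "\<tau> \<in> A" using near[of \<tau>] \<tau> by (cases "\<tau> < e") (auto simp: A_def)
  moreover have bdd: "bdd_below A" by (auto simp: A_def intro!: bdd_belowI)
  ultimately have "T \<in> A" unfolding T_def by (intro closed_contains_Inf) auto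
  then have T: "T > 0" "z T = z 0" using e(1) by (auto simp: A_def)
  have least: "T \<le> t" if "t > 0" "z t = z 0" for t
    unfolding T_def using near[of t] that by (intro cInf_lower bdd) (cases "t < e"; auto simp: A_def)
  have per: "z (t + T) = z t" for t using det[OF T(2), of t] by (simp add: add.commute)
  note perk = periodic_int_shift[of z T, OF per]
  have "z s = z t \<longleftrightarrow> (\<exists>k::int. t - s = of_int k * T)" for s t
  proof
    assume "z s = z t"
    from det[OF this, of "- s"] have z0: "z (t - s) = z 0" by simp
    define k where "k = \<lfloor>(t - s) / T\<rfloor>"
    define r where "r = t - s - of_int k * T"
    have "of_int k \<le> (t - s) / T" "(t - s) / T < of_int k + 1" by (auto simp: k_def)
    then have r: "0 \<le> r" "r < T" using T(1) by (auto simp: r_def field_simps)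
    have "z r = z 0" using perk[of r k] z0 by (simp add: r_def)
    then have "r = 0" using least[of r] r by force
    then show "\<exists>k::int. t - s = of_int k * T" unfolding r_def by auto
  next
    assume "\<exists>k::int. t - s = of_int k * T"
    then obtain k :: int where "t = s + of_int k * T" by (metis add.commute diff_add_cancel)
    then show "z s = z t" by (simp add: perk)
  qed
  with T(1) show ?thesis by (rule that)
qed

text \<open>If a point were missed, the orbit would lift to a real function that is injective on
  intervals shorter than a period and yet takes the same value at \<open>0\<close> and
  \<open>T\<close>.\<close>

lemma periodic_orbit_covers_closed_curve:
  fixes z :: "real \<Rightarrow> real \<times> real"
  assumes curve: "simple_closed_param \<Gamma> p" and cont: "continuous_on UNIV z"
    and in\<Gamma>: "\<And>t. z t \<in> \<Gamma>"
    and T: "T > 0" "\<And>s t. z s = z t \<longleftrightarrow> (\<exists>k::int. t - s = of_int k * T)"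
  shows "range z = \<Gamma>"
proof (rule ccontr)
  assume "range z \<noteq> \<Gamma>"
  then obtain z0 where z0: "z0 \<in> \<Gamma>" "\<And>t. z t \<noteq> z0" using in\<Gamma> by blast
  have avoid: "z t \<in> \<Gamma> - {z0}" for t using in\<Gamma> z0 by auto
  obtain c :: "real \<Rightarrow> real \<times> real" and \<psi> :: "real \<Rightarrow> real" where c: "continuous_on {0..1} c" "c ` {0..1} = \<Gamma>"
    and lift: "continuous_on UNIV \<psi>" "\<forall>t\<in>UNIV. \<psi> t \<in> {0..1} \<and> c (\<psi> t) = z t"
      "\<forall>s\<in>UNIV. \<forall>t\<in>UNIV. \<psi> s = \<psi> t \<longleftrightarrow> z s = z t"
    by (rule simple_closed_lift[OF curve z0(1) closed_UNIV cont avoid])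
  note \<psi> = lift[rule_format]
  have inj: "inj_on \<psi> {a..b}" if "b - a < T" for a b
  proof (intro inj_onI)
    fix s t assume st: "s \<in> {a..b}" "t \<in> {a..b}" "\<psi> s = \<psi> t"
    then obtain k :: int where k: "t - s = of_int k * T" using \<psi>(3) T(2) by auto
    have "\<bar>t - s\<bar> < T" using st that by auto
    then have "\<bar>real_of_int k\<bar> < 1" using T(1) by (simp add: k abs_mult)
    then have "k = 0" by linarith
    then show "s = t" using k by simp
  qed
  have "\<psi> 0 = \<psi> T" using \<psi>(3) T(2)[of 0 T] by (auto intro: exI[of _ 1])
  \<comment> \<open>The intervals \<open>{0..T/2}\<close> and \<open>{T/4..T}\<close> are shorter
    than the period; their overlap forces the same direction of monotonicity on both, hence from
    \<open>0\<close> to \<open>T\<close>.\<close>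
  moreover have "\<psi> 0 < \<psi> (T/4) \<and> \<psi> (T/4) < \<psi> (T/2) \<or> \<psi> (T/2) < \<psi> (T/4) \<and> \<psi> (T/4) < \<psi> 0"
    by (rule continuous_inj_imp_mono) (use T(1) in \<open>auto intro!: inj continuous_on_subset[OF \<psi>(1)]\<close>)
  moreover have "\<psi> (T/4) < \<psi> (T/2) \<and> \<psi> (T/2) < \<psi> T \<or> \<psi> T < \<psi> (T/2) \<and> \<psi> (T/2) < \<psi> (T/4)"
    by (rule continuous_inj_imp_mono) (use T(1) in \<open>auto intro!: inj continuous_on_subset[OF \<psi>(1)]\<close>)
  ultimately show False by linarith
qed

section \<open>Melnikov integrals along periodic orbits\<close>

text \<open>This is the second order equation \<open>U'' = f (U, U')\<close> as a first order system
  in the phase plane.\<close>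

definition wave_field :: "(real \<times> real \<Rightarrow> real) \<Rightarrow> real \<times> real \<Rightarrow> real \<times> real" where
  "wave_field f z = (snd z, f z)"

lemma lipschitz_on_snd: "1-lipschitz_on S snd"
  by (rule lipschitz_onI) (auto simp: dist_snd_le)

lemma lipschitz_on_fst: "1-lipschitz_on S fst"
  by (rule lipschitz_onI) (auto simp: dist_fst_le)

lemma lipschitz_on_wave_field:
  assumes "L-lipschitz_on S f"
  obtains M where "M-lipschitz_on S (wave_field f)"
  using lipschitz_on_Pair[OF lipschitz_on_snd assms] that unfolding wave_field_def by blast

text \<open>Equilibria of the wave field lie on the axis \<open>y = 0\<close>;
  \<open>regular\<close> keeps them off the oval.\<close>

locale hamiltonian_oval =
  fixes V :: "(real \<times> real) set" and f H s :: "real \<times> real \<Rightarrow> real" and xc h :: real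
    and \<Gamma> :: "(real \<times> real) set" and p :: "real \<Rightarrow> real \<times> real"
  assumes openV: "open V" and C1f: "C1_on V f" and ham: "property_A_ii V f xc H s"
    and level: "\<Gamma> = level_oval V H h" and curve: "simple_closed_param \<Gamma> p"
    and regular: "\<And>x. (x, 0) \<in> \<Gamma> \<Longrightarrow> f (x, 0) \<noteq> 0"
begin

lemma subset: "\<Gamma> \<subseteq> V" by (auto simp: level level_oval_def)

lemma s_pos: "z \<in> V \<Longrightarrow> s z > 0" using ham by (auto simp: property_A_ii_def)

lemma compact_curve: "compact \<Gamma>"
  using curve by (auto simp: simple_closed_param_def simple_path_def compact_path_image)

lemma nonempty: "\<Gamma> \<noteq> {}"
  using curve by (auto simp: simple_closed_param_def)

lemma field_nonzero: "z \<in> \<Gamma> \<Longrightarrow> wave_field f z \<noteq> 0"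
  using regular by (cases z) (auto simp: wave_field_def zero_prod_def)

lemma field_lipschitz: obtains L where "L-lipschitz_on \<Gamma> (wave_field f)"
  using C1_on_compact_imp_lipschitz[OF C1f openV compact_curve subset] lipschitz_on_wave_field
  by metis

text \<open>The two fields differ by the positive factor \<open>1 / s\<close>: they have the same
  orbits and orientation but different speeds. This links the orientation in the line integral to
  the waves.\<close>

lemma hamiltonian_field_eq:
  assumes "z \<in> V"
  shows "hamiltonian_field H z = (1 / s z) *\<^sub>R wave_field f z"
proof -
  obtain x y where z: "z = (x, y)" by force
  have "((\<lambda>\<eta>. H (x, \<eta>)) has_real_derivative y / s (x, y)) (at y)"
    "((\<lambda>\<xi>. H (\<xi>, y)) has_real_derivative - (f (x, y) / s (x, y))) (at x)"
    using ham assms by (auto simp: property_A_ii_def z)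
  then have "deriv (\<lambda>\<eta>. H (x, \<eta>)) y = y / s (x, y)" "deriv (\<lambda>\<xi>. H (\<xi>, y)) x = - (f (x, y) / s (x, y))"
    by (auto intro: DERIV_imp_deriv)
  then show ?thesis by (simp add: hamiltonian_field_def z wave_field_def)
qed

lemma solution_determined:
  assumes z: "\<And>t. (z has_vector_derivative wave_field f (z t)) (at t)" "\<And>t. z t \<in> \<Gamma>"
    and w: "\<And>t. (w has_vector_derivative wave_field f (w t)) (at t)" "\<And>t. w t \<in> \<Gamma>"
    and eq: "z a = w b"
  shows "z (a + r) = w (b + r)"
proof -
  obtain L where lip: "L-lipschitz_on \<Gamma> (wave_field f)" by (rule field_lipschitz)
  have "z (r + a) = w (r + b)"
    by (rule lipschitz_solutions_unique[OF lip, of "\<lambda>t. z (t + a)" "\<lambda>t. w (t + b)" 0])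
      (auto intro!: has_vector_derivative_shift z w simp: eq)
  then show ?thesis by (simp add: add.commute)
qed

lemma solution_minimal_period:
  assumes z: "\<And>t. (z has_vector_derivative wave_field f (z t)) (at t)" "\<And>t. z t \<in> \<Gamma>"
  obtains T where "T > 0" "\<And>s t. z s = z t \<longleftrightarrow> (\<exists>k::int. t - s = of_int k * T)" "range z = \<Gamma>"
proof -
  obtain L where lip: "L-lipschitz_on \<Gamma> (wave_field f)" by (rule field_lipschitz)
  have cont: "continuous_on UNIV z"
    using z(1) by (meson continuous_at_imp_continuous_on has_vector_derivative_continuous)
  obtain \<tau> where "\<tau> > 0" "z \<tau> = z 0"
    by (rule solution_on_closed_curve_recurs[OF curve lip field_nonzero z])
  then obtain T where T: "T > 0" "\<And>s t. z s = z t \<longleftrightarrow> (\<exists>k::int. t - s = of_int k * T)"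
    using minimal_period_exists[OF solution_determined[OF z z] z(1) field_nonzero[OF z(2)] cont]
    by metis
  with periodic_orbit_covers_closed_curve[OF curve cont z(2) T] that show ?thesis by blast
qed

text \<open>An oriented parametrization is a time change of the flow; the antiderivative along the orbit
  therefore evaluates every integral that occurs in the definite description.\<close>

lemma line_integral_over_period:
  assumes z: "\<And>t. (z has_vector_derivative wave_field f (z t)) (at t)" "\<And>t. z t \<in> \<Gamma>"
    and T: "T > 0" "\<And>s t. z s = z t \<longleftrightarrow> (\<exists>k::int. t - s = of_int k * T)" and range: "range z = \<Gamma>"
    and A: "\<And>t. (A has_real_derivative k (z t) * snd (z t)) (at t)"
  shows "line_integral_dx (hamiltonian_field H) \<Gamma> k = A T - A 0"
    and "A (t + T) - A t = A T - A 0"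
proof -
  let ?F = "wave_field f" and ?X = "hamiltonian_field H"
  obtain L where lip: "L-lipschitz_on \<Gamma> ?F" by (rule field_lipschitz)
  have per: "z (t + T) = z t" for t using T(2)[of t "t + T"] by (auto intro: exI[of _ 1])
  have contz: "continuous_on S z" for S
    using z(1) by (meson continuous_at_imp_continuous_on has_vector_derivative_continuous)
  \<comment> \<open>The integrand along the orbit is periodic, so the gain of \<open>A\<close> over
    one period does not depend on the starting time.\<close>
  have shift: "A (t + T) - A t = A T - A 0" for t
  proof -
    have "((\<lambda>t. A (t + T) - A t) has_real_derivative 0) (at t)" for t
    proof -
      have "((\<lambda>t. A (t + T)) has_real_derivative k (z (t + T)) * snd (z (t + T))) (at t)"
        using A[of "t + T"] DERIV_shift by blast
      from DERIV_diff[OF this A[of t]] show ?thesis by (simp add: per)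
    qed
    then have "A (t + T) - A t = A (0 + T) - A 0" by (rule DERIV_isconst_all[rule_format])
    then show ?thesis by simp
  qed
  show "A (t + T) - A t = A T - A 0" by (rule shift)
  \<comment> \<open>The orbit itself, rescaled to the unit interval, witnesses existence in the
    definite description.\<close>
  define q where "q t = z (T * t)" for t
  have dq: "(q has_vector_derivative T *\<^sub>R ?F (q t)) (at t)" for t
  proof -
    have "((\<lambda>t. T * t) has_vector_derivative T) (at t)" by (auto intro!: derivative_eq_intros)
    from vector_diff_chain_at[OF this z(1)] show ?thesis by (simp add: o_def q_def[abs_def])
  qed
  then have vq: "vector_derivative q (at t) = T *\<^sub>R ?F (q t)" for t by (rule vector_derivative_at)
  have contq: "continuous_on S q" for S
    using dq by (meson continuous_at_imp_continuous_on has_vector_derivative_continuous)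
  have imq: "q ` {0..1} = \<Gamma>"
  proof -
    have "\<exists>u\<in>{0..1}. z t = q u" for t
    proof -
      have "\<exists>u\<in>{0..T}. z t = z u"
        by (rule periodic_in_period_image[of z T, OF per T(1)])
      then obtain u where "u \<in> {0..T}" "z t = z u" by (rule bexE)
      then show ?thesis using T(1) by (intro bexI[of _ "u / T"]) (auto simp: q_def)
    qed
    then have "range z \<subseteq> q ` {0..1}" by (blast intro: image_eqI)
    moreover have "q ` {0..1} \<subseteq> \<Gamma>" using z(2) by (intro image_subsetI) (simp add: q_def)
    ultimately show ?thesis using range by blast
  qed
  have simple: "simple_path q"
    unfolding simple_path_def path_def loop_free_def
  proof (intro conjI ballI impI contq)
    fix u v :: real assume uv: "u \<in> {0..1}" "v \<in> {0..1}" "q u = q v"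
    then obtain j :: int where "T * v - T * u = of_int j * T" by (auto simp: q_def T(2))
    then have "(v - u) * T = of_int j * T" by (simp add: algebra_simps)
    then have j: "v - u = of_int j" using T(1) by simp
    then have "\<bar>real_of_int j\<bar> \<le> 1" using uv by auto
    then have "j = - 1 \<or> j = 0 \<or> j = 1" by linarith
    then show "u = v \<or> u = 0 \<and> v = 1 \<or> u = 1 \<and> v = 0" using j uv by auto
  qed
  have loop: "pathfinish q = pathstart q"
    using per[of 0] by (simp add: pathfinish_def pathstart_def q_def)
  have contF: "continuous_on \<Gamma> ?F" using lip by (rule lipschitz_on_continuous_on)
  have orient: "oriented_param ?X \<Gamma> q"
    unfolding oriented_param_def simple_closed_param_def
  proof (intro conjI simple loop ballI)
    show "path_image q = \<Gamma>" using imq by (simp add: path_image_def)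
    show "q C1_differentiable_on {0..1}"
      unfolding C1_differentiable_on_eq vq
    proof (intro conjI ballI)
      show "q differentiable at t" for t using dq[of t] by (rule differentiableI_vector)
      show "continuous_on {0..1} (\<lambda>t. T *\<^sub>R ?F (q t))"
        by (intro continuous_intros continuous_on_compose2[OF contF contq]) (simp add: imq)
    qed
    fix t :: real assume "t \<in> {0..1}"
    then have V: "q t \<in> V" using imq subset by blast
    show "\<exists>r>0. vector_derivative q (at t) = r *\<^sub>R ?X (q t)"
      using T(1) s_pos[OF V]
      by (intro exI[of _ "T * s (q t)"]) (simp add: vq hamiltonian_field_eq[OF V])
  qed
  have int: "((\<lambda>t. k (q t) * fst (vector_derivative q (at t))) has_integral A T - A 0) {0..1}"
  proof -
    have "((\<lambda>t. A (T * t)) has_vector_derivative k (q t) * fst (vector_derivative q (at t))) (at t)" for t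
    proof -
      have "((\<lambda>t. A (T * t)) has_real_derivative k (z (T * t)) * snd (z (T * t)) * T) (at t)"
        by (rule DERIV_chain2[OF A]) (auto intro!: derivative_eq_intros)
      then show ?thesis
        unfolding has_real_derivative_iff_has_vector_derivative[symmetric] vq
        by (simp add: q_def wave_field_def algebra_simps)
    qed
    then have "((\<lambda>t. k (q t) * fst (vector_derivative q (at t))) has_integral A (T * 1) - A (T * 0)) {0..1}"
      by (intro fundamental_theorem_of_calculus) (auto intro: has_vector_derivative_at_within)
    then show ?thesis by simp
  qed
  have uniq: "J = A T - A 0"
    if pr: "oriented_param ?X \<Gamma> r"
      and J: "((\<lambda>t. k (r t) * fst (vector_derivative r (at t))) has_integral J) {0..1}" for r J
  proof -
    have r: "loop_free r" "path r" "r 1 = r 0" "\<And>t. t \<in> {0..1} \<Longrightarrow> r t \<in> \<Gamma>"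
      using pr by (auto simp: oriented_param_def simple_closed_param_def simple_path_def
          pathfinish_def pathstart_def path_image_def)
    define r' where "r' t = vector_derivative r (at t)" for t
    have dr: "(r has_vector_derivative r' t) (at t)" if "t \<in> {0..1}" for t
      using pr that unfolding oriented_param_def C1_differentiable_on_eq r'_def
      by (simp add: vector_derivative_works)
    have contr': "continuous_on {0..1} r'"
      using pr unfolding oriented_param_def C1_differentiable_on_eq r'_def by blast
    have contr: "continuous_on {0..1} r" using r(2) by (simp add: path_def)
    \<comment> \<open>Orientation provides a positive factor at each time separately; the quotient
      of norms exhibits it as a continuous function.\<close>
    define \<rho> where "\<rho> t = norm (r' t) / norm (?F (r t))" for t
    have \<rho>: "\<rho> t > 0 \<and> r' t = \<rho> t *\<^sub>R ?F (r t)" if t: "t \<in> {0..1}" for t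
    proof -
      have V: "r t \<in> V" using r(4)[OF t] subset by blast
      obtain a where a: "a > 0" "r' t = a *\<^sub>R ?X (r t)"
        using pr t unfolding oriented_param_def r'_def by blast
      define b where "b = a / s (r t)"
      have b: "b > 0" "r' t = b *\<^sub>R ?F (r t)"
        using a s_pos[OF V] by (auto simp: b_def hamiltonian_field_eq[OF V])
      have "\<rho> t = b" unfolding \<rho>_def b(2) using b(1) field_nonzero[OF r(4)[OF t]] by simp
      then show ?thesis using b by simp
    qed
    have cont\<rho>: "continuous_on {0..1} \<rho>"
      unfolding \<rho>_def
    proof (intro continuous_intros contr')
      show "continuous_on {0..1} (\<lambda>t. ?F (r t))"
        by (rule continuous_on_compose2[OF contF contr]) (use r(4) in auto)
    qed (use r(4) field_nonzero in auto)
    have "bounded (\<rho> ` {0..1})"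
      by (rule compact_imp_bounded[OF compact_continuous_image[OF cont\<rho> compact_Icc]])
    then have "\<exists>M. \<forall>t\<in>{0..1}. norm (\<rho> t) \<le> M"
      by (auto simp: bounded_iff)
    then obtain M where "\<forall>t\<in>{0..1}. norm (\<rho> t) \<le> M" by (rule exE)
    note M = this[rule_format]
    have "r 0 \<in> range z" using r(4)[of 0] range by simp
    then obtain t0 where t0: "z t0 = r 0" by (metis imageE)
    \<comment> \<open>The new time integrates the speed ratio, starting when the orbit passes
      through \<open>r 0\<close>; then \<open>r\<close> is \<open>z\<close> after
      \<open>\<theta>\<close>.\<close>
    define \<theta> where "\<theta> t = t0 + integral {0..t} \<rho>" for t
    have d\<theta>: "(\<theta> has_real_derivative \<rho> t) (at t within {0..1})" if "t \<in> {0..1}" for t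
      unfolding \<theta>_def has_real_derivative_iff_has_vector_derivative
      using integral_has_vector_derivative[OF cont\<rho> that] by (auto intro!: derivative_eq_intros)
    have \<theta>0: "\<theta> 0 = t0" by (simp add: \<theta>_def)
    have dz\<theta>: "((\<lambda>t. z (\<theta> t)) has_vector_derivative \<rho> t *\<^sub>R ?F (z (\<theta> t))) (at t within {0..1})"
      if "t \<in> {0..1}" for t
      using vector_diff_chain_within[of \<theta> "\<rho> t" t "{0..1}" z "?F (z (\<theta> t))"] d\<theta>[OF that]
        has_vector_derivative_at_within[OF z(1)]
      by (simp add: has_real_derivative_iff_has_vector_derivative o_def)
    have rz: "r t = z (\<theta> t)" if t: "t \<in> {0..1}" for t
    proof -
      have sub: "u \<in> {0..t} \<Longrightarrow> u \<in> {0..1}" for u using t by auto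
      have "norm (r t - z (\<theta> t)) \<le> exp ((M * L) * (t - 0)) * norm (r 0 - z (\<theta> 0))"
      proof (rule gronwall_difference)
        show "0 \<le> t" using t by simp
        fix u assume "u \<in> {0..t}"
        then have u: "u \<in> {0..1}" by (rule sub)
        show "(r has_vector_derivative r' u) (at u within {0..t})"
          using dr[OF u] by (rule has_vector_derivative_at_within)
        show "((\<lambda>t. z (\<theta> t)) has_vector_derivative \<rho> u *\<^sub>R ?F (z (\<theta> u))) (at u within {0..t})"
          using dz\<theta>[OF u] by (rule has_vector_derivative_within_subset) (use sub in auto)
        have "norm (r' u - \<rho> u *\<^sub>R ?F (z (\<theta> u))) = norm (\<rho> u) * norm (?F (r u) - ?F (z (\<theta> u)))"
          using \<rho>[OF u] by (simp flip: scaleR_diff_right)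
        also have "\<dots> \<le> M * (L * norm (r u - z (\<theta> u)))"
          using M[OF u] lipschitz_on_nonneg[OF lip] order_trans[OF norm_ge_zero M[OF u]]
          by (intro mult_mono lipschitz_on_normD[OF lip] r(4) u z(2)) auto
        finally show "norm (r' u - \<rho> u *\<^sub>R ?F (z (\<theta> u))) \<le> M * L * norm (r u - z (\<theta> u))" by simp
      qed
      then show ?thesis by (simp add: \<theta>0 t0)
    qed
    have cont\<theta>: "continuous_on {0..1} \<theta>"
      using d\<theta> by (meson DERIV_continuous continuous_on_eq_continuous_within)
    have "\<theta> 0 < \<theta> 1"
    proof (rule DERIV_pos_imp_increasing_open[of 0 1 \<theta>])
      fix t :: real assume t: "0 < t" "t < 1"
      then show "\<exists>y. (\<theta> has_real_derivative y) (at t) \<and> y > 0"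
        using d\<theta>[of t] \<rho>[of t] by (auto simp: at_within_Icc_at)
    qed (use cont\<theta> in auto)
    obtain j :: int where j: "\<theta> 1 - t0 = of_int j * T"
      using T(2)[of t0 "\<theta> 1"] rz[of 1] t0 r(3) by auto
    have "j \<ge> 1"
    proof (rule ccontr)
      assume "\<not> j \<ge> 1"
      then have "of_int j * T \<le> 0" using T(1) by (simp add: mult_le_0_iff)
      then show False using j \<open>\<theta> 0 < \<theta> 1\<close> \<theta>0 by linarith
    qed
    \<comment> \<open>A second turn would bring \<open>r\<close> back to \<open>r 0\<close> strictly
      between its ends, which \<open>loop_free\<close> forbids.\<close>
    have "j = 1"
    proof (rule ccontr)
      assume "j \<noteq> 1"
      then have "real_of_int j \<ge> 2" using \<open>j \<ge> 1\<close> by linarith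
      then have "2 * T \<le> of_int j * T" using T(1) by (intro mult_right_mono) auto
      then have jT: "\<theta> 0 \<le> t0 + T" "t0 + T < \<theta> 1" using j T(1) \<theta>0 by linarith+
      then obtain t where t: "0 \<le> t" "t \<le> 1" "\<theta> t = t0 + T"
        using IVT'[of \<theta> 0 "t0 + T" 1, OF _ _ _ cont\<theta>] by auto
      then have "r t = r 0" using rz[of t] rz[of 0] per[of t0] \<theta>0 by simp
      then have "t = 0 \<or> t = 1" using r(1) t unfolding loop_free_def by fastforce
      then show False using t jT \<theta>0 T(1) by auto
    qed
    then have \<theta>1: "\<theta> 1 = t0 + T" using j by simp
    have "((\<lambda>t. k (r t) * fst (vector_derivative r (at t))) has_integral A (\<theta> 1) - A (\<theta> 0)) {0..1}"
    proof (rule fundamental_theorem_of_calculus)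
      fix t :: real assume t: "t \<in> {0..1}"
      have "((\<lambda>t. A (\<theta> t)) has_real_derivative k (z (\<theta> t)) * snd (z (\<theta> t)) * \<rho> t) (at t within {0..1})"
        by (rule DERIV_chain2[OF A d\<theta>[OF t]])
      also have "k (z (\<theta> t)) * snd (z (\<theta> t)) * \<rho> t = k (r t) * fst (r' t)"
        using \<rho>[OF t] rz[OF t] by (simp add: wave_field_def)
      finally show "((\<lambda>t. A (\<theta> t)) has_vector_derivative k (r t) * fst (vector_derivative r (at t)))
          (at t within {0..1})"
        by (simp add: has_real_derivative_iff_has_vector_derivative r'_def)
    qed simp
    from has_integral_unique[OF J this] show ?thesis using shift[of t0] \<theta>0 \<theta>1 by simp
  qed
  show "line_integral_dx ?X \<Gamma> k = A T - A 0"
    unfolding line_integral_dx_def using orient int uniq by (intro the_equality) blast+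
qed

text \<open>A return time need not be the minimal period; it is a multiple of it, and the oval is
  counted once for each turn.\<close>

lemma melnikov_along_periodic_solution:
  assumes z: "\<And>t. (z has_vector_derivative wave_field f (z t)) (at t)" "\<And>t. z t \<in> \<Gamma>"
    and \<tau>: "\<tau> > 0" "z \<tau> = z 0"
    and A: "\<And>t. (A has_real_derivative k (z t) * snd (z t)) (at t)"
  obtains n :: nat where "n \<ge> 1"
    "A \<tau> - A 0 = real n * line_integral_dx (hamiltonian_field H) \<Gamma> k"
proof -
  obtain T where T: "T > 0" "\<And>s t. z s = z t \<longleftrightarrow> (\<exists>k::int. t - s = of_int k * T)" "range z = \<Gamma>"
    using solution_minimal_period[OF z] by metis
  note M = line_integral_over_period[OF z T A]
  obtain j :: int where j: "\<tau> = of_int j * T" using T(2)[of 0 \<tau>] \<tau>(2) by auto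
  then have "j > 0" using \<tau>(1) T(1) by (simp add: zero_less_mult_iff)
  then obtain n where n: "j = int n" "n \<ge> 1" by (metis nat_0_le less_imp_le of_nat_1 zless_nat_eq_int_zless int_one_le_iff_zero_less of_nat_le_iff)
  have "A (real m * T) - A 0 = real m * (A T - A 0)" for m :: nat
  proof (induction m)
    case (Suc m)
    then show ?case using M(2)[of "real m * T"] by (simp add: algebra_simps)
  qed simp
  from this[of n] show ?thesis using that n j M(1) by simp
qed

end

section \<open>The perturbed system\<close>

lemma lipschitz_on_mult_compact:
  fixes u v :: "'a::metric_space \<Rightarrow> real"
  assumes u: "L-lipschitz_on K u" and v: "M-lipschitz_on K v" and "compact K"
  obtains N where "N-lipschitz_on K (\<lambda>x. u x * v x)"
proof -
  have bdd: "\<exists>B. \<forall>x\<in>K. \<bar>f x\<bar> \<le> B" if "C-lipschitz_on K f" for C and f :: "'a \<Rightarrow> real"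
    using compact_imp_bounded[OF compact_continuous_image[OF lipschitz_on_continuous_on[OF that] \<open>compact K\<close>]]
    by (auto simp: bounded_iff)
  from bdd[OF u] obtain A where "\<forall>x\<in>K. \<bar>u x\<bar> \<le> A" by (rule exE)
  note A = this[rule_format]
  from bdd[OF v] obtain B where "\<forall>x\<in>K. \<bar>v x\<bar> \<le> B" by (rule exE)
  note B = this[rule_format]
  have "(\<bar>A\<bar> * M + \<bar>B\<bar> * L)-lipschitz_on K (\<lambda>x. u x * v x)"
  proof (rule lipschitz_onI)
    fix x y assume xy: "x \<in> K" "y \<in> K"
    have "\<bar>u x * v x - u y * v y\<bar> = \<bar>u x * (v x - v y) + v y * (u x - u y)\<bar>"
      by (simp add: algebra_simps)
    also have "\<dots> \<le> \<bar>u x\<bar> * \<bar>v x - v y\<bar> + \<bar>v y\<bar> * \<bar>u x - u y\<bar>"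
      by (rule order_trans[OF abs_triangle_ineq]) (simp add: abs_mult)
    also have "\<dots> \<le> \<bar>A\<bar> * (M * dist x y) + \<bar>B\<bar> * (L * dist x y)"
      using lipschitz_onD[OF u xy] lipschitz_onD[OF v xy] A[OF xy(1)] B[OF xy(2)]
      by (intro add_mono mult_mono) (auto simp: dist_real_def)
    finally show "dist (u x * v x) (u y * v y) \<le> (\<bar>A\<bar> * M + \<bar>B\<bar> * L) * dist x y"
      by (simp add: dist_real_def algebra_simps)
  qed (use lipschitz_on_nonneg[OF u] lipschitz_on_nonneg[OF v] in simp)
  then show ?thesis by (rule that)
qed

lemma lipschitz_on_inverse_compact:
  fixes u :: "'a::metric_space \<Rightarrow> real"
  assumes u: "L-lipschitz_on K u" and "compact K" and pos: "\<And>x. x \<in> K \<Longrightarrow> u x > 0"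
  obtains N where "N-lipschitz_on K (\<lambda>x. 1 / u x)"
proof (cases "K = {}")
  case True
  then show ?thesis using that[of 0] by simp
next
  case False
  obtain k where k: "k \<in> K" "\<And>x. x \<in> K \<Longrightarrow> u k \<le> u x"
    using continuous_attains_inf[OF \<open>compact K\<close> False lipschitz_on_continuous_on[OF u]] by blast
  have "(L / (u k)\<^sup>2)-lipschitz_on K (\<lambda>x. 1 / u x)"
  proof (rule lipschitz_onI)
    fix x y assume xy: "x \<in> K" "y \<in> K"
    have "\<bar>1 / u x - 1 / u y\<bar> = \<bar>u x - u y\<bar> / (u x * u y)"
      using pos[OF xy(1)] pos[OF xy(2)]
      by (simp add: field_simps abs_mult flip: abs_divide) (simp add: abs_minus_commute)
    also have "\<dots> \<le> (L * dist x y) / (u k * u k)"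
      using lipschitz_onD[OF u xy] pos[OF k(1)] k(2)[OF xy(1)] k(2)[OF xy(2)]
      by (intro frac_le mult_mono) (auto simp: dist_real_def)
    finally show "dist (1 / u x) (1 / u y) \<le> L / (u k)\<^sup>2 * dist x y"
      by (simp add: dist_real_def power2_eq_square)
  qed (use lipschitz_on_nonneg[OF u] in simp)
  then show ?thesis by (rule that)
qed

text \<open>Monotonicity in \<open>t\<close> traps the zero: at a fixed time just before or after it
  the sign of \<open>y\<close> persists for nearby parameters, so their zeros stay on the same side
  of that time. The branch later serves as the return time to the axis.\<close>

lemma continuous_zero_branch:
  fixes y :: "real \<Rightarrow> 'b::topological_space \<Rightarrow> real"
  assumes "\<alpha> < \<beta>"
    and mono: "\<And>l. l \<in> \<Lambda> \<Longrightarrow> strict_mono_on {\<alpha>..\<beta>} (\<lambda>t. y t l)"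
    and cont: "\<And>l. l \<in> \<Lambda> \<Longrightarrow> continuous_on {\<alpha>..\<beta>} (\<lambda>t. y t l)"
      "\<And>t. t \<in> {\<alpha>..\<beta>} \<Longrightarrow> continuous_on \<Lambda> (\<lambda>l. y t l)"
    and sgn: "\<And>l. l \<in> \<Lambda> \<Longrightarrow> y \<alpha> l < 0 \<and> 0 < y \<beta> l"
  obtains \<tau> where "continuous_on \<Lambda> \<tau>" "\<forall>l\<in>\<Lambda>. \<alpha> < \<tau> l \<and> \<tau> l < \<beta> \<and> y (\<tau> l) l = 0"
proof -
  have "\<exists>t. \<alpha> < t \<and> t < \<beta> \<and> y t l = 0" if l: "l \<in> \<Lambda>" for l
  proof -
    obtain t where "\<alpha> \<le> t" "t \<le> \<beta>" "y t l = 0"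
      using IVT'[of "\<lambda>t. y t l" \<alpha> 0 \<beta>] sgn[OF l] cont(1)[OF l] \<open>\<alpha> < \<beta>\<close> by auto
    then show ?thesis using sgn[OF l] by (metis less_irrefl order_le_less)
  qed
  then obtain \<tau> where \<tau>: "\<And>l. l \<in> \<Lambda> \<Longrightarrow> \<alpha> < \<tau> l \<and> \<tau> l < \<beta> \<and> y (\<tau> l) l = 0" by metis
  have "continuous_on \<Lambda> \<tau>"
    unfolding continuous_on_def
  proof (intro ballI order_tendstoI)
    fix l a assume l: "l \<in> \<Lambda>" and a: "a < \<tau> l"
    obtain t where t: "max a \<alpha> < t" "t < \<tau> l" using dense[of "max a \<alpha>" "\<tau> l"] a \<tau>[OF l] by auto
    then have tI: "t \<in> {\<alpha>..\<beta>}" using \<tau>[OF l] by auto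
    have "y t l < y (\<tau> l) l" using strict_mono_onD[OF mono[OF l] tI _ t(2)] \<tau>[OF l] by auto
    then have "y t l < 0" using \<tau>[OF l] by simp
    then have "\<forall>\<^sub>F k in at l within \<Lambda>. y t k < 0"
      using cont(2)[OF tI] l by (auto simp: continuous_on_def intro: order_tendstoD)
    moreover have "\<forall>\<^sub>F k in at l within \<Lambda>. k \<in> \<Lambda>" by (simp add: eventually_at_topological) blast
    ultimately show "\<forall>\<^sub>F k in at l within \<Lambda>. a < \<tau> k"
    proof eventually_elim
      case (elim k)
      have "t < \<tau> k"
      proof (rule ccontr)
        assume "\<not> t < \<tau> k"
        then have "y (\<tau> k) k \<le> y t k"
          using strict_mono_onD[OF mono[OF elim(2)], of "\<tau> k" t] tI \<tau>[OF elim(2)]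
          by (cases "\<tau> k = t") auto
        then show False using elim \<tau>[OF elim(2)] by simp
      qed
      then show ?case using t by simp
    qed
  next
    fix l a assume l: "l \<in> \<Lambda>" and a: "\<tau> l < a"
    obtain t where t: "t < min a \<beta>" "\<tau> l < t" using dense[of "\<tau> l" "min a \<beta>"] a \<tau>[OF l] by auto
    then have tI: "t \<in> {\<alpha>..\<beta>}" using \<tau>[OF l] by auto
    have "y (\<tau> l) l < y t l" using strict_mono_onD[OF mono[OF l] _ tI t(2)] \<tau>[OF l] by auto
    then have "y t l > 0" using \<tau>[OF l] by simp
    then have "\<forall>\<^sub>F k in at l within \<Lambda>. y t k > 0"
      using cont(2)[OF tI] l by (auto simp: continuous_on_def intro: order_tendstoD)
    moreover have "\<forall>\<^sub>F k in at l within \<Lambda>. k \<in> \<Lambda>" by (simp add: eventually_at_topological) blast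
    ultimately show "\<forall>\<^sub>F k in at l within \<Lambda>. \<tau> k < a"
    proof eventually_elim
      case (elim k)
      have "\<tau> k < t"
      proof (rule ccontr)
        assume "\<not> \<tau> k < t"
        then have "y t k \<le> y (\<tau> k) k"
          using strict_mono_onD[OF mono[OF elim(2)], of t "\<tau> k"] tI \<tau>[OF elim(2)]
          by (cases "\<tau> k = t") auto
        then show False using elim \<tau>[OF elim(2)] by simp
      qed
      then show ?case using t by simp
    qed
  qed
  with \<tau> show ?thesis by (intro that[of \<tau>]) auto
qed

text \<open>The parameter and the accumulated Melnikov integrand are carried along as extra state
  variables, so that continuity of the flow yields joint continuity of all three in
  time, initial point and parameter.\<close>

lemma augmented_flow_exists:
  fixes F G :: "(real \<times> real) \<times> real \<Rightarrow> real"
  assumes F: "L-lipschitz_on UNIV F" and G: "M-lipschitz_on UNIV G"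
  obtains z :: "(real \<times> real) \<times> real \<Rightarrow> real \<Rightarrow> real \<times> real" and w :: "(real \<times> real) \<times> real \<Rightarrow> real \<Rightarrow> real"
  where "\<forall>p \<epsilon>. z (p, \<epsilon>) 0 = p" "\<forall>l. w l 0 = 0"
    "\<forall>p \<epsilon> t. (z (p, \<epsilon>) has_vector_derivative wave_field (\<lambda>q. F (q, \<epsilon>)) (z (p, \<epsilon>) t)) (at t)"
    "\<forall>p \<epsilon> t. (w (p, \<epsilon>) has_real_derivative G (z (p, \<epsilon>) t, \<epsilon>)) (at t)"
    "continuous_on UNIV (\<lambda>(l, t). z l t)" "continuous_on UNIV (\<lambda>(l, t). w l t)"
proof -
  define X :: "((real \<times> real) \<times> real) \<times> real \<Rightarrow> ((real \<times> real) \<times> real) \<times> real"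
    where "X v = (((snd (fst (fst v)), F (fst v)), 0), G (fst v))" for v
  have lfst: "1-lipschitz_on UNIV (fst :: ((real \<times> real) \<times> real) \<times> real \<Rightarrow> _)"
    by (rule lipschitz_on_fst)
  note lip1 = lipschitz_on_compose2[OF lipschitz_on_compose2[OF lfst lipschitz_on_fst] lipschitz_on_snd]
  note lip2 = lipschitz_on_compose2[OF lfst lipschitz_on_subset[OF F subset_UNIV]]
  note lip3 = lipschitz_on_compose2[OF lfst lipschitz_on_subset[OF G subset_UNIV]]
  obtain N where "N-lipschitz_on UNIV X"
    using lipschitz_on_Pair[OF lipschitz_on_Pair[OF lipschitz_on_Pair[OF lip1 lip2] lipschitz_on_constant] lip3]
    unfolding X_def by blast
  then obtain \<Phi> :: "real \<Rightarrow> ((real \<times> real) \<times> real) \<times> real \<Rightarrow> ((real \<times> real) \<times> real) \<times> real"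
    where flow: "\<forall>p. \<Phi> 0 p = p" "\<forall>p t. ((\<lambda>t. \<Phi> t p) has_vector_derivative X (\<Phi> t p)) (at t)"
    and cont: "continuous_on UNIV (\<lambda>(t, p). \<Phi> t p)"
    by (rule lipschitz_flow_exists)
  note \<Phi> = flow[rule_format]
  define z where "z l t = fst (fst (\<Phi> t (l, 0)))" for l t
  define w where "w l t = snd (\<Phi> t (l, 0))" for l t
  have eps: "snd (fst (\<Phi> t ((p, \<epsilon>), 0))) = \<epsilon>" for t p \<epsilon>
  proof -
    have "((\<lambda>t. snd (fst (\<Phi> t ((p, \<epsilon>), 0)))) has_real_derivative 0) (at t)" for t
      using bounded_linear.has_vector_derivative[OF bounded_linear_snd
          bounded_linear.has_vector_derivative[OF bounded_linear_fst \<Phi>(2)[of "((p, \<epsilon>), 0)" t]]]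
      by (simp add: X_def has_real_derivative_iff_has_vector_derivative)
    then have "snd (fst (\<Phi> t ((p, \<epsilon>), 0))) = snd (fst (\<Phi> 0 ((p, \<epsilon>), 0)))"
      by (intro DERIV_isconst_all) blast
    then show ?thesis by (simp add: \<Phi>(1))
  qed
  have fstPhi: "fst (\<Phi> t ((p, \<epsilon>), 0)) = (z (p, \<epsilon>) t, \<epsilon>)" for t p \<epsilon>
    using eps[of t p \<epsilon>] by (simp add: z_def prod_eq_iff)
  have "(z (p, \<epsilon>) has_vector_derivative wave_field (\<lambda>q. F (q, \<epsilon>)) (z (p, \<epsilon>) t)) (at t)" for p \<epsilon> t
    using bounded_linear.has_vector_derivative[OF bounded_linear_fst
        bounded_linear.has_vector_derivative[OF bounded_linear_fst \<Phi>(2)[of "((p, \<epsilon>), 0)" t]]]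
    by (simp add: X_def wave_field_def fstPhi)
  moreover have "(w (p, \<epsilon>) has_real_derivative G (z (p, \<epsilon>) t, \<epsilon>)) (at t)" for p \<epsilon> t
    using bounded_linear.has_vector_derivative[OF bounded_linear_snd \<Phi>(2)[of "((p, \<epsilon>), 0)" t]]
    by (simp add: X_def w_def[abs_def] has_real_derivative_iff_has_vector_derivative fstPhi)
  moreover have "continuous_on UNIV (\<lambda>(l, t). \<Phi> t (l, 0))"
  proof -
    have "continuous_on UNIV (\<lambda>x. (\<lambda>(t, p). \<Phi> t p) (snd x, (fst x, 0)))"
      by (rule continuous_on_compose2[OF cont]) (auto intro!: continuous_intros)
    then show ?thesis by (simp add: case_prod_beta)
  qed
  then have "continuous_on UNIV (\<lambda>(l, t). z l t)" "continuous_on UNIV (\<lambda>(l, t). w l t)"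
    unfolding z_def w_def case_prod_beta by (intro continuous_intros; assumption)+
  ultimately show ?thesis
    using that[of z w] by (simp add: z_def w_def \<Phi>(1))
qed

text \<open>This collects what concerns the planar system alone; the link with \<open>P\<close>
  enters only when orbits are turned into waves.\<close>

locale perturbed_wave =
  fixes I :: "real set" and V :: "real \<Rightarrow> (real \<times> real) set"
    and f H s :: "real \<times> real \<Rightarrow> real" and g :: "real \<times> real \<times> real \<Rightarrow> real" and xc :: real
  assumes zero_in: "0 \<in> I"
    and open_V0: "open (V 0)"
    and open_total: "open {(x, y, \<epsilon>). \<epsilon> \<in> I \<and> (x, y) \<in> V \<epsilon>}"
    and C1f: "C1_on (V 0) f"
    and C1g: "C1_on {(x, y, \<epsilon>). \<epsilon> \<in> I \<and> (x, y) \<in> V \<epsilon>} g"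
    and ham: "property_A_ii (V 0) f xc H s"
    and equilibrium: "{x. (x, 0) \<in> V 0 \<and> f (x, 0) = 0} = {xc}"
begin

lemma s_pos: "z \<in> V 0 \<Longrightarrow> s z > 0" using ham by (auto simp: property_A_ii_def)

text \<open>The only equilibrium is \<open>(xc, 0)\<close>, where \<open>H\<close> vanishes, so no
  positive level contains one.\<close>

lemma hamiltonian_oval:
  assumes "h > 0" and "simple_closed_param (level_oval (V 0) H h) p"
  shows "hamiltonian_oval (V 0) f H s xc h (level_oval (V 0) H h) p"
proof (unfold_locales, rule open_V0, rule C1f, rule ham, rule refl, rule assms(2))
  fix x assume x: "(x, 0) \<in> level_oval (V 0) H h"
  show "f (x, 0) \<noteq> 0"
  proof
    assume "f (x, 0) = 0"
    then have "x = xc" using x equilibrium by (auto simp: level_oval_def)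
    then show False using x \<open>h > 0\<close> ham by (simp add: level_oval_def property_A_ii_def)
  qed
qed

lemma continuous_H: "continuous_on (V 0) H"
proof -
  obtain H' :: "real \<times> real \<Rightarrow> (real \<times> real) \<Rightarrow>\<^sub>L real"
    where "\<And>z. z \<in> V 0 \<Longrightarrow> (H has_derivative H' z) (at z)"
    using ham by (auto simp: property_A_ii_def C2_on_def)
  then show ?thesis
    by (meson continuous_at_imp_continuous_on has_derivative_continuous)
qed

lemma continuous_f: "continuous_on (V 0) f"
proof -
  obtain f' :: "real \<times> real \<Rightarrow> (real \<times> real) \<Rightarrow>\<^sub>L real"
    where "\<And>z. z \<in> V 0 \<Longrightarrow> (f has_derivative f' z) (at z)"
    using C1f by (auto simp: C1_on_def)
  then show ?thesis
    by (meson continuous_at_imp_continuous_on has_derivative_continuous)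
qed

text \<open>The partial derivatives of \<open>H\<close> are prescribed, and its differentiability
  assembles them into the chain rule. For the velocity \<open>(y, f + \<epsilon> * g)\<close> the
  terms with \<open>f\<close> cancel and \<open>\<epsilon> * g * y / s\<close> remains.\<close>

lemma H_chain:
  assumes "z t \<in> V 0" and "(z has_vector_derivative (a, b)) (at t)"
  shows "((\<lambda>t. H (z t)) has_real_derivative (snd (z t) * b - f (z t) * a) / s (z t)) (at t)"
proof -
  obtain H' :: "real \<times> real \<Rightarrow> (real \<times> real) \<Rightarrow>\<^sub>L real"
    where H': "\<And>z. z \<in> V 0 \<Longrightarrow> (H has_derivative H' z) (at z)"
    using ham by (auto simp: property_A_ii_def C2_on_def)
  obtain x y where xy: "z t = (x, y)" by force
  have D: "(H has_derivative H' (x, y)) (at (x, y))" using H' assms(1) xy by simp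
  have lin1: "H' (x, y) (u, 0) = u * H' (x, y) (1, 0)" for u
    using blinfun.scaleR_right[of "H' (x, y)" u "(1, 0)"] by simp
  have lin0: "H' (x, y) (0, u) = u * H' (x, y) (0, 1)" for u
    using blinfun.scaleR_right[of "H' (x, y)" u "(0, 1)"] by simp
  have "((\<lambda>\<xi>. H (\<xi>, y)) has_derivative (\<lambda>u. H' (x, y) (u, 0))) (at x)"
    by (rule has_derivative_compose[of "\<lambda>\<xi>. (\<xi>, y)" "\<lambda>u. (u, 0)"]) (auto intro!: derivative_eq_intros D)
  then have "((\<lambda>\<xi>. H (\<xi>, y)) has_real_derivative H' (x, y) (1, 0)) (at x)"
    unfolding has_field_derivative_def
    by (rule has_derivative_eq_rhs) (rule ext, subst lin1, rule mult.commute)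
  moreover have "((\<lambda>\<xi>. H (\<xi>, y)) has_real_derivative - (f (x, y) / s (x, y))) (at x)"
    using ham assms(1) xy by (auto simp: property_A_ii_def)
  ultimately have Hx: "H' (x, y) (1, 0) = - (f (x, y) / s (x, y))" by (rule DERIV_unique)
  have "((\<lambda>\<eta>. H (x, \<eta>)) has_derivative (\<lambda>u. H' (x, y) (0, u))) (at y)"
    by (rule has_derivative_compose[of "\<lambda>\<eta>. (x, \<eta>)" "\<lambda>u. (0, u)"]) (auto intro!: derivative_eq_intros D)
  then have "((\<lambda>\<eta>. H (x, \<eta>)) has_real_derivative H' (x, y) (0, 1)) (at y)"
    unfolding has_field_derivative_def
    by (rule has_derivative_eq_rhs) (rule ext, subst lin0, rule mult.commute)
  moreover have "((\<lambda>\<eta>. H (x, \<eta>)) has_real_derivative y / s (x, y)) (at y)"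
    using ham assms(1) xy by (auto simp: property_A_ii_def)
  ultimately have Hy: "H' (x, y) (0, 1) = y / s (x, y)" by (rule DERIV_unique)
  have ab: "H' (x, y) (a, b) = a * H' (x, y) (1, 0) + b * H' (x, y) (0, 1)"
    using blinfun.add_right[of "H' (x, y)" "(a, 0)" "(0, b)"] lin1[of a] lin0[of b] by simp
  have "((\<lambda>t. H (z t)) has_vector_derivative H' (x, y) (a, b)) (at t)"
    using vector_derivative_diff_chain_within[OF assms(2), of H "H' (x, y)"] D xy
    by (simp add: has_derivative_at_withinI o_def)
  then show ?thesis
    unfolding has_real_derivative_iff_has_vector_derivative ab Hx Hy xy
    by (simp add: diff_divide_distrib algebra_simps)
qed

text \<open>The field is replaced by a globally Lipschitz extension of its restriction to a compact
  neighbourhood; conservation of the Hamiltonian keeps the orbit on the level curve.\<close>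

lemma level_orbit_exists:
  assumes h: "h > 0" and curve: "simple_closed_param (level_oval (V 0) H h) r"
    and p: "p \<in> level_oval (V 0) H h"
  obtains z where "z 0 = p" "\<forall>t. (z has_vector_derivative wave_field f (z t)) (at t)"
    "\<forall>t. z t \<in> level_oval (V 0) H h"
proof -
  let ?\<Gamma> = "level_oval (V 0) H h"
  interpret O: hamiltonian_oval "V 0" f H s xc h ?\<Gamma> r using h curve by (rule hamiltonian_oval)
  obtain e where e: "e > 0" "{q. infdist q ?\<Gamma> \<le> e} \<subseteq> V 0"
    using compact_in_open_separated[OF O.nonempty O.compact_curve open_V0 O.subset] .
  define K where "K = {q. infdist q ?\<Gamma> \<le> e}"
  have K: "compact K" "K \<subseteq> V 0"
    using compact_infdist_le[OF O.nonempty O.compact_curve e(1)] e(2) by (auto simp: K_def)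
  have inK: "?\<Gamma> \<subseteq> K" using e(1) by (auto simp: K_def)
  obtain L where "L-lipschitz_on K f" using C1_on_compact_imp_lipschitz[OF C1f open_V0 K] .
  then obtain F where F: "L-lipschitz_on UNIV F" "\<And>q. q \<in> K \<Longrightarrow> F q = f q"
    using lipschitz_extension[of L K f] inK p by blast
  obtain M where "M-lipschitz_on UNIV (wave_field F)" by (rule lipschitz_on_wave_field[OF F(1)])
  then obtain z where z: "z 0 = p" "\<And>t. (z has_vector_derivative wave_field F (z t)) (at t)"
    using lipschitz_ode_exists by blast
  have contz: "continuous_on UNIV z"
    using z(2) by (meson continuous_at_imp_continuous_on has_vector_derivative_continuous)
  define Z where "Z = z -` ?\<Gamma>"
  have "closed Z"
    unfolding Z_def using contz compact_imp_closed[OF O.compact_curve] by (intro closed_vimage)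
  \<comment> \<open>The times spent on the level curve form a closed set. It is also open: for
    nearby times the orbit stays in \<open>K\<close>, where \<open>F\<close> is \<open>f\<close>, so
    \<open>H\<close> keeps its value. Connectedness of the line then gives all times.\<close>
  moreover have "open Z"
    unfolding open_contains_ball
  proof
    fix t assume t: "t \<in> Z"
    have "open ((\<lambda>t. infdist (z t) ?\<Gamma>) -` {..<e})"
      by (intro open_vimage continuous_intros contz)
    moreover have "t \<in> (\<lambda>t. infdist (z t) ?\<Gamma>) -` {..<e}" using t e(1) by (simp add: Z_def)
    ultimately obtain d where d: "d > 0" "ball t d \<subseteq> (\<lambda>t. infdist (z t) ?\<Gamma>) -` {..<e}"
      using openE by blast
    then have zK: "z u \<in> K" if "u \<in> ball t d" for u using that by (force simp: K_def)
    have "(\<lambda>u. H (z u)) constant_on ball t d"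
    proof (rule has_field_derivative_0_imp_constant_on)
      fix u assume "u \<in> ball t d"
      then have "z u \<in> V 0" "F (z u) = f (z u)" using zK K(2) F(2) by auto
      then show "((\<lambda>u. H (z u)) has_real_derivative 0) (at u)"
        using H_chain[of z u "snd (z u)" "f (z u)"] z(2)[of u] by (simp add: wave_field_def mult.commute)
    qed auto
    then have "H (z u) = H (z t)" if "u \<in> ball t d" for u
      using that d(1) unfolding constant_on_def by (metis centre_in_ball)
    moreover have "H (z t) = h" using t by (simp add: Z_def level_oval_def)
    ultimately have "ball t d \<subseteq> Z" using zK K(2) by (auto simp: Z_def level_oval_def)
    then show "\<exists>d>0. ball t d \<subseteq> Z" using d(1) by blast
  qed
  ultimately have "Z = UNIV" using z(1) p clopen[of Z] by (auto simp: Z_def)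
  then have in\<Gamma>: "z t \<in> ?\<Gamma>" for t by (auto simp: Z_def)
  then have "F (z t) = f (z t)" for t using F(2) inK by blast
  then have "(z has_vector_derivative wave_field f (z t)) (at t)" for t
    using z(2)[of t] by (simp add: wave_field_def)
  with in\<Gamma> z(1) show ?thesis by (intro that[of z]) auto
qed

text \<open>Compactness of \<open>K\<close> and openness of the total set give one parameter range
  valid for all of \<open>K\<close>. The function \<open>G\<close> extends the rate of change of
  \<open>H\<close> along orbits divided by \<open>\<epsilon>\<close>.\<close>

lemma lipschitz_extension_near:
  assumes K: "compact K" "K \<subseteq> V 0" "K \<noteq> {}"
  obtains \<epsilon>1 L M and F G :: "(real \<times> real) \<times> real \<Rightarrow> real" where "\<epsilon>1 > 0"
    "L-lipschitz_on UNIV F" "M-lipschitz_on UNIV G"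
    "\<forall>q\<in>K. \<forall>\<epsilon>. \<bar>\<epsilon>\<bar> \<le> \<epsilon>1 \<longrightarrow> \<epsilon> \<in> I \<and> q \<in> V \<epsilon> \<and> F (q, \<epsilon>) = f q + \<epsilon> * g (fst q, snd q, \<epsilon>)
       \<and> G (q, \<epsilon>) = g (fst q, snd q, \<epsilon>) * snd q / s q"
proof -
  let ?\<Omega> = "{(x, y, \<epsilon>). \<epsilon> \<in> I \<and> (x, y) \<in> V \<epsilon>}"
  \<comment> \<open>\<open>j\<close> only regroups a point with its parameter into the triple on
    which \<open>g\<close> is defined.\<close>
  define j :: "(real \<times> real) \<times> real \<Rightarrow> real \<times> real \<times> real"
    where "j v = (fst (fst v), snd (fst v), snd v)" for v
  have contj: "continuous_on S j" for S unfolding j_def by (intro continuous_intros)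
  have open_j: "open (j -` ?\<Omega>)" by (intro open_vimage open_total contj)
  have sub_j: "K \<times> {0} \<subseteq> j -` ?\<Omega>" using K(2) zero_in by (auto simp: j_def)
  have K0: "K \<times> {0::real} \<noteq> {}" "compact (K \<times> {0::real})"
    using K by (auto intro: compact_Times)
  obtain e where e: "e > 0" "{v. infdist v (K \<times> {0}) \<le> e} \<subseteq> j -` ?\<Omega>"
    using compact_in_open_separated[OF K0 open_j sub_j] .
  define K' where "K' = K \<times> {- e..e}"
  have K': "compact K'" "K' \<noteq> {}" using K e(1) by (auto simp: K'_def intro: compact_Times)
  have in\<Omega>: "j ` K' \<subseteq> ?\<Omega>"
  proof
    fix u assume "u \<in> j ` K'"
    then obtain q \<epsilon> where u: "u = j (q, \<epsilon>)" "q \<in> K" "\<bar>\<epsilon>\<bar> \<le> e" by (auto simp: K'_def)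
    have "infdist (q, \<epsilon>) (K \<times> {0}) \<le> dist (q, \<epsilon>) (q, 0)" using u by (intro infdist_le) auto
    then have "infdist (q, \<epsilon>) (K \<times> {0}) \<le> e" using u(3) by (simp add: dist_Pair_Pair)
    then have "(q, \<epsilon>) \<in> j -` ?\<Omega>" using e(2) by blast
    then show "u \<in> ?\<Omega>" unfolding u(1) by (rule vimageD)
  qed
  obtain Lg where "Lg-lipschitz_on (j ` K') g"
    using C1_on_compact_imp_lipschitz[OF C1g open_total compact_continuous_image[OF contj K'(1)] in\<Omega>] .
  moreover obtain Lj where "Lj-lipschitz_on K' j"
    unfolding j_def
    using lipschitz_on_Pair[OF lipschitz_on_compose2[OF lipschitz_on_fst lipschitz_on_fst]
        lipschitz_on_Pair[OF lipschitz_on_compose2[OF lipschitz_on_fst lipschitz_on_snd] lipschitz_on_snd]]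
    by blast
  ultimately obtain Lg' where lg: "Lg'-lipschitz_on K' (\<lambda>v. g (j v))"
    using lipschitz_on_compose2 by blast
  have K'K: "fst ` K' \<subseteq> K" by (auto simp: K'_def)
  obtain Lf where "Lf-lipschitz_on K f" using C1_on_compact_imp_lipschitz[OF C1f open_V0 K(1,2)] .
  from lipschitz_on_compose2[OF lipschitz_on_fst lipschitz_on_subset[OF this K'K]]
  have lf: "(Lf * 1)-lipschitz_on K' (\<lambda>v. f (fst v))" .
  have "C1_on (V 0) s" using ham by (simp add: property_A_ii_def)
  then obtain Ls where "Ls-lipschitz_on K s" using C1_on_compact_imp_lipschitz[OF _ open_V0 K(1,2)] by blast
  from lipschitz_on_compose2[OF lipschitz_on_fst lipschitz_on_subset[OF this K'K]]
  have ls: "(Ls * 1)-lipschitz_on K' (\<lambda>v. s (fst v))" .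
  have pos: "s (fst v) > 0" if "v \<in> K'" for v using that K'K K(2) s_pos by blast
  obtain Li where li: "Li-lipschitz_on K' (\<lambda>v. 1 / s (fst v))"
    by (rule lipschitz_on_inverse_compact[OF ls K'(1) pos])
  obtain L1 where l1: "L1-lipschitz_on K' (\<lambda>v. snd v * g (j v))"
    by (rule lipschitz_on_mult_compact[OF lipschitz_on_snd lg K'(1)])
  obtain L2 where l2: "L2-lipschitz_on K' (\<lambda>v. snd (fst v) * (1 / s (fst v)))"
    by (rule lipschitz_on_mult_compact[OF lipschitz_on_compose2[OF lipschitz_on_fst lipschitz_on_snd] li K'(1)])
  obtain L3 where l3: "L3-lipschitz_on K' (\<lambda>v. g (j v) * (snd (fst v) * (1 / s (fst v))))"
    by (rule lipschitz_on_mult_compact[OF lg l2 K'(1)])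
  obtain F where F: "(Lf * 1 + L1)-lipschitz_on UNIV F"
    "\<And>v. v \<in> K' \<Longrightarrow> F v = f (fst v) + snd v * g (j v)"
    using lipschitz_extension[OF lipschitz_on_add[OF lf l1] K'(2)] by metis
  obtain G where G: "L3-lipschitz_on UNIV G"
    "\<And>v. v \<in> K' \<Longrightarrow> G v = g (j v) * (snd (fst v) * (1 / s (fst v)))"
    using lipschitz_extension[OF l3 K'(2)] by metis
  show ?thesis
  proof (rule that[OF e(1) F(1) G(1)], intro ballI allI impI)
    fix q \<epsilon> assume "q \<in> K" "\<bar>\<epsilon>\<bar> \<le> e"
    then have v: "(q, \<epsilon>) \<in> K'" by (auto simp: K'_def)
    have "j (q, \<epsilon>) \<in> ?\<Omega>" by (rule subsetD[OF in\<Omega> imageI[OF v]])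
    then show "\<epsilon> \<in> I \<and> q \<in> V \<epsilon> \<and> F (q, \<epsilon>) = f q + \<epsilon> * g (fst q, snd q, \<epsilon>)
       \<and> G (q, \<epsilon>) = g (fst q, snd q, \<epsilon>) * snd q / s q"
      using F(2)[OF v] G(2)[OF v] by (simp add: j_def)
  qed
qed

end

section \<open>Periodic orbits near a simple zero\<close>

text \<open>The product form hides the sign of the derivative; a negative derivative is reduced to a
  positive one by passing to \<open>- M\<close>.\<close>

lemma simple_zero_sign_change:
  assumes "simple_zero M h"
  obtains \<delta> where "\<delta> > 0" "\<And>h1 h2. h - \<delta> < h1 \<Longrightarrow> h1 < h \<Longrightarrow> h < h2 \<Longrightarrow> h2 < h + \<delta> \<Longrightarrow> M h1 * M h2 < 0"
proof -
  obtain D where M: "M h = 0" "D \<noteq> 0" "(M has_real_derivative D) (at h)"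
    using assms by (auto simp: simple_zero_def)
  have *: "\<exists>\<delta>>0. \<forall>h1 h2. h - \<delta> < h1 \<longrightarrow> h1 < h \<longrightarrow> h < h2 \<longrightarrow> h2 < h + \<delta> \<longrightarrow> N h1 < 0 \<and> 0 < N h2"
    if E: "E > 0" and N: "(N has_real_derivative E) (at h)" and N0: "N h = 0" for N and E :: real
  proof -
    obtain d1 where d1: "d1 > 0" "\<forall>k>0. k < d1 \<longrightarrow> N h < N (h + k)"
      using DERIV_pos_inc_right[OF N E] by (elim exE conjE)
    obtain d2 where d2: "d2 > 0" "\<forall>k>0. k < d2 \<longrightarrow> N (h - k) < N h"
      using DERIV_pos_inc_left[OF N E] by (elim exE conjE)
    have "N h1 < 0 \<and> 0 < N h2" if "h - min d1 d2 < h1" "h1 < h" "h < h2" "h2 < h + min d1 d2" for h1 h2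
      using d1(2)[rule_format, of "h2 - h"] d2(2)[rule_format, of "h - h1"] that N0 by simp
    then show ?thesis using d1(1) d2(1) by (intro exI[of _ "min d1 d2"]) auto
  qed
  show ?thesis
  proof (cases "D > 0")
    case True
    from *[OF this M(3,1)] show ?thesis using that by (metis mult_neg_pos)
  next
    case False
    then have "- D > 0" "((\<lambda>h. - M h) has_real_derivative - D) (at h)" "- M h = 0"
      using M by (auto intro!: derivative_intros)
    from *[OF this] show ?thesis using that by (metis mult_pos_neg neg_0_less_iff_less neg_less_0_iff_less)
  qed
qed

lemma open_contains_box:
  fixes A :: "(real \<times> real) set"
  assumes "open A" "(a, b) \<in> A"
  obtains \<rho> where "\<rho> > 0" "{a - \<rho>..a + \<rho>} \<times> {b - \<rho>..b + \<rho>} \<subseteq> A"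
proof -
  obtain B C where BC: "open B" "open C" "(a, b) \<in> B \<times> C" "B \<times> C \<subseteq> A"
    by (rule open_prod_elim[OF assms])
  obtain r1 where r1: "r1 > 0" "cball a r1 \<subseteq> B"
    using BC(1,3) unfolding open_contains_cball by blast
  obtain r2 where r2: "r2 > 0" "cball b r2 \<subseteq> C"
    using BC(2,3) unfolding open_contains_cball by blast
  have "{a - min r1 r2..a + min r1 r2} \<subseteq> {a - r1..a + r1}"
    "{b - min r1 r2..b + min r1 r2} \<subseteq> {b - r2..b + r2}" by auto
  then have "{a - min r1 r2..a + min r1 r2} \<subseteq> B" "{b - min r1 r2..b + min r1 r2} \<subseteq> C"
    using r1(2) r2(2) unfolding cball_eq_atLeastAtMost by (meson order_trans)+
  with BC(4) r1(1) r2(1) show ?thesis by (intro that[of "min r1 r2"]) auto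
qed

context perturbed_wave
begin

text \<open>Over one period \<open>x\<close> returns to its value, so by the mean value theorem its
  derivative \<open>y\<close> vanishes at some time. Shifting time puts that point of the axis at
  time 0.\<close>

lemma level_orbit_from_axis:
  assumes h: "h > 0" and curve: "simple_closed_param (level_oval (V 0) H h) r"
  obtains a T z where "T > 0" "z 0 = (a, 0)" "z T = (a, 0)"
    "\<forall>t. (z has_vector_derivative wave_field f (z t)) (at t)" "\<forall>t. z t \<in> level_oval (V 0) H h"
    "\<forall>t. z (t + T) = z t"
proof -
  let ?\<Gamma> = "level_oval (V 0) H h"
  interpret O: hamiltonian_oval "V 0" f H s xc h ?\<Gamma> r using h curve by (rule hamiltonian_oval)
  obtain p where p: "p \<in> ?\<Gamma>" using O.nonempty by blast
  obtain z where "\<forall>t. (z has_vector_derivative wave_field f (z t)) (at t)" "\<forall>t. z t \<in> ?\<Gamma>"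
    using level_orbit_exists[OF h curve p] by metis
  note z = this[rule_format]
  obtain T where T: "T > 0" "\<And>s t. z s = z t \<longleftrightarrow> (\<exists>k::int. t - s = of_int k * T)"
    using O.solution_minimal_period[OF z] by metis
  have per: "z (t + T) = z t" for t using T(2)[of t "t + T"] by (auto intro: exI[of _ 1])
  have dx: "((\<lambda>t. fst (z t)) has_real_derivative snd (z t)) (at t)" for t
    using bounded_linear.has_vector_derivative[OF bounded_linear_fst z(1)[of t]]
    by (simp add: wave_field_def has_real_derivative_iff_has_vector_derivative)
  have "\<exists>u. 0 < u \<and> u < T \<and> fst (z T) - fst (z 0) = (T - 0) * snd (z u)"
    by (rule MVT2[OF T(1) dx])
  then obtain u where "T * snd (z u) = 0" using per[of 0] by auto
  then have u: "snd (z u) = 0" using T(1) by simp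
  show ?thesis
  proof (rule that[OF T(1), of "\<lambda>t. z (t + u)" "fst (z u)"])
    show "z (0 + u) = (fst (z u), 0)" using u by (simp add: prod_eq_iff)
    then show "z (T + u) = (fst (z u), 0)" using per[of u] by (simp add: add.commute)
    show "\<forall>t. ((\<lambda>t. z (t + u)) has_vector_derivative wave_field f (z (t + u))) (at t)"
      using z(1) by (blast intro: has_vector_derivative_shift)
    show "\<forall>t. z (t + T + u) = z (t + u)" using per[of "t + u" for t] by (simp add: ac_simps)
  qed (use z(2) in blast)
qed

text \<open>The tolerance \<open>\<kappa>\<close> keeps \<open>H\<close> along the orbit close to
  \<open>h\<close>, which later separates the waves of different zeros; \<open>d\<close> bounds the
  levels known to be closed curves.\<close>

lemma perturbed_periodic_orbits:
  assumes h: "h > 0" and "d > 0"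
    and curves: "\<And>h'. \<bar>h' - h\<bar> < d \<Longrightarrow> \<exists>r. simple_closed_param (level_oval (V 0) H h') r"
    and zero: "simple_zero (melnikov (V 0) g H s) h" and "\<kappa> > 0"
  shows "\<exists>\<epsilon>0>0. \<forall>\<epsilon>. \<bar>\<epsilon>\<bar> < \<epsilon>0 \<longrightarrow> \<epsilon> \<in> I \<and> (\<exists>z T. T > 0 \<and> (\<forall>t. z (t + T) = z t) \<and>
      (\<forall>t. (z has_vector_derivative wave_field (\<lambda>q. f q + \<epsilon> * g (fst q, snd q, \<epsilon>)) (z t)) (at t)) \<and>
      (\<forall>t. z t \<in> V \<epsilon> \<and> z t \<in> V 0 \<and> \<bar>H (z t) - h\<bar> < \<kappa>) \<and> (\<exists>t. snd (z t) \<noteq> 0))"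
proof -
  let ?\<Gamma> = "level_oval (V 0) H h"
  let ?M = "melnikov (V 0) g H s"
  obtain r where curve: "simple_closed_param ?\<Gamma> r" using curves[of h] \<open>d > 0\<close> by auto
  interpret O: hamiltonian_oval "V 0" f H s xc h ?\<Gamma> r using h curve by (rule hamiltonian_oval)
  obtain a T zs where T: "T > 0" and orbit0: "zs 0 = (a, 0)" "zs T = (a, 0)"
    "\<forall>t. (zs has_vector_derivative wave_field f (zs t)) (at t)" "\<forall>t. zs t \<in> ?\<Gamma>" "\<forall>t. zs (t + T) = zs t"
    by (rule level_orbit_from_axis[OF h curve])
  note orbit = orbit0[rule_format]
  have a\<Gamma>: "(a, 0) \<in> ?\<Gamma>" using orbit(4)[of 0] orbit(1) by simp
  have fa: "f (a, 0) \<noteq> 0" by (rule O.regular[OF a\<Gamma>])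
  \<comment> \<open>The sign of \<open>f\<close> at the crossing tells whether \<open>y\<close>
    increases or decreases there; the factor \<open>\<sigma>\<close> reduces both cases to an
    increasing crossing.\<close>
  define \<sigma> where "\<sigma> = sgn (f (a, 0))"
  have \<sigma>: "\<sigma> * f (a, 0) > 0" "\<sigma> = 1 \<or> \<sigma> = - 1" using fa by (auto simp: \<sigma>_def sgn_if)
  obtain \<delta>1 where \<delta>1: "\<delta>1 > 0"
    "\<And>h1 h2. h - \<delta>1 < h1 \<Longrightarrow> h1 < h \<Longrightarrow> h < h2 \<Longrightarrow> h2 < h + \<delta>1 \<Longrightarrow> ?M h1 * ?M h2 < 0"
    using simple_zero_sign_change[OF zero] by metis
  \<comment> \<open>The four bounds give closeness to \<open>h\<close>, levels that are closed
    curves, positive levels, and the sign pattern of the Melnikov function.\<close>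
  define \<delta> where "\<delta> = min (min \<kappa> d) (min h \<delta>1)"
  have \<delta>: "\<delta> > 0" "\<delta> \<le> \<kappa>" "\<delta> \<le> d" "\<delta> \<le> h" "\<delta> \<le> \<delta>1"
    using h \<open>d > 0\<close> \<open>\<kappa> > 0\<close> \<delta>1(1) by (auto simp: \<delta>_def)
  define B where "B = V 0 \<inter> H -` {h - \<delta><..<h + \<delta>}"
  have openB: "open B"
    unfolding B_def by (rule continuous_open_preimage[OF continuous_H open_V0 open_greaterThanLessThan])
  have \<Gamma>B: "?\<Gamma> \<subseteq> B" using \<delta>(1) by (auto simp: B_def level_oval_def)
  obtain e where e: "e > 0" "{q. infdist q ?\<Gamma> \<le> e} \<subseteq> B"
    using compact_in_open_separated[OF O.nonempty O.compact_curve openB \<Gamma>B] .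
  \<comment> \<open>The compact \<open>K\<close> carries the extensions; the open \<open>U\<close>
    inside it makes staying near the oval for a bounded time stable under perturbation.\<close>
  define K where "K = {q. infdist q ?\<Gamma> \<le> e}"
  define U where "U = {q. infdist q ?\<Gamma> < e}"
  have openU: "open U" unfolding U_def by (intro open_Collect_less continuous_intros)
  have UK: "U \<subseteq> K" "?\<Gamma> \<subseteq> U" using e(1) by (auto simp: U_def K_def)
  have KB: "K \<subseteq> B" using e(2) by (simp add: K_def)
  have KV: "K \<subseteq> V 0" using KB by (auto simp: B_def)
  have KH: "\<bar>H q - h\<bar> < \<delta>" if "q \<in> K" for q
  proof -
    have "q \<in> B" using that KB by blast
    then show ?thesis by (auto simp: B_def)
  qed
  have K: "compact K" unfolding K_def by (rule compact_infdist_le[OF O.nonempty O.compact_curve e(1)])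
  have Kne: "K \<noteq> {}" using a\<Gamma> UK by blast
  obtain \<epsilon>1 L N and F G :: "(real \<times> real) \<times> real \<Rightarrow> real" where \<epsilon>1: "\<epsilon>1 > 0"
    and FL: "L-lipschitz_on UNIV F" and GL: "N-lipschitz_on UNIV G"
    and ext: "\<forall>q\<in>K. \<forall>\<epsilon>. \<bar>\<epsilon>\<bar> \<le> \<epsilon>1 \<longrightarrow> \<epsilon> \<in> I \<and> q \<in> V \<epsilon> \<and> F (q, \<epsilon>) = f q + \<epsilon> * g (fst q, snd q, \<epsilon>)
       \<and> G (q, \<epsilon>) = g (fst q, snd q, \<epsilon>) * snd q / s q"
    by (rule lipschitz_extension_near[OF K KV Kne])
  obtain z :: "(real \<times> real) \<times> real \<Rightarrow> real \<Rightarrow> real \<times> real" and w :: "(real \<times> real) \<times> real \<Rightarrow> real \<Rightarrow> real"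
    where flow0: "\<forall>p \<epsilon>. z (p, \<epsilon>) 0 = p" "\<forall>l. w l 0 = 0"
    "\<forall>p \<epsilon> t. (z (p, \<epsilon>) has_vector_derivative wave_field (\<lambda>q. F (q, \<epsilon>)) (z (p, \<epsilon>) t)) (at t)"
    "\<forall>p \<epsilon> t. (w (p, \<epsilon>) has_real_derivative G (z (p, \<epsilon>) t, \<epsilon>)) (at t)"
    and cont: "continuous_on UNIV (\<lambda>(l, t). z l t)" "continuous_on UNIV (\<lambda>(l, t). w l t)"
    by (rule augmented_flow_exists[OF FL GL])
  note flow = flow0[rule_format]
  have FLe: "L-lipschitz_on UNIV (\<lambda>q. F (q, \<epsilon>))" for \<epsilon>
  proof (rule lipschitz_onI)
    show "dist (F (p, \<epsilon>)) (F (q, \<epsilon>)) \<le> L * dist p q" for p q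
      using lipschitz_onD[OF FL, of "(p, \<epsilon>)" "(q, \<epsilon>)"] by (simp add: dist_Pair_Pair)
  qed (rule lipschitz_on_nonneg[OF FL])
  have unique: "u t = v t"
    if "\<And>t. (u has_vector_derivative wave_field (\<lambda>q. F (q, \<epsilon>)) (u t)) (at t)"
      "\<And>t. (v has_vector_derivative wave_field (\<lambda>q. F (q, \<epsilon>)) (v t)) (at t)" "u 0 = v 0" for u v t \<epsilon>
  proof -
    obtain C where "C-lipschitz_on UNIV (wave_field (\<lambda>q. F (q, \<epsilon>)))" by (rule lipschitz_on_wave_field[OF FLe])
    from lipschitz_solutions_unique[OF this that(1) UNIV_I that(2) UNIV_I that(3)] show ?thesis .
  qed
  \<comment> \<open>Orbits start on the axis: the pair \<open>(x, \<epsilon>)\<close> stands for the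
    start \<open>(x, 0)\<close> with parameter \<open>\<epsilon>\<close>.\<close>
  define m :: "real \<times> real \<Rightarrow> (real \<times> real) \<times> real" where "m l = ((fst l, 0), snd l)" for l
  have contm: "continuous_on S m" for S unfolding m_def by (intro continuous_intros)
  have cz: "continuous_on S (\<lambda>v. z (m (k v)) (j v))"
    if "continuous_on S k" "continuous_on S j" for S :: "'c::topological_space set" and k j
  proof -
    have "continuous_on S (\<lambda>v. (\<lambda>(l, t). z l t) (m (k v), j v))"
      by (rule continuous_on_compose2[OF cont(1)])
        (auto simp: m_def intro!: continuous_intros that)
    then show ?thesis by simp
  qed
  have cw: "continuous_on S (\<lambda>v. w (m (k v)) (j v))"
    if "continuous_on S k" "continuous_on S j" for S :: "'c::topological_space set" and k j
  proof -
    have "continuous_on S (\<lambda>v. (\<lambda>(l, t). w l t) (m (k v), j v))"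
      by (rule continuous_on_compose2[OF cont(2)])
        (auto simp: m_def intro!: continuous_intros that)
    then show ?thesis by simp
  qed
  have contF: "continuous_on UNIV F" using FL by (rule lipschitz_on_continuous_on)
  have zs: "z (m (a, 0)) t = zs t" for t
  proof (rule unique[of _ 0])
    show "(z (m (a, 0)) has_vector_derivative wave_field (\<lambda>q. F (q, 0)) (z (m (a, 0)) t)) (at t)" for t
      unfolding m_def by (simp add: flow(3))
    show "(zs has_vector_derivative wave_field (\<lambda>q. F (q, 0)) (zs t)) (at t)" for t
    proof -
      have "zs t \<in> K" using orbit(4) UK by blast
      then have "F (zs t, 0) = f (zs t)" using ext \<epsilon>1 by simp
      then show ?thesis using orbit(3)[of t] by (simp add: wave_field_def)
    qed
  qed (simp add: m_def flow orbit)
  have dy: "((\<lambda>t. snd (z (m l) t)) has_real_derivative F (z (m l) t, snd l)) (at t)" for l t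
    using bounded_linear.has_vector_derivative[OF bounded_linear_snd flow(3)[of "(fst l, 0)" "snd l" t]]
    by (simp add: m_def wave_field_def has_real_derivative_iff_has_vector_derivative)

  have "open {q \<in> U. \<sigma> * f q > 0}"
  proof -
    have "continuous_on U (\<lambda>q. \<sigma> * f q)"
      using continuous_on_subset[OF continuous_f] UK KV by (intro continuous_intros) auto
    from continuous_open_preimage[OF this openU, of "{0<..}"] show ?thesis
      by (simp add: vimage_def Int_def conj_commute)
  qed
  moreover have "(a, 0) \<in> {q \<in> U. \<sigma> * f q > 0}" using a\<Gamma> UK(2) \<sigma>(1) by blast
  ultimately obtain \<rho>0 where \<rho>0: "\<rho>0 > 0"
    and sec: "{a - \<rho>0..a + \<rho>0} \<times> {0 - \<rho>0..0 + \<rho>0} \<subseteq> {q \<in> U. \<sigma> * f q > 0}"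
    by (rule open_contains_box)
  have secU: "(x, 0) \<in> U" "\<sigma> * f (x, 0) > 0" if "x \<in> {a - \<rho>0..a + \<rho>0}" for x
  proof -
    have "(x, 0) \<in> {a - \<rho>0..a + \<rho>0} \<times> {0 - \<rho>0..0 + \<rho>0}" using that \<rho>0 by auto
    then have "(x, 0) \<in> {q \<in> U. \<sigma> * f q > 0}" using sec by blast
    then show "(x, 0) \<in> U" "\<sigma> * f (x, 0) > 0" by auto
  qed
  \<comment> \<open>On the section \<open>f\<close> keeps its sign, and the derivative of
    \<open>H\<close> along the axis is \<open>- f / s\<close>.\<close>
  have Hmono: "\<sigma> * H (x', 0) < \<sigma> * H (x, 0)" if "x < x'" "x \<in> {a - \<rho>0..a + \<rho>0}" "x' \<in> {a - \<rho>0..a + \<rho>0}" for x x'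
  proof (rule DERIV_neg_imp_decreasing[OF that(1), of "\<lambda>x. \<sigma> * H (x, 0)"])
    fix y assume "x \<le> y" "y \<le> x'"
    then have y: "y \<in> {a - \<rho>0..a + \<rho>0}" using that by auto
    then have V: "(y, 0) \<in> V 0" using secU(1) UK KV by blast
    then have "((\<lambda>x. H (x, 0)) has_real_derivative - (f (y, 0) / s (y, 0))) (at y)"
      using ham by (auto simp: property_A_ii_def)
    then have "((\<lambda>x. \<sigma> * H (x, 0)) has_real_derivative \<sigma> * - (f (y, 0) / s (y, 0))) (at y)"
      by (rule DERIV_cmult)
    moreover have "\<sigma> * - (f (y, 0) / s (y, 0)) < 0"
      using secU(2)[OF y] s_pos[OF V] by (simp add: divide_pos_pos)
    ultimately show "\<exists>D. ((\<lambda>x. \<sigma> * H (x, 0)) has_real_derivative D) (at y) \<and> D < 0" by blast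
  qed
  have Hinj: "x = x'" if "H (x, 0) = H (x', 0)" "x \<in> {a - \<rho>0..a + \<rho>0}" "x' \<in> {a - \<rho>0..a + \<rho>0}" for x x'
    using Hmono[of x x'] Hmono[of x' x] that by (cases x x' rule: linorder_cases) auto

  text \<open>Near time \<open>T\<close> all orbits cross the axis transversally and close to \<open>a\<close>.\<close>
  define O1 where "O1 = {v. \<sigma> * F (z (m (fst v)) (snd v), snd (fst v)) > 0} \<inter>
      {v. \<bar>fst (z (m (fst v)) (snd v)) - a\<bar> < \<rho>0}"
  have "continuous_on UNIV (\<lambda>v. F (z (m (fst v)) (snd v), snd (fst v)))"
    by (rule continuous_on_compose2[OF contF]) (auto intro!: continuous_intros cz)
  moreover have "continuous_on UNIV (\<lambda>v. fst (z (m (fst v)) (snd v)))"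
    by (intro continuous_intros cz)
  ultimately have "open O1"
    unfolding O1_def by (intro open_Int open_Collect_less continuous_intros cz)
  moreover have "((a, 0), T) \<in> O1"
  proof -
    have "F ((a, 0), 0) = f (a, 0)" using ext \<epsilon>1 a\<Gamma> UK by auto
    then show ?thesis using zs[of T] orbit(2) \<sigma>(1) \<rho>0 by (simp add: O1_def)
  qed
  ultimately obtain A1 B1 where AB0: "open A1" "open B1" "((a, 0), T) \<in> A1 \<times> B1" "A1 \<times> B1 \<subseteq> O1"
    by (rule open_prod_elim)
  then have AB: "open A1" "open B1" "(a, 0) \<in> A1" "T \<in> B1" "A1 \<times> B1 \<subseteq> O1" by simp_all
  obtain \<eta>0 where \<eta>0: "\<eta>0 > 0" "cball T \<eta>0 \<subseteq> B1"
    using AB(2,4) unfolding open_contains_cball by blast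
  \<comment> \<open>The bound \<open>T / 2\<close> keeps the window of crossing times
    positive.\<close>
  define \<eta> where "\<eta> = min \<eta>0 (T / 2)"
  have \<eta>: "\<eta> > 0" "T - \<eta> > 0" using \<eta>0(1) T by (auto simp: \<eta>_def)
  have \<eta>B: "t \<in> B1" if "t \<in> {T - \<eta>..T + \<eta>}" for t
  proof -
    have "\<bar>T - t\<bar> \<le> \<eta>" using that by auto
    moreover have "\<eta> \<le> \<eta>0" by (simp add: \<eta>_def)
    ultimately have "t \<in> cball T \<eta>0" by (simp add: dist_real_def)
    then show ?thesis using \<eta>0(2) by blast
  qed
  have near: "\<sigma> * F (z (m l) t, snd l) > 0" "\<bar>fst (z (m l) t) - a\<bar> < \<rho>0"
    if "l \<in> A1" "t \<in> {T - \<eta>..T + \<eta>}" for l t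
  proof -
    have "(l, t) \<in> O1" using AB(5) \<eta>B[OF that(2)] that(1) by blast
    then show "\<sigma> * F (z (m l) t, snd l) > 0" "\<bar>fst (z (m l) t) - a\<bar> < \<rho>0" by (auto simp: O1_def)
  qed
  have ymono: "strict_mono_on {T - \<eta>..T + \<eta>} (\<lambda>t. \<sigma> * snd (z (m l) t))" if "l \<in> A1" for l
  proof (rule strict_mono_onI)
    fix t u assume tu: "t \<in> {T - \<eta>..T + \<eta>}" "u \<in> {T - \<eta>..T + \<eta>}" "t < u"
    show "\<sigma> * snd (z (m l) t) < \<sigma> * snd (z (m l) u)"
    proof (rule DERIV_pos_imp_increasing[OF tu(3), of "\<lambda>t. \<sigma> * snd (z (m l) t)"])
      fix v assume "t \<le> v" "v \<le> u"
      then have "v \<in> {T - \<eta>..T + \<eta>}" using tu by auto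
      from near(1)[OF that this] DERIV_cmult[OF dy, of \<sigma>]
      show "\<exists>D. ((\<lambda>t. \<sigma> * snd (z (m l) t)) has_real_derivative D) (at v) \<and> D > 0" by blast
    qed
  qed
  \<comment> \<open>These starts are on opposite sides of the axis at the two ends of the time
    window.\<close>
  define A2 where "A2 = {l. \<sigma> * snd (z (m l) (T - \<eta>)) < 0} \<inter> {l. 0 < \<sigma> * snd (z (m l) (T + \<eta>))}"
  have "continuous_on UNIV (\<lambda>l. \<sigma> * snd (z (m l) t))" for t
    by (intro continuous_intros cz[of _ "\<lambda>l. l"])
  then have A2: "open A2" unfolding A2_def by (intro open_Int open_Collect_less continuous_on_const)
  have aA2: "(a, 0) \<in> A2"
    using strict_mono_onD[OF ymono[OF AB(3)], of "T - \<eta>" T] strict_mono_onD[OF ymono[OF AB(3)], of T "T + \<eta>"]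
      \<eta> zs[of T] orbit(2) by (simp add: A2_def)
  define W where "W = {v. z (m (fst v)) (snd v) \<in> U}"
  have openW: "open W"
  proof -
    have "open ((\<lambda>v. z (m (fst v)) (snd v)) -` U)"
      by (intro open_vimage[OF openU] cz continuous_intros)
    then show ?thesis by (simp add: W_def vimage_def)
  qed
  \<comment> \<open>The unperturbed orbit stays in \<open>U\<close> for a compact time interval; the
    tube lemma passes this to all nearby starts and parameters at once.\<close>
  have "{(a, 0)} \<times> {0..T + \<eta>} \<subseteq> W" using zs orbit(4) UK(2) by (auto simp: W_def)
  from Elementary_Topology.tube_lemma[OF compact_Icc openW this]
  obtain A3 where A3: "(a, 0) \<in> A3" "open A3" "A3 \<times> {0..T + \<eta>} \<subseteq> W" by (elim exE conjE)
  have "open (A1 \<inter> A2 \<inter> A3)" "(a, 0) \<in> A1 \<inter> A2 \<inter> A3" using AB A2 aA2 A3 by auto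
  then obtain \<rho>1 where \<rho>1: "\<rho>1 > 0" "{a - \<rho>1..a + \<rho>1} \<times> {0 - \<rho>1..0 + \<rho>1} \<subseteq> A1 \<inter> A2 \<inter> A3"
    by (rule open_contains_box)
  define \<rho> where "\<rho> = min \<rho>1 (min \<rho>0 \<epsilon>1)"
  have \<rho>: "\<rho> > 0" "\<rho> \<le> \<rho>0" "\<rho> \<le> \<epsilon>1" "\<rho> \<le> \<rho>1" using \<rho>1(1) \<rho>0 \<epsilon>1 by (auto simp: \<rho>_def)
  define \<Lambda> where "\<Lambda> = {a - \<rho>..a + \<rho>} \<times> {- \<rho>..\<rho>}"
  have "\<Lambda> \<subseteq> {a - \<rho>1..a + \<rho>1} \<times> {0 - \<rho>1..0 + \<rho>1}" unfolding \<Lambda>_def using \<rho>(4) by (intro Sigma_mono) auto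
  then have "\<Lambda> \<subseteq> A1 \<inter> A2 \<inter> A3" using \<rho>1(2) by (rule order_trans)
  then have \<Lambda>: "l \<in> A1" "l \<in> A2" "l \<in> A3" if "l \<in> \<Lambda>" for l using that by auto
  have inU: "z (m l) t \<in> U" if "l \<in> \<Lambda>" "t \<in> {0..T + \<eta>}" for l t
  proof -
    have "(l, t) \<in> W" using A3(3) \<Lambda>(3)[OF that(1)] that(2) by blast
    then show ?thesis by (simp add: W_def)
  qed
  \<comment> \<open>This singles out the crossing near the period \<open>T\<close> among all
    passages through the axis.\<close>
  obtain \<tau> where c\<tau>: "continuous_on \<Lambda> \<tau>"
    and \<tau>0: "\<forall>l\<in>\<Lambda>. T - \<eta> < \<tau> l \<and> \<tau> l < T + \<eta> \<and> \<sigma> * snd (z (m l) (\<tau> l)) = 0"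
  proof (rule continuous_zero_branch[of "T - \<eta>" "T + \<eta>" \<Lambda> "\<lambda>t l. \<sigma> * snd (z (m l) t)"])
    show "T - \<eta> < T + \<eta>" using \<eta> by simp
    show "strict_mono_on {T - \<eta>..T + \<eta>} (\<lambda>t. \<sigma> * snd (z (m l) t))" if "l \<in> \<Lambda>" for l
      by (rule ymono[OF \<Lambda>(1)[OF that]])
    show "continuous_on {T - \<eta>..T + \<eta>} (\<lambda>t. \<sigma> * snd (z (m l) t))" if "l \<in> \<Lambda>" for l
      by (intro continuous_intros cz)
    show "continuous_on \<Lambda> (\<lambda>l. \<sigma> * snd (z (m l) t))" for t
      by (intro continuous_intros cz[of _ "\<lambda>l. l"])
    show "\<sigma> * snd (z (m l) (T - \<eta>)) < 0 \<and> 0 < \<sigma> * snd (z (m l) (T + \<eta>))" if "l \<in> \<Lambda>" for l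
      using \<Lambda>(2)[OF that] by (simp add: A2_def)
  qed
  have \<tau>: "T - \<eta> < \<tau> l" "\<tau> l < T + \<eta>" "snd (z (m l) (\<tau> l)) = 0" "\<tau> l > 0" if "l \<in> \<Lambda>" for l
    using \<tau>0 that \<sigma>(2) \<eta>(2) by force+
  define \<Delta> where "\<Delta> l = w (m l) (\<tau> l)" for l
  have c\<Delta>: "continuous_on \<Lambda> \<Delta>" unfolding \<Delta>_def by (intro cw[of _ "\<lambda>l. l"] c\<tau> continuous_intros)
  \<comment> \<open>Inside \<open>U\<close> the derivative of \<open>H\<close> along the orbit is
    \<open>\<epsilon>\<close> times the integrand of \<open>w\<close>, so this combination is
    conserved.\<close>
  have energy: "H (z (m l) t) - snd l * w (m l) t = H (fst l, 0)" if l: "l \<in> \<Lambda>" and t: "t \<in> {0..T + \<eta>}" for l t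
  proof -
    have d: "((\<lambda>t. H (z (m l) t) - snd l * w (m l) t) has_real_derivative 0) (at u)" if "u \<in> {0..T + \<eta>}" for u
    proof -
      have zK: "z (m l) u \<in> K" using inU[OF l that] UK by blast
      then have zV: "z (m l) u \<in> V 0" using KV by blast
      have "\<bar>snd l\<bar> \<le> \<epsilon>1" using l \<rho>(3) by (auto simp: \<Lambda>_def)
      then have FG: "F (z (m l) u, snd l) = f (z (m l) u) + snd l * g (fst (z (m l) u), snd (z (m l) u), snd l)"
        "G (z (m l) u, snd l) = g (fst (z (m l) u), snd (z (m l) u), snd l) * snd (z (m l) u) / s (z (m l) u)"
        using ext zK by auto
      have "(z (m l) has_vector_derivative (snd (z (m l) u), F (z (m l) u, snd l))) (at u)"
        using flow(3)[of "(fst l, 0)" "snd l" u] by (simp add: m_def wave_field_def)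
      from H_chain[OF zV this] have "((\<lambda>t. H (z (m l) t)) has_real_derivative
          snd l * G (z (m l) u, snd l)) (at u)"
        by (simp add: FG algebra_simps)
      moreover have "(w (m l) has_real_derivative G (z (m l) u, snd l)) (at u)"
        using flow(4)[of "(fst l, 0)" "snd l" u] by (simp add: m_def)
      ultimately show ?thesis by (auto intro!: derivative_eq_intros)
    qed
    have "H (z (m l) t) - snd l * w (m l) t = H (z (m l) 0) - snd l * w (m l) 0"
    proof (rule DERIV_isconst2[of 0 "T + \<eta>"])
      show "continuous_on {0..T + \<eta>} (\<lambda>t. H (z (m l) t) - snd l * w (m l) t)"
        using d by (meson DERIV_continuous continuous_at_imp_continuous_on)
    qed (use T \<eta> t d in auto)
    then show ?thesis by (simp add: flow m_def)
  qed
  \<comment> \<open>The orbit comes back to the section on its initial level, and \<open>H\<close>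
    is injective there, so it comes back to its start. The product form of the condition also covers
    \<open>\<epsilon> = 0\<close>, where every start qualifies.\<close>
  have closed: "z (m l) (t + \<tau> l) = z (m l) t" if l: "l \<in> \<Lambda>" and "snd l * \<Delta> l = 0" for l t
  proof -
    have \<tau>I: "\<tau> l \<in> {0..T + \<eta>}" "\<tau> l \<in> {T - \<eta>..T + \<eta>}" using \<tau>[OF l] by auto
    define x where "x = fst (z (m l) (\<tau> l))"
    have zx: "z (m l) (\<tau> l) = (x, 0)" using \<tau>(3)[OF l] by (simp add: x_def prod_eq_iff)
    have "H (x, 0) = H (fst l, 0)"
      using energy[OF l \<tau>I(1)] that(2) unfolding zx \<Delta>_def by linarith
    moreover have "x \<in> {a - \<rho>0..a + \<rho>0}" using near(2)[OF \<Lambda>(1)[OF l] \<tau>I(2)] by (auto simp: x_def)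
    moreover have "fst l \<in> {a - \<rho>0..a + \<rho>0}" using l \<rho>(2) by (auto simp: \<Lambda>_def)
    ultimately have "x = fst l" by (rule Hinj)
    then have start: "z (m l) (0 + \<tau> l) = z (m l) 0" using zx by (simp add: m_def flow)
    have sol: "(z (m l) has_vector_derivative wave_field (\<lambda>q. F (q, snd l)) (z (m l) t)) (at t)" for t
      using flow(3)[of "(fst l, 0)" "snd l" t] by (simp add: m_def)
    show ?thesis
      by (rule unique[where u = "\<lambda>t. z (m l) (t + \<tau> l)" and v = "z (m l)",
            OF has_vector_derivative_shift[OF sol] sol start])
  qed
  \<comment> \<open>Closing the orbit turns confinement during one return into confinement for all
    times, so the extended field is the original one along the whole orbit.\<close>
  have inK: "z (m l) t \<in> K" if l: "l \<in> \<Lambda>" and "snd l * \<Delta> l = 0" for l t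
  proof -
    have "\<exists>u\<in>{0..\<tau> l}. z (m l) t = z (m l) u"
      by (rule periodic_in_period_image[of "z (m l)" "\<tau> l", OF closed[OF that] \<tau>(4)[OF l]])
    then obtain u where u: "u \<in> {0..\<tau> l}" "z (m l) t = z (m l) u" by (rule bexE)
    then have "u \<in> {0..T + \<eta>}" using \<tau>(2)[OF l] by auto
    then have "z (m l) u \<in> U" by (rule inU[OF l])
    then show ?thesis using u(2) UK(1) by auto
  qed

  text \<open>At parameter zero every orbit closes up and the accumulated integrand is a multiple of the
    Melnikov function.\<close>
  have \<Delta>0: "\<exists>n::nat. n \<ge> 1 \<and> \<Delta> (x, 0) = real n * ?M (H (x, 0))" if x: "x \<in> {a - \<rho>..a + \<rho>}" for x
  proof -
    have l: "(x, 0) \<in> \<Lambda>" using x \<rho>(1) by (auto simp: \<Lambda>_def)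
    define k where "k = H (x, 0)"
    let ?z = "z (m (x, 0))"
    have zK: "?z t \<in> K" for t by (rule inK[OF l]) simp
    have per: "?z (t + \<tau> (x, 0)) = ?z t" for t by (rule closed[OF l]) simp
    have "\<bar>k - h\<bar> < \<delta>" using KH[OF zK[of 0]] by (simp add: k_def m_def flow)
    then obtain r' where r': "k > 0" "simple_closed_param (level_oval (V 0) H k) r'"
      using curves[of k] \<delta> by force
    interpret Q: hamiltonian_oval "V 0" f H s xc k "level_oval (V 0) H k" r'
      using r' by (rule hamiltonian_oval)
    have on: "?z t \<in> level_oval (V 0) H k" for t
    proof -
      have "\<exists>u\<in>{0..\<tau> (x, 0)}. ?z t = ?z u"
        by (rule periodic_in_period_image[of ?z "\<tau> (x, 0)", OF per \<tau>(4)[OF l]])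
      then obtain u where u: "u \<in> {0..\<tau> (x, 0)}" "?z t = ?z u" by (rule bexE)
      then have "H (?z u) = k" using energy[OF l, of u] \<tau>(2)[OF l] by (simp add: k_def)
      then show ?thesis using u zK[of t] KV by (auto simp: level_oval_def)
    qed
    have FG: "F (?z t, 0) = f (?z t)" "G (?z t, 0) = g (fst (?z t), snd (?z t), 0) * snd (?z t) / s (?z t)" for t
      using ext[rule_format, OF zK[of t], of 0] \<epsilon>1 by auto
    have sol: "(?z has_vector_derivative wave_field f (?z t)) (at t)" for t
      using flow(3)[of "(x, 0)" 0 t] FG(1)[of t] by (simp add: m_def wave_field_def)
    have acc: "(w (m (x, 0)) has_real_derivative (\<lambda>(x, y). g (x, y, 0) / s (x, y)) (?z t) * snd (?z t)) (at t)" for t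
      using flow(4)[of "(x, 0)" 0 t] FG(2)[of t] by (simp add: m_def case_prod_beta)
    obtain n :: nat where "n \<ge> 1" "w (m (x, 0)) (\<tau> (x, 0)) - w (m (x, 0)) 0 = real n *
        line_integral_dx (hamiltonian_field H) (level_oval (V 0) H k) (\<lambda>(x, y). g (x, y, 0) / s (x, y))"
      using Q.melnikov_along_periodic_solution[OF sol on \<tau>(4)[OF l] _ acc] per[of 0] by auto
    then show ?thesis by (auto simp: \<Delta>_def flow melnikov_def k_def)
  qed
  define x1 x2 where "x1 = a - \<rho>" and "x2 = a + \<rho>"
  have xs: "x1 \<in> {a - \<rho>..a + \<rho>}" "x2 \<in> {a - \<rho>..a + \<rho>}" "a \<in> {a - \<rho>0..a + \<rho>0}"
    "x1 \<in> {a - \<rho>0..a + \<rho>0}" "x2 \<in> {a - \<rho>0..a + \<rho>0}"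
    using \<rho> by (auto simp: x1_def x2_def)
  have Ha: "H (a, 0) = h" using a\<Gamma> by (simp add: level_oval_def)
  \<comment> \<open>The ends of the section lie on levels on opposite sides of \<open>h\<close>;
    \<open>\<sigma>\<close> decides which end is the higher one.\<close>
  have "?M (H (x1, 0)) * ?M (H (x2, 0)) < 0"
  proof -
    have 1: "\<sigma> * h < \<sigma> * H (x1, 0)" "\<sigma> * H (x2, 0) < \<sigma> * h"
      using Hmono[of x1 a] Hmono[of a x2] xs \<rho>(1) Ha by (auto simp: x1_def x2_def)
    have 2: "\<bar>H (x1, 0) - h\<bar> < \<delta>1" "\<bar>H (x2, 0) - h\<bar> < \<delta>1"
      using KH[of "(x1, 0)"] KH[of "(x2, 0)"] secU(1) xs UK \<delta>(5) by force+
    from \<sigma>(2) show ?thesis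
    proof
      assume "\<sigma> = 1"
      then show ?thesis using \<delta>1(2)[of "H (x2, 0)" "H (x1, 0)"] 1 2 by (simp add: mult.commute)
    next
      assume "\<sigma> = - 1"
      then show ?thesis using \<delta>1(2)[of "H (x1, 0)" "H (x2, 0)"] 1 2 by simp
    qed
  qed
  \<comment> \<open>The numbers of turns at the two ends may differ, but both are positive, so the
    sign change passes to \<open>\<Delta>\<close>.\<close>
  then have neg: "\<Delta> (x1, 0) * \<Delta> (x2, 0) < 0"
  proof -
    obtain n1 n2 :: nat where n: "n1 \<ge> 1" "n2 \<ge> 1" "\<Delta> (x1, 0) = real n1 * ?M (H (x1, 0))"
      "\<Delta> (x2, 0) = real n2 * ?M (H (x2, 0))" using \<Delta>0 xs by metis
    have "\<Delta> (x1, 0) * \<Delta> (x2, 0) = (real n1 * real n2) * (?M (H (x1, 0)) * ?M (H (x2, 0)))"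
      by (simp add: n)
    also have "\<dots> < 0"
      using n(1,2) \<open>?M (H (x1, 0)) * ?M (H (x2, 0)) < 0\<close> by (subst mult_less_0_iff) auto
    finally show ?thesis .
  qed
  have c\<epsilon>: "continuous_on {- \<rho>..\<rho>} (\<lambda>\<epsilon>. \<Delta> (x, \<epsilon>))" if "x \<in> {a - \<rho>..a + \<rho>}" for x
    by (rule continuous_on_compose2[OF c\<Delta>]) (use that in \<open>auto intro!: continuous_intros simp: \<Lambda>_def\<close>)
  have "isCont (\<lambda>\<epsilon>. \<Delta> (x1, \<epsilon>) * \<Delta> (x2, \<epsilon>)) 0"
    by (rule continuous_on_interior[of "{- \<rho>..\<rho>}"]) (use \<rho>(1) xs in \<open>auto intro!: continuous_intros c\<epsilon>\<close>)
  then have "\<forall>\<^sub>F \<epsilon> in at 0. \<Delta> (x1, \<epsilon>) * \<Delta> (x2, \<epsilon>) < 0"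
    unfolding isCont_def using neg by (rule order_tendstoD)
  then obtain \<epsilon>2 where \<epsilon>2: "\<epsilon>2 > 0"
    "\<And>\<epsilon>. \<epsilon> \<noteq> 0 \<Longrightarrow> \<bar>\<epsilon>\<bar> < \<epsilon>2 \<Longrightarrow> \<Delta> (x1, \<epsilon>) * \<Delta> (x2, \<epsilon>) < 0"
    by (auto simp: eventually_at dist_real_def)
  have main: "\<epsilon> \<in> I \<and> (\<exists>z T. T > 0 \<and> (\<forall>t. z (t + T) = z t) \<and>
      (\<forall>t. (z has_vector_derivative wave_field (\<lambda>q. f q + \<epsilon> * g (fst q, snd q, \<epsilon>)) (z t)) (at t)) \<and>
      (\<forall>t. z t \<in> V \<epsilon> \<and> z t \<in> V 0 \<and> \<bar>H (z t) - h\<bar> < \<kappa>) \<and> (\<exists>t. snd (z t) \<noteq> 0))"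
    if \<epsilon>: "\<bar>\<epsilon>\<bar> < min \<epsilon>2 \<rho>" for \<epsilon>
  proof -
    have cx: "continuous_on {x1..x2} (\<lambda>x. \<Delta> (x, \<epsilon>))"
      by (rule continuous_on_compose2[OF c\<Delta>])
        (use \<epsilon> in \<open>auto intro!: continuous_intros simp: \<Lambda>_def x1_def x2_def\<close>)
    \<comment> \<open>The punctured neighbourhood leaves out \<open>\<epsilon> = 0\<close>, where
      \<open>neg\<close> itself applies.\<close>
    have neg\<epsilon>: "\<Delta> (x1, \<epsilon>) * \<Delta> (x2, \<epsilon>) < 0"
      using \<epsilon>2(2)[of \<epsilon>] \<epsilon> neg by (cases "\<epsilon> = 0") auto
    have "x1 \<le> x2" using \<rho>(1) by (simp add: x1_def x2_def)
    have "\<exists>x. x1 \<le> x \<and> x \<le> x2 \<and> \<Delta> (x, \<epsilon>) = 0"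
      using neg\<epsilon> IVT'[of "\<lambda>x. \<Delta> (x, \<epsilon>)" x1 0 x2, OF _ _ \<open>x1 \<le> x2\<close> cx]
        IVT2'[of "\<lambda>x. \<Delta> (x, \<epsilon>)" x2 0 x1, OF _ _ \<open>x1 \<le> x2\<close> cx]
      unfolding mult_less_0_iff by force
    then obtain x where x: "x1 \<le> x" "x \<le> x2" "\<Delta> (x, \<epsilon>) = 0" by blast
    define l where "l = (x, \<epsilon>)"
    have l: "l \<in> \<Lambda>" "snd l * \<Delta> l = 0" using x \<epsilon> by (auto simp: l_def \<Lambda>_def x1_def x2_def)
    let ?z = "z (m l)"
    have zK: "?z t \<in> K" for t by (rule inK[OF l])
    have \<epsilon>le: "\<bar>\<epsilon>\<bar> \<le> \<epsilon>1" using \<epsilon> \<rho>(3) by simp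
    have Feq: "F (?z t, \<epsilon>) = f (?z t) + \<epsilon> * g (fst (?z t), snd (?z t), \<epsilon>)" for t
      using ext[rule_format, OF zK \<epsilon>le] by blast
    have sol: "(?z has_vector_derivative wave_field (\<lambda>q. f q + \<epsilon> * g (fst q, snd q, \<epsilon>)) (?z t)) (at t)" for t
      using flow(3)[of "(x, 0)" \<epsilon> t] Feq[of t] by (simp add: m_def l_def wave_field_def)
    \<comment> \<open>Were \<open>y\<close> identically 0, its derivative \<open>F\<close> would
      vanish at the return time, where the crossing is transversal.\<close>
    have "\<exists>t. snd (?z t) \<noteq> 0"
    proof (rule ccontr)
      assume "\<not> (\<exists>t. snd (?z t) \<noteq> 0)"
      then have "(\<lambda>t. snd (?z t)) = (\<lambda>t. 0)" by auto
      with dy[of l "\<tau> l"] have "F (?z (\<tau> l), snd l) = 0"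
        by (metis DERIV_const DERIV_unique)
      with near(1)[OF \<Lambda>(1)[OF l(1)], of "\<tau> l"] \<tau>[OF l(1)] show False by simp
    qed
    moreover have "\<epsilon> \<in> I" using ext[rule_format, OF zK[of 0] \<epsilon>le] by blast
    moreover have "?z t \<in> V \<epsilon> \<and> ?z t \<in> V 0 \<and> \<bar>H (?z t) - h\<bar> < \<kappa>" for t
      using ext[rule_format, OF zK[of t] \<epsilon>le] subsetD[OF KV zK[of t]] KH[OF zK[of t]] \<delta>(2)
      by auto
    ultimately show ?thesis
      using sol closed[OF l] \<tau>(4)[OF l(1)] by blast
  qed
  show ?thesis
    by (rule exI[of _ "min \<epsilon>2 \<rho>"]) (use main \<epsilon>2(1) \<rho>(1) in auto)
qed

end

section \<open>From orbits to waves\<close>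

lemma C1_on_subset: "C1_on S f \<Longrightarrow> T \<subseteq> S \<Longrightarrow> C1_on T f"
  unfolding C1_on_def by (meson continuous_on_subset subsetD)

lemma C1_on_imp_continuous_on:
  assumes "C1_on S f"
  shows "continuous_on S f"
  using assms unfolding C1_on_def
  by (meson continuous_at_imp_continuous_on has_derivative_continuous)

text \<open>The wave is \<open>U\<close> after the linear form \<open>l\<close>. Its derivatives are
  \<open>U'\<close> times \<open>l\<close> and \<open>U''\<close> times the curried bilinear square
  \<open>B\<close> of \<open>l\<close>.\<close>

lemma C2_on_traveling_profile:
  fixes U Y A :: "real \<Rightarrow> real"
  assumes U: "\<And>t. (U has_real_derivative Y t) (at t)" and Y: "\<And>t. (Y has_real_derivative A t) (at t)"
    and contA: "continuous_on UNIV A"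
  shows "C2_on UNIV (\<lambda>(x, t). U (x - c * t))"
proof -
  define l :: "(real \<times> real) \<Rightarrow>\<^sub>L real" where "l = Blinfun (\<lambda>p. fst p - c * snd p)"
  have l: "l p = fst p - c * snd p" for p
    unfolding l_def by (subst bounded_linear_Blinfun_apply) (intro bounded_linear_intros, rule refl)
  define B :: "(real \<times> real) \<Rightarrow>\<^sub>L ((real \<times> real) \<Rightarrow>\<^sub>L real)" where "B = Blinfun (\<lambda>p. l p *\<^sub>R l)"
  have B: "B p = l p *\<^sub>R l" for p
    unfolding B_def by (subst bounded_linear_Blinfun_apply) (intro bounded_linear_intros, rule refl)
  have dl: "(blinfun_apply l has_derivative blinfun_apply l) (at p)" for p
    by (rule bounded_linear_imp_has_derivative[OF blinfun.bounded_linear_right])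
  have U': "((\<lambda>p. U (l p)) has_derivative blinfun_apply (Y (l p) *\<^sub>R l)) (at p)" for p
  proof -
    have "blinfun_apply (Y (l p) *\<^sub>R l) = (\<lambda>v. Y (l p) * l v)"
      by (simp add: fun_eq_iff blinfun.scaleR_left)
    then show ?thesis
      using has_derivative_compose[OF dl U[unfolded has_field_derivative_def]] by simp
  qed
  have "((\<lambda>p. Y (l p) *\<^sub>R l) has_derivative blinfun_apply (A (l p) *\<^sub>R B)) (at p)" for p
  proof -
    have "((\<lambda>p. Y (l p)) has_derivative (\<lambda>v. A (l p) * l v)) (at p)"
      by (rule has_derivative_compose[OF dl Y[unfolded has_field_derivative_def]])
    then have "((\<lambda>p. Y (l p) *\<^sub>R l) has_derivative (\<lambda>v. (A (l p) * l v) *\<^sub>R l)) (at p)"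
      by (rule has_derivative_scaleR_left)
    moreover have "blinfun_apply (A (l p) *\<^sub>R B) = (\<lambda>v. (A (l p) * l v) *\<^sub>R l)"
      by (simp add: fun_eq_iff blinfun.scaleR_left B)
    ultimately show ?thesis by simp
  qed
  moreover have "continuous_on UNIV (\<lambda>p. A (l p) *\<^sub>R B)"
    by (intro continuous_intros continuous_on_compose2[OF contA]) auto
  ultimately have "C1_on UNIV (\<lambda>p. Y (l p) *\<^sub>R l)"
    unfolding C1_on_def by (intro exI[of _ "\<lambda>p. A (l p) *\<^sub>R B"]) blast
  then have "C2_on UNIV (\<lambda>p. U (l p))"
    unfolding C2_on_def using U' by (intro exI[of _ "\<lambda>p. Y (l p) *\<^sub>R l"]) blast
  moreover have "(\<lambda>p. U (l p)) = (\<lambda>(x, t). U (x - c * t))" by (auto simp: l)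
  ultimately show ?thesis by simp
qed

lemma jet_of_traveling_profile:
  fixes U Y A :: "real \<Rightarrow> real"
  assumes U: "\<And>t. (U has_real_derivative Y t) (at t)" and Y: "\<And>t. (Y has_real_derivative A t) (at t)"
  shows "jet_of (\<lambda>x t. U (x - c * t)) x t
    = wave_jet c (U (x - c * t), Y (x - c * t), A (x - c * t))"
proof -
  have X: "deriv (\<lambda>\<xi>. k * G (\<xi> - c * t)) x = k * G' (x - c * t)"
    if "\<And>t. (G has_real_derivative G' t) (at t)" for G G' k x t
  proof -
    have "((\<lambda>\<xi>. G (\<xi> - c * t)) has_real_derivative G' (x - c * t) * 1) (at x)"
      by (rule DERIV_chain2[OF that]) (auto intro!: derivative_eq_intros)
    from DERIV_cmult[OF this, of k] show ?thesis by (simp add: DERIV_imp_deriv)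
  qed
  \<comment> \<open>The factor \<open>k\<close> lets the same rule differentiate
    \<open>- c * Y\<close> once more.\<close>
  have T: "deriv (\<lambda>\<tau>. k * G (x - c * \<tau>)) t = - c * k * G' (x - c * t)"
    if "\<And>t. (G has_real_derivative G' t) (at t)" for G G' k x t
  proof -
    have "((\<lambda>\<tau>. G (x - c * \<tau>)) has_real_derivative G' (x - c * t) * - c) (at t)"
      by (rule DERIV_chain2[OF that]) (auto intro!: derivative_eq_intros)
    from DERIV_imp_deriv[OF DERIV_cmult[OF this, of k]] show ?thesis by simp
  qed
  have Dx: "Dx (\<lambda>x t. U (x - c * t)) = (\<lambda>x t. Y (x - c * t))"
    using X[OF U, of 1] by (simp add: Dx_def fun_eq_iff)
  have Dt: "Dt (\<lambda>x t. U (x - c * t)) = (\<lambda>x t. - c * Y (x - c * t))"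
    using T[OF U, of 1] by (simp add: Dt_def fun_eq_iff)
  have "Dx (\<lambda>x t. Y (x - c * t)) x t = A (x - c * t)"
    using X[OF Y, of 1] by (simp add: Dx_def)
  moreover have "Dt (\<lambda>x t. Y (x - c * t)) x t = - c * A (x - c * t)"
    using T[OF Y, of 1] by (simp add: Dt_def)
  moreover have "Dt (\<lambda>x t. - c * Y (x - c * t)) x t = c\<^sup>2 * A (x - c * t)"
    using T[OF Y, of "- c"] by (simp add: Dt_def power2_eq_square)
  ultimately show ?thesis
    by (simp add: jet_of_def Dx Dt wave_jet_def)
qed

lemma solution_components:
  assumes "(z has_vector_derivative wave_field k (z t)) (at t)"
  shows "((\<lambda>t. fst (z t)) has_real_derivative snd (z t)) (at t)"
    and "((\<lambda>t. snd (z t)) has_real_derivative k (z t)) (at t)"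
  using bounded_linear.has_vector_derivative[OF bounded_linear_fst assms]
    bounded_linear.has_vector_derivative[OF bounded_linear_snd assms]
  by (simp_all add: wave_field_def has_real_derivative_iff_has_vector_derivative)

text \<open>Along an orbit the profile has second derivative \<open>k (z t)\<close>, so
  \<open>eq\<close> is the partial differential equation evaluated on the jet of the wave.\<close>

lemma periodic_wave_of_solution:
  assumes z: "\<And>t. (z has_vector_derivative wave_field k (z t)) (at t)"
    and cont: "continuous_on UNIV (\<lambda>t. k (z t))"
    and T: "T > 0" "\<And>t. z (t + T) = z t" and nonconst: "snd (z t0) \<noteq> 0"
    and eq: "\<And>t. (fst (z t), snd (z t), k (z t)) \<in> {w \<in> W_c W c. P_c P c w \<epsilon> = 0}"
  shows "periodic_wave P W \<epsilon> c (\<lambda>t. fst (z t))"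
proof -
  note d = solution_components[OF z]
  have "traveling_wave P W \<epsilon> c (\<lambda>t. fst (z t))"
    unfolding traveling_wave_def pde_solution_def
  proof (intro conjI allI)
    show "C2_on UNIV (\<lambda>(x, t). fst (z (x - c * t)))" by (rule C2_on_traveling_profile[OF d cont])
    fix x t
    have "jet_of (\<lambda>x t. fst (z (x - c * t))) x t = wave_jet c
        (fst (z (x - c * t)), snd (z (x - c * t)), k (z (x - c * t)))"
      by (rule jet_of_traveling_profile[OF d])
    then show "jet_of (\<lambda>x t. fst (z (x - c * t))) x t \<in> W"
      "P (jet_of (\<lambda>x t. fst (z (x - c * t))) x t) \<epsilon> = 0"
      using eq[of "x - c * t"] by (auto simp: W_c_def P_c_def)
  qed
  moreover have "\<not> (\<lambda>t. fst (z t)) constant_on UNIV"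
  proof
    assume "(\<lambda>t. fst (z t)) constant_on UNIV"
    then obtain b where "(\<lambda>t. fst (z t)) = (\<lambda>t. b)" by (auto simp: constant_on_def)
    with d(1)[of t0] have "((\<lambda>t. b) has_real_derivative snd (z t0)) (at t0)" by simp
    then show False using nonconst DERIV_const DERIV_unique by blast
  qed
  ultimately show ?thesis using T by (auto simp: periodic_wave_def intro: exI[of _ T])
qed

text \<open>Equal profiles up to translation have equal derivatives up to the same translation, so
  the phase plane orbits share a point. Different values of \<open>H\<close> then rule this
  out.\<close>

lemma same_wave_meets:
  assumes z: "\<And>t. (z has_vector_derivative wave_field k (z t)) (at t)"
    and w: "\<And>t. (w has_vector_derivative wave_field k (w t)) (at t)"
    and same: "same_wave (\<lambda>t. fst (z t)) (\<lambda>t. fst (w t))"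
  obtains a where "w 0 = z a"
proof -
  obtain a where "\<forall>t. fst (w t) = fst (z (t + a))" using same unfolding same_wave_def by (rule exE)
  note a = this[rule_format]
  have "((\<lambda>t. fst (w t)) has_real_derivative snd (z (0 + a))) (at 0)"
    unfolding a using solution_components(1)[OF has_vector_derivative_shift[OF z]] by blast
  with solution_components(1)[OF w] have "snd (w 0) = snd (z (0 + a))" by (rule DERIV_unique)
  with a[of 0] have "w 0 = z a" by (simp add: prod_eq_iff)
  then show ?thesis by (rule that)
qed

lemma separation_of_finite_family:
  fixes u :: "nat \<Rightarrow> real"
  assumes "finite J" "inj_on u J"
  obtains \<kappa> where "\<kappa> > 0" "\<And>i j. i \<in> J \<Longrightarrow> j \<in> J \<Longrightarrow> i \<noteq> j \<Longrightarrow> 2 * \<kappa> \<le> \<bar>u i - u j\<bar>"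
proof
  \<comment> \<open>The element \<open>1\<close> keeps \<open>D\<close> nonempty when there are no
    two distinct indices.\<close>
  define D where "D = insert 1 ((\<lambda>(i, j). \<bar>u i - u j\<bar>) ` {(i, j) \<in> J \<times> J. i \<noteq> j})"
  have fin: "finite D"
    unfolding D_def
    by (intro finite.insertI finite_imageI, rule finite_subset[of _ "J \<times> J"]) (auto simp: assms(1))
  have "\<forall>d\<in>D. d > 0" using assms(2) by (auto simp: D_def inj_on_def)
  then show "Min D / 2 > 0" using fin Min_in[of D] by (simp add: D_def)
  fix i j assume "i \<in> J" "j \<in> J" "i \<noteq> j"
  then have "\<bar>u i - u j\<bar> \<in> D" by (auto simp: D_def)
  then show "2 * (Min D / 2) \<le> \<bar>u i - u j\<bar>" using Min_le[OF fin] by simp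
qed

theorem theorem1:
  fixes P :: "jet \<Rightarrow> real \<Rightarrow> real" and W :: "jet set" and I :: "real set"
    and c :: real and L :: nat
  assumes "open W"
    and "open I" and "is_interval I" and "0 \<in> I"
    and "C1_on (W \<times> I) (\<lambda>(w, \<epsilon>). P w \<epsilon>)"
    and "property_A P W I c L"
  shows "(\<exists>a b. a < b \<and> (\<exists>U :: real \<Rightarrow> real \<Rightarrow> real.
            (\<forall>h\<in>{a<..<b}. periodic_wave P W 0 c (U h)) \<and>
            (\<forall>h\<in>{a<..<b}. \<forall>k\<in>{a<..<b}. h \<noteq> k \<longrightarrow> \<not> same_wave (U h) (U k)))) \<and>
         (\<exists>\<epsilon>\<^sub>0>0. \<forall>\<epsilon>\<in>I. \<bar>\<epsilon>\<bar> < \<epsilon>\<^sub>0 \<longrightarrow> (\<exists>U :: nat \<Rightarrow> real \<Rightarrow> real.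
            (\<forall>j\<in>{1..L}. periodic_wave P W \<epsilon> c (U j)) \<and>
            (\<forall>i\<in>{1..L}. \<forall>j\<in>{1..L}. i \<noteq> j \<longrightarrow> \<not> same_wave (U i) (U j))))"
proof -
  obtain V f g xc H s where A1: "property_A_i P W I c V f g xc"
    and A2: "property_A_ii (V 0) f xc H s" and A3: "property_A_iii (V 0) g xc H s L"
    using assms(6) by (auto simp: property_A_def)
  let ?\<Omega> = "{(x, y, \<epsilon>). \<epsilon> \<in> I \<and> (x, y) \<in> V \<epsilon>}"
  have V: "\<forall>\<epsilon>\<in>I. open (V \<epsilon>)" using A1 unfolding property_A_i_def by (elim conjE)
  have open_\<Omega>: "open ?\<Omega>" using A1 unfolding property_A_i_def by (elim conjE)
  have C1f: "C1_on (\<Union>\<epsilon>\<in>I. V \<epsilon>) f" using A1 unfolding property_A_i_def by (elim conjE)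
  have C1g: "C1_on ?\<Omega> g" using A1 unfolding property_A_i_def by (elim conjE)
  have eqn: "\<exists>\<epsilon>\<^sub>1>0. \<forall>\<epsilon>\<in>I. \<bar>\<epsilon>\<bar> < \<epsilon>\<^sub>1 \<longrightarrow>
      {(x, y, z). (x, y) \<in> V \<epsilon> \<and> z = f (x, y) + \<epsilon> * g (x, y, \<epsilon>)} \<subseteq> {w \<in> W_c W c. P_c P c w \<epsilon> = 0}"
    using A1 unfolding property_A_i_def by (elim conjE)
  have equil: "{x. (x, 0) \<in> V 0 \<and> f (x, 0) = 0} = {xc}"
    using A1 unfolding property_A_i_def by (elim conjE)
  have V0: "open (V 0)" "C1_on (V 0) f" using V C1f assms(4) by (auto intro: C1_on_subset)
  note cont_f = C1_on_imp_continuous_on[OF C1f] and cont_g = C1_on_imp_continuous_on[OF C1g]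
  interpret perturbed_wave I V f H s g xc
    by (unfold_locales; fact)
  obtain \<epsilon>\<^sub>1 where \<epsilon>\<^sub>1: "\<epsilon>\<^sub>1 > 0" "\<And>\<epsilon>. \<epsilon> \<in> I \<Longrightarrow> \<bar>\<epsilon>\<bar> < \<epsilon>\<^sub>1 \<Longrightarrow>
      {(x, y, z). (x, y) \<in> V \<epsilon> \<and> z = f (x, y) + \<epsilon> * g (x, y, \<epsilon>)} \<subseteq> {w \<in> W_c W c. P_c P c w \<epsilon> = 0}"
    using eqn by blast
  \<comment> \<open>This is the right-hand side of the perturbed equation
    \<open>U'' = k \<epsilon> (U, U')\<close>.\<close>
  define k where "k \<epsilon> q = f q + \<epsilon> * g (fst q, snd q, \<epsilon>)" for \<epsilon> q
  \<comment> \<open>The phase points with their second derivative lie on the graph that Property A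
    places inside the zero set of \<open>P_c\<close>.\<close>
  have wave: "periodic_wave P W \<epsilon> c (\<lambda>t. fst (z t))"
    if \<epsilon>: "\<epsilon> \<in> I" "\<bar>\<epsilon>\<bar> < \<epsilon>\<^sub>1" and z: "\<And>t. (z has_vector_derivative wave_field (k \<epsilon>) (z t)) (at t)"
      and inV: "\<And>t. z t \<in> V \<epsilon>" and T: "T > 0" "\<And>t. z (t + T) = z t" and nc: "snd (z t0) \<noteq> 0"
    for \<epsilon> z T t0
  proof (rule periodic_wave_of_solution[OF z _ T nc])
    have contz: "continuous_on UNIV z"
      using z by (meson continuous_at_imp_continuous_on has_vector_derivative_continuous)
    have "continuous_on UNIV (\<lambda>t. f (z t))"
      by (rule continuous_on_compose2[OF cont_f contz]) (use inV \<epsilon>(1) in auto)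
    moreover have "continuous_on UNIV (\<lambda>t. g (fst (z t), snd (z t), \<epsilon>))"
      by (rule continuous_on_compose2[OF cont_g])
        (use inV \<epsilon>(1) in \<open>auto intro!: continuous_intros contz\<close>)
    ultimately show "continuous_on UNIV (\<lambda>t. k \<epsilon> (z t))"
      unfolding k_def by (intro continuous_intros)
    fix t
    have "(fst (z t), snd (z t), k \<epsilon> (z t)) \<in>
        {(x, y, z). (x, y) \<in> V \<epsilon> \<and> z = f (x, y) + \<epsilon> * g (x, y, \<epsilon>)}"
      using inV[of t] by (simp add: k_def)
    then show "(fst (z t), snd (z t), k \<epsilon> (z t)) \<in> {w \<in> W_c W c. P_c P c w \<epsilon> = 0}"
      using \<epsilon>\<^sub>1(2)[OF \<epsilon>] by blast
  qed
  obtain hbar :: ereal and hz :: "nat \<Rightarrow> real" where "L \<ge> 1" and hbar: "hbar > 0"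
    and oval: "\<And>h. h > 0 \<Longrightarrow> ereal h < hbar \<Longrightarrow> oval_around (level_oval (V 0) H h) (xc, 0)"
    and inj: "inj_on hz {1..L}"
    and hz: "\<And>j. j \<in> {1..L} \<Longrightarrow> 0 < hz j \<and> ereal (hz j) < hbar \<and> simple_zero (melnikov (V 0) g H s) (hz j)"
    using A3 unfolding property_A_iii_def by blast
  have curve: "\<exists>r. simple_closed_param (level_oval (V 0) H h) r" if "h > 0" "ereal h < hbar" for h
    using oval[OF that] by (auto simp: oval_around_def)
  have "\<exists>a b. a < b \<and> (\<exists>U :: real \<Rightarrow> real \<Rightarrow> real. (\<forall>h\<in>{a<..<b}. periodic_wave P W 0 c (U h)) \<and>
      (\<forall>h\<in>{a<..<b}. \<forall>k\<in>{a<..<b}. h \<noteq> k \<longrightarrow> \<not> same_wave (U h) (U k)))"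
  proof -
    \<comment> \<open>The parameter interval needs a real endpoint, while \<open>hbar\<close> may be
      infinite.\<close>
    obtain b where b: "0 < b" "ereal b < hbar" using ereal_dense2[OF hbar] by (auto simp: zero_ereal_def)
    have "\<exists>z. (\<forall>t. (z has_vector_derivative wave_field f (z t)) (at t)) \<and> (\<forall>t. z t \<in> level_oval (V 0) H h) \<and>
        periodic_wave P W 0 c (\<lambda>t. fst (z t))" if h: "h \<in> {0<..<b}" for h
    proof -
      have "ereal h < hbar" using h b(2) by (auto intro: less_trans[of _ "ereal b"])
      then obtain r where r: "simple_closed_param (level_oval (V 0) H h) r" using curve[of h] h by auto
      have h0: "h > 0" using h by simp
      interpret O: hamiltonian_oval "V 0" f H s xc h "level_oval (V 0) H h" r
        using h0 r by (rule hamiltonian_oval)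
      obtain a T z where T: "T > 0" and z: "\<forall>t. (z has_vector_derivative wave_field f (z t)) (at t)"
        "\<forall>t. z t \<in> level_oval (V 0) H h" "\<forall>t. z (t + T) = z t"
        using level_orbit_from_axis[OF h0 r] by metis
      have k0: "k 0 = f" by (simp add: k_def fun_eq_iff)
      have "\<exists>t. snd (z t) \<noteq> 0"
      proof (rule ccontr)
        assume no: "\<not> (\<exists>t. snd (z t) \<noteq> 0)"
        then have "((\<lambda>t. 0) has_real_derivative f (z 0)) (at 0)"
          using solution_components(2)[OF z(1)[rule_format], of 0] by simp
        then have "f (z 0) = 0" using DERIV_const DERIV_unique by blast
        then show False
          using O.regular[of "fst (z 0)"] z(2) no by (metis prod.collapse)
      qed
      then obtain t0 where "snd (z t0) \<noteq> 0" by blast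
      moreover have "z t \<in> V 0" for t using z(2) O.subset by blast
      ultimately have "periodic_wave P W 0 c (\<lambda>t. fst (z t))"
        using wave[of 0 z T t0] z T \<epsilon>\<^sub>1(1) assms(4) k0 by simp
      then show ?thesis using z by blast
    qed
    then obtain z where z: "\<And>h t. h \<in> {0<..<b} \<Longrightarrow> (z h has_vector_derivative wave_field f (z h t)) (at t)"
      "\<And>h t. h \<in> {0<..<b} \<Longrightarrow> z h t \<in> level_oval (V 0) H h"
      "\<And>h. h \<in> {0<..<b} \<Longrightarrow> periodic_wave P W 0 c (\<lambda>t. fst (z h t))"
      by metis
    have "\<not> same_wave (\<lambda>t. fst (z h t)) (\<lambda>t. fst (z h' t))"
      if hh: "h \<in> {0<..<b}" "h' \<in> {0<..<b}" "h \<noteq> h'" for h h'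
    proof
      assume "same_wave (\<lambda>t. fst (z h t)) (\<lambda>t. fst (z h' t))"
      then obtain a where "z h' 0 = z h a"
        by (rule same_wave_meets[OF z(1)[OF hh(1)] z(1)[OF hh(2)]])
      then show False using z(2)[OF hh(1), of a] z(2)[OF hh(2), of 0] hh(3)
        by (simp add: level_oval_def)
    qed
    with z(3) b(1) show ?thesis
      by (intro exI[of _ 0] exI[of _ b] conjI exI[of _ "\<lambda>h t. fst (z h t)"]) auto
  qed
  moreover have "\<exists>\<epsilon>\<^sub>0>0. \<forall>\<epsilon>\<in>I. \<bar>\<epsilon>\<bar> < \<epsilon>\<^sub>0 \<longrightarrow> (\<exists>U :: nat \<Rightarrow> real \<Rightarrow> real.
      (\<forall>j\<in>{1..L}. periodic_wave P W \<epsilon> c (U j)) \<and>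
      (\<forall>i\<in>{1..L}. \<forall>j\<in>{1..L}. i \<noteq> j \<longrightarrow> \<not> same_wave (U i) (U j)))"
  proof -
    obtain \<kappa> where \<kappa>: "\<kappa> > 0" "\<And>i j. i \<in> {1..L} \<Longrightarrow> j \<in> {1..L} \<Longrightarrow> i \<noteq> j \<Longrightarrow> 2 * \<kappa> \<le> \<bar>hz i - hz j\<bar>"
      using separation_of_finite_family[OF _ inj] by auto
    have k_eq: "k \<epsilon> = (\<lambda>q. f q + \<epsilon> * g (fst q, snd q, \<epsilon>))" for \<epsilon> by (simp add: k_def fun_eq_iff)
    \<comment> \<open>Packing all data of an orbit into one predicate allows a choice for each
      index.\<close>
    define Q where "Q j \<epsilon> z \<longleftrightarrow> (\<exists>T. T > 0 \<and> (\<forall>t. z (t + T) = z t) \<and>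
      (\<forall>t. (z has_vector_derivative wave_field (k \<epsilon>) (z t)) (at t)) \<and>
      (\<forall>t. z t \<in> V \<epsilon> \<and> z t \<in> V 0 \<and> \<bar>H (z t) - hz j\<bar> < \<kappa>) \<and> (\<exists>t. snd (z t) \<noteq> 0))" for j \<epsilon> z
    have "\<exists>e>0. \<forall>\<epsilon>. \<bar>\<epsilon>\<bar> < e \<longrightarrow> (\<exists>z. Q j \<epsilon> z)" if j: "j \<in> {1..L}" for j
    proof -
      obtain b where b: "hz j < b" "ereal b < hbar" using ereal_dense2[of "ereal (hz j)" hbar] hz[OF j] by auto
      \<comment> \<open>This radius keeps the levels between \<open>0\<close> and \<open>b\<close>,
        hence below \<open>hbar\<close>.\<close>
      have "\<exists>r. simple_closed_param (level_oval (V 0) H h') r"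
        if h': "\<bar>h' - hz j\<bar> < min (hz j) (b - hz j)" for h'
      proof (rule curve)
        show "h' > 0" using h' by auto
        have "h' < b" using h' by auto
        then show "ereal h' < hbar" using b(2) by (auto intro: less_trans[of _ "ereal b"])
      qed
      moreover have "0 < min (hz j) (b - hz j)" using hz[OF j] b(1) by simp
      ultimately have "\<exists>e>0. \<forall>\<epsilon>. \<bar>\<epsilon>\<bar> < e \<longrightarrow> \<epsilon> \<in> I \<and> (\<exists>z. Q j \<epsilon> z)"
        unfolding Q_def k_eq using hz[OF j]
        by (intro perturbed_periodic_orbits[of "hz j" "min (hz j) (b - hz j)" \<kappa>] \<kappa>(1)) auto
      then show ?thesis by blast
    qed
    then obtain e where e: "\<And>j. j \<in> {1..L} \<Longrightarrow> e j > 0"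
      "\<And>j \<epsilon>. j \<in> {1..L} \<Longrightarrow> \<bar>\<epsilon>\<bar> < e j \<Longrightarrow> \<exists>z. Q j \<epsilon> z" by metis
    define \<epsilon>\<^sub>0 where "\<epsilon>\<^sub>0 = min \<epsilon>\<^sub>1 (Min (e ` {1..L}))"
    have pos: "\<epsilon>\<^sub>0 > 0" using \<epsilon>\<^sub>1(1) e(1) \<open>L \<ge> 1\<close> by (simp add: \<epsilon>\<^sub>0_def)
    have le: "\<epsilon>\<^sub>0 \<le> e j" if "j \<in> {1..L}" for j
      using that by (auto simp: \<epsilon>\<^sub>0_def intro!: min.coboundedI2)
    have "\<exists>U :: nat \<Rightarrow> real \<Rightarrow> real. (\<forall>j\<in>{1..L}. periodic_wave P W \<epsilon> c (U j)) \<and>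
        (\<forall>i\<in>{1..L}. \<forall>j\<in>{1..L}. i \<noteq> j \<longrightarrow> \<not> same_wave (U i) (U j))"
      if \<epsilon>: "\<epsilon> \<in> I" "\<bar>\<epsilon>\<bar> < \<epsilon>\<^sub>0" for \<epsilon>
    proof -
      have "\<exists>z. Q j \<epsilon> z" if "j \<in> {1..L}" for j using e(2)[OF that] le[OF that] \<epsilon>(2) by force
      then obtain z where Q: "\<And>j. j \<in> {1..L} \<Longrightarrow> Q j \<epsilon> (z j)" by metis
      have sol: "(z j has_vector_derivative wave_field (k \<epsilon>) (z j t)) (at t)" if "j \<in> {1..L}" for j t
        using Q[OF that] unfolding Q_def by blast
      have "periodic_wave P W \<epsilon> c (\<lambda>t. fst (z j t))" if j: "j \<in> {1..L}" for j
      proof -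
        obtain T t0 where T: "T > 0" "\<forall>t. z j (t + T) = z j t" and nc: "snd (z j t0) \<noteq> 0"
          and inV: "\<forall>t. z j t \<in> V \<epsilon>"
          using Q[OF j] unfolding Q_def by blast
        have "\<bar>\<epsilon>\<bar> < \<epsilon>\<^sub>1" using \<epsilon>(2) by (simp add: \<epsilon>\<^sub>0_def)
        from wave[OF \<epsilon>(1) this sol[OF j] inV[rule_format] T(1) T(2)[rule_format] nc]
        show ?thesis .
      qed
      moreover have "\<not> same_wave (\<lambda>t. fst (z i t)) (\<lambda>t. fst (z j t))"
        if ij: "i \<in> {1..L}" "j \<in> {1..L}" "i \<noteq> j" for i j
      proof
        assume "same_wave (\<lambda>t. fst (z i t)) (\<lambda>t. fst (z j t))"
        then obtain a where a: "z j 0 = z i a"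
          by (rule same_wave_meets[OF sol[OF ij(1)] sol[OF ij(2)]])
        \<comment> \<open>At a common point \<open>H\<close> would be within \<open>\<kappa>\<close>
          of two zeros that are at least \<open>2 * \<kappa>\<close> apart.\<close>
        have "\<bar>H (z i a) - hz i\<bar> < \<kappa>" "\<bar>H (z j 0) - hz j\<bar> < \<kappa>"
          using Q[OF ij(1)] Q[OF ij(2)] unfolding Q_def by blast+
        then show False using \<kappa>(2)[OF ij] a by auto
      qed
      ultimately show ?thesis by (intro exI[of _ "\<lambda>j t. fst (z j t)"]) blast
    qed
    with pos show ?thesis by blast
  qed
  ultimately show ?thesis by (rule conjI)
qed

end
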